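(* Let $Q$ be a Dynkin quiver, $k$ an algebraically closed field, $\Pi$ the preprojective algebra of $Q$, $W$ its Weyl group and $w_0$ the longest element of $W$. Let $w\in W$. Then: (1) $DI_w\cong\Pi/I_{w_0w^{-1}}$ in $\operatorname{mod}\Pi^{\mathrm{op}}$ (that is, as left $\Pi$-modules); (2) $DI_w\cong\Pi/I_{w^{-1}w_0}$ in $\operatorname{mod}\Pi$ (that is, as right $\Pi$-modules).
   Context: $D=\operatorname{Hom}_k(-,k)$. $\operatorname{mod}\Pi$ denotes finitely generated right $\Pi$-modules and $\operatorname{mod}\Pi^{\mathrm{op}}$ finitely generated left $\Pi$-modules. $W$ is generated by simple reflections $s_i$ indexed by the vertices of $Q$. $\Pi=k\overline Q/(\sum_a(aa^*-a^*a))$, where $\overline Q$ is obtained from $Q$ by adding an opposite arrow $a^*$ for each arrow $a$. $I_i=\Pi(1-e_i)\Pi$ and, for a reduced expression $w=s_{i_1}\cdots s_{i_t}$, $I_w=I_{i_t}\cdots I_{i_1}$ (a well-defined two-sided ideal; note the reversed order of the product). *)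

theory Defs
  imports
    "HOL-Algebra.QuotRing"
    "HOL-Algebra.Ideal_Product"
    "HOL-Algebra.Bij"
    "HOL-Algebra.Generated_Groups"
    "HOL-Algebra.Module"
    "HOL-Computational_Algebra.Polynomial"
    "Graph_Theory.Arc_Walk"
begin

section \<open>Dynkin quivers\<close>

text \<open>
  A quiver is a \<^typ>\<open>('v, 'a) pre_digraph\<close>: parallel arrows are distinct elements of type \<^typ>\<open>'a\<close>.
  The simply laced connected Dynkin diagrams are given by their number of vertices \<open>n\<close> and their
  set of edges on \<open>{1..n}\<close>, in Bourbaki's numbering.
\<close>

definition dynkin_A_edges :: "nat \<Rightarrow> nat set set" where
  "dynkin_A_edges n = {{i, i + 1} | i. 1 \<le> i \<and> i < n}"

definition dynkin_D_edges :: "nat \<Rightarrow> nat set set" where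
  "dynkin_D_edges n = insert {n - 2, n} {{i, i + 1} | i. 1 \<le> i \<and> i < n - 1}"

definition dynkin_E_edges :: "nat \<Rightarrow> nat set set" where
  "dynkin_E_edges n = {{1, 3}, {3, 4}, {2, 4}} \<union> {{i, i + 1} | i. 4 \<le> i \<and> i < n}"

definition dynkin_diagrams :: "(nat \<times> nat set set) set" where
  "dynkin_diagrams =
     {(n, dynkin_A_edges n) | n. n \<ge> 1} \<union>
     {(n, dynkin_D_edges n) | n. n \<ge> 4} \<union>
     {(n, dynkin_E_edges n) | n. n \<in> {6, 7, 8}}"

text \<open>
  The second bijection says that the arrows correspond one-to-one to the edges of the diagram;
  this excludes loops and multiple arrows, and leaves the orientation arbitrary.
\<close>

definition dynkin_quiver :: "('v, 'a) pre_digraph \<Rightarrow> bool" where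
  "dynkin_quiver Q \<longleftrightarrow> wf_digraph Q \<and>
     (\<exists>(n, E) \<in> dynkin_diagrams. \<exists>f. bij_betw f (verts Q) {1..n} \<and>
        bij_betw (\<lambda>a. {f (tail Q a), f (head Q a)}) (arcs Q) E)"


section \<open>The Weyl group\<close>

text \<open>
  The Weyl group is realised as the group generated by the simple reflections of the root lattice
  \<open>\<int>Q\<^sub>0\<close>, an element \<open>\<Sum>\<^sub>j x\<^sub>j \<alpha>\<^sub>j\<close> of which is the function \<open>j \<mapsto> x\<^sub>j\<close> (extended by \<open>0\<close> outside \<open>Q\<^sub>0\<close>).
\<close>

definition cartan_matrix :: "('v, 'a) pre_digraph \<Rightarrow> 'v \<Rightarrow> 'v \<Rightarrow> int" where
  "cartan_matrix Q i j =
     (if i = j then 2 else - int (card {a \<in> arcs Q. {tail Q a, head Q a} = {i, j}}))"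

definition root_lattice :: "('v, 'a) pre_digraph \<Rightarrow> ('v \<Rightarrow> int) set" where
  "root_lattice Q = {x. \<forall>v. v \<notin> verts Q \<longrightarrow> x v = 0}"

definition simple_reflection :: "('v, 'a) pre_digraph \<Rightarrow> 'v \<Rightarrow> ('v \<Rightarrow> int) \<Rightarrow> ('v \<Rightarrow> int)" where
  "simple_reflection Q i =
     (\<lambda>x \<in> root_lattice Q. x(i := x i - (\<Sum>j\<in>verts Q. cartan_matrix Q i j * x j)))"

definition weyl_group :: "('v, 'a) pre_digraph \<Rightarrow> (('v \<Rightarrow> int) \<Rightarrow> ('v \<Rightarrow> int)) monoid" where
  "weyl_group Q = subgroup_generated (BijGroup (root_lattice Q)) (simple_reflection Q ` verts Q)"

text \<open>\<open>[i\<^sub>1, \<dots>, i\<^sub>t]\<close> is sent to \<open>s\<^sub>i\<^sub>1 \<cdots> s\<^sub>i\<^sub>t\<close>, where products are compositions of maps, so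
  that \<open>s\<^sub>i\<^sub>t\<close> is applied first.\<close>

definition word_element :: "('v, 'a) pre_digraph \<Rightarrow> 'v list \<Rightarrow> (('v \<Rightarrow> int) \<Rightarrow> ('v \<Rightarrow> int))" where
  "word_element Q u =
     foldr (\<lambda>i g. simple_reflection Q i \<otimes>\<^bsub>weyl_group Q\<^esub> g) u \<one>\<^bsub>weyl_group Q\<^esub>"

definition weyl_length :: "('v, 'a) pre_digraph \<Rightarrow> (('v \<Rightarrow> int) \<Rightarrow> ('v \<Rightarrow> int)) \<Rightarrow> nat" where
  "weyl_length Q w = (LEAST n. \<exists>u. set u \<subseteq> verts Q \<and> word_element Q u = w \<and> length u = n)"

definition reduced_expression ::
    "('v, 'a) pre_digraph \<Rightarrow> (('v \<Rightarrow> int) \<Rightarrow> ('v \<Rightarrow> int)) \<Rightarrow> 'v list \<Rightarrow> bool" where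
  "reduced_expression Q w u \<longleftrightarrow>
     set u \<subseteq> verts Q \<and> word_element Q u = w \<and> length u = weyl_length Q w"

definition longest_element ::
    "('v, 'a) pre_digraph \<Rightarrow> (('v \<Rightarrow> int) \<Rightarrow> ('v \<Rightarrow> int)) \<Rightarrow> bool" where
  "longest_element Q w \<longleftrightarrow> w \<in> carrier (weyl_group Q) \<and>
     (\<forall>v \<in> carrier (weyl_group Q). weyl_length Q v \<le> weyl_length Q w)"


section \<open>Path algebras\<close>

text \<open>
  A path is a pair of its starting vertex and its list of arrows, in the order in which they are
  travelled; \<open>(v, [])\<close> is the trivial path at \<open>v\<close>. An element of the path algebra is the function
  giving its coefficients. The product \<open>pq\<close> of paths is \<open>p\<close> followed by \<open>q\<close>, so the
  coefficient of a path in \<open>f g\<close> is a sum over the ways of cutting that path in two.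

  The ground field is the type passed as the first argument \<open>k = TYPE('k)\<close>.
\<close>

definition paths :: "('v, 'a) pre_digraph \<Rightarrow> ('v \<times> 'a list) set" where
  "paths Q = {(u, p). \<exists>v. pre_digraph.awalk Q u p v}"

definition path_algebra ::
    "'k::field itself \<Rightarrow> ('v, 'a) pre_digraph \<Rightarrow> ('k, 'v \<times> 'a list \<Rightarrow> 'k) module" where
  "path_algebra k Q =
     \<lparr>carrier = {f. finite {x. f x \<noteq> 0} \<and> {x. f x \<noteq> 0} \<subseteq> paths Q},
      monoid.mult = (\<lambda>f g. \<lambda>(u, p). \<Sum>i\<le>length p.
                f (u, take i p) * g (pre_digraph.awlast Q u (take i p), drop i p)),
      one = (\<lambda>(u, p). if u \<in> verts Q \<and> p = [] then 1 else 0),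
      zero = (\<lambda>x. 0),
      add = (\<lambda>f g x. f x + g x),
      module.smult = (\<lambda>c f x. c * f x)\<rparr>"

definition path_elem :: "'k::field itself \<Rightarrow> 'v \<times> 'a list \<Rightarrow> ('v \<times> 'a list \<Rightarrow> 'k)" where
  "path_elem k p = (\<lambda>x. if x = p then 1 else 0)"


section \<open>Preprojective algebras\<close>

text \<open>In the double quiver, \<open>(a, False)\<close> is the arrow \<open>a\<close> and \<open>(a, True)\<close> is \<open>a\<^sup>*\<close>.\<close>

definition double_quiver :: "('v, 'a) pre_digraph \<Rightarrow> ('v, 'a \<times> bool) pre_digraph" where
  "double_quiver Q =
     \<lparr>verts = verts Q,
      arcs = arcs Q \<times> UNIV,
      tail = (\<lambda>(a, b). if b then head Q a else tail Q a),
      head = (\<lambda>(a, b). if b then tail Q a else head Q a)\<rparr>"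

definition preprojective_relation ::
    "'k::field itself \<Rightarrow> ('v, 'a) pre_digraph \<Rightarrow> ('v \<times> ('a \<times> bool) list \<Rightarrow> 'k)" where
  "preprojective_relation k Q =
     (let A = path_algebra k (double_quiver Q);
          arrow = (\<lambda>a. path_elem k (tail Q a, [(a, False)]));
          opp = (\<lambda>a. path_elem k (head Q a, [(a, True)]))
      in \<Oplus>\<^bsub>A\<^esub>a\<in>arcs Q. (arrow a \<otimes>\<^bsub>A\<^esub> opp a) \<ominus>\<^bsub>A\<^esub> (opp a \<otimes>\<^bsub>A\<^esub> arrow a))"

definition preprojective_ideal ::
    "'k::field itself \<Rightarrow> ('v, 'a) pre_digraph \<Rightarrow> ('v \<times> ('a \<times> bool) list \<Rightarrow> 'k) set" where
  "preprojective_ideal k Q =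
     Idl\<^bsub>path_algebra k (double_quiver Q)\<^esub> {preprojective_relation k Q}"

definition preprojective_algebra ::
    "'k::field itself \<Rightarrow> ('v, 'a) pre_digraph \<Rightarrow> ('k, ('v \<times> ('a \<times> bool) list \<Rightarrow> 'k) set) module" where
  "preprojective_algebra k Q =
     (let A = path_algebra k (double_quiver Q); J = preprojective_ideal k Q
      in \<lparr>carrier = carrier (A Quot J),
          monoid.mult = monoid.mult (A Quot J),
          one = \<one>\<^bsub>A Quot J\<^esub>,
          zero = \<zero>\<^bsub>A Quot J\<^esub>,
          add = add (A Quot J),
          module.smult = (\<lambda>c X. \<Union>x\<in>X. J +>\<^bsub>A\<^esub> (c \<odot>\<^bsub>A\<^esub> x))\<rparr>)"


section \<open>The ideals attached to Weyl group elements\<close>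

definition vertex_idempotent ::
    "'k::field itself \<Rightarrow> ('v, 'a) pre_digraph \<Rightarrow> 'v \<Rightarrow> ('v \<times> ('a \<times> bool) list \<Rightarrow> 'k) set" where
  "vertex_idempotent k Q i =
     preprojective_ideal k Q +>\<^bsub>path_algebra k (double_quiver Q)\<^esub> path_elem k (i, [])"

definition vertex_ideal ::
    "'k::field itself \<Rightarrow> ('v, 'a) pre_digraph \<Rightarrow> 'v \<Rightarrow> ('v \<times> ('a \<times> bool) list \<Rightarrow> 'k) set set" where
  "vertex_ideal k Q i =
     (let P = preprojective_algebra k Q in Idl\<^bsub>P\<^esub> {\<one>\<^bsub>P\<^esub> \<ominus>\<^bsub>P\<^esub> vertex_idempotent k Q i})"

text \<open>The word \<open>[i\<^sub>1, \<dots>, i\<^sub>t]\<close> is sent to the product in reversed order \<open>I\<^sub>i\<^sub>t \<cdots> I\<^sub>i\<^sub>1\<close>.\<close>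

primrec word_ideal ::
    "'k::field itself \<Rightarrow> ('v, 'a) pre_digraph \<Rightarrow> 'v list \<Rightarrow> ('v \<times> ('a \<times> bool) list \<Rightarrow> 'k) set set" where
  "word_ideal k Q [] = carrier (preprojective_algebra k Q)"
| "word_ideal k Q (i # u) =
     ideal_prod (preprojective_algebra k Q) (word_ideal k Q u) (vertex_ideal k Q i)"

text \<open>The ideal \<open>I\<^sub>w\<close>; it does not depend on which reduced expression of \<open>w\<close> is chosen.\<close>

definition weyl_ideal ::
    "'k::field itself \<Rightarrow> ('v, 'a) pre_digraph \<Rightarrow> (('v \<Rightarrow> int) \<Rightarrow> ('v \<Rightarrow> int)) \<Rightarrow>
     ('v \<times> ('a \<times> bool) list \<Rightarrow> 'k) set set" where
  "weyl_ideal k Q w = word_ideal k Q (SOME u. reduced_expression Q w u)"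


section \<open>Left and right modules over a \<open>k\<close>-algebra\<close>

text \<open>
  Modules over a noncommutative ring are presented by the record type \<^typ>\<open>('r, 'm) module\<close>, whose
  ring multiplication and unit play no role. For a left module, \<open>a \<odot> m\<close> is \<open>a m\<close>; for a
  right module, \<open>a \<odot> m\<close> stands for \<open>m a\<close>. In both cases a homomorphism is an
  additive map commuting with \<open>\<odot>\<close>.
\<close>

definition module_isomorphic ::
    "('r, 'c) ring_scheme \<Rightarrow> ('r, 'm) module \<Rightarrow> ('r, 'n) module \<Rightarrow> bool" where
  "module_isomorphic R M N \<longleftrightarrow>
     (\<exists>h. bij_betw h (carrier M) (carrier N) \<and>
        (\<forall>x\<in>carrier M. \<forall>y\<in>carrier M. h (x \<oplus>\<^bsub>M\<^esub> y) = h x \<oplus>\<^bsub>N\<^esub> h y) \<and>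
        (\<forall>a\<in>carrier R. \<forall>x\<in>carrier M. h (a \<odot>\<^bsub>M\<^esub> x) = a \<odot>\<^bsub>N\<^esub> h x))"

text \<open>\<open>A / I\<close> for a two-sided ideal \<open>I\<close>, on which \<open>a\<close> acts as its residue class.\<close>

definition quotient_left_module :: "('k, 'r) module \<Rightarrow> 'r set \<Rightarrow> ('r, 'r set) module" where
  "quotient_left_module A I =
     \<lparr>carrier = carrier (A Quot I), monoid.mult = undefined, one = undefined,
      zero = \<zero>\<^bsub>A Quot I\<^esub>, add = add (A Quot I),
      module.smult = (\<lambda>a X. (I +>\<^bsub>A\<^esub> a) \<otimes>\<^bsub>A Quot I\<^esub> X)\<rparr>"

definition quotient_right_module :: "('k, 'r) module \<Rightarrow> 'r set \<Rightarrow> ('r, 'r set) module" where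
  "quotient_right_module A I =
     \<lparr>carrier = carrier (A Quot I), monoid.mult = undefined, one = undefined,
      zero = \<zero>\<^bsub>A Quot I\<^esub>, add = add (A Quot I),
      module.smult = (\<lambda>a X. X \<otimes>\<^bsub>A Quot I\<^esub> (I +>\<^bsub>A\<^esub> a))\<rparr>"

text \<open>
  \<open>D I = Hom\<^sub>k(I, k)\<close>, its elements being taken to be \<^const>\<open>undefined\<close> outside \<open>I\<close>. The right action on \<open>I\<close>
  induces the left action \<open>(a f)(x) = f(x a)\<close> on \<open>D I\<close>, and the left action on \<open>I\<close> induces
  the right action \<open>(f a)(x) = f(a x)\<close>.
\<close>

definition linear_forms :: "('k::field, 'r) module \<Rightarrow> 'r set \<Rightarrow> ('r \<Rightarrow> 'k) set" where
  "linear_forms A I = {f \<in> extensional I.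
     (\<forall>x\<in>I. \<forall>y\<in>I. f (x \<oplus>\<^bsub>A\<^esub> y) = f x + f y) \<and> (\<forall>c. \<forall>x\<in>I. f (c \<odot>\<^bsub>A\<^esub> x) = c * f x)}"

definition dual_left_module :: "('k::field, 'r) module \<Rightarrow> 'r set \<Rightarrow> ('r, 'r \<Rightarrow> 'k) module" where
  "dual_left_module A I =
     \<lparr>carrier = linear_forms A I, monoid.mult = undefined, one = undefined,
      zero = (\<lambda>x\<in>I. 0), add = (\<lambda>f g. \<lambda>x\<in>I. f x + g x),
      module.smult = (\<lambda>a f. \<lambda>x\<in>I. f (x \<otimes>\<^bsub>A\<^esub> a))\<rparr>"

definition dual_right_module :: "('k::field, 'r) module \<Rightarrow> 'r set \<Rightarrow> ('r, 'r \<Rightarrow> 'k) module" where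
  "dual_right_module A I =
     \<lparr>carrier = linear_forms A I, monoid.mult = undefined, one = undefined,
      zero = (\<lambda>x\<in>I. 0), add = (\<lambda>f g. \<lambda>x\<in>I. f x + g x),
      module.smult = (\<lambda>a f. \<lambda>x\<in>I. f (a \<otimes>\<^bsub>A\<^esub> x))\<rparr>"

end

(*
  Let X I_i be the product of a two-sided ideal X of Pi with I_i; it differs from X only in the part
  ending at the vertex i, which becomes the sum of the X b over the arrows b into i.  Together with the
  mesh relations this gives the braid relations I_i I_j = I_j I_i, resp. I_i I_j I_i = I_j I_i I_j, so I_w
  is well defined by Matsumoto's theorem.  The middle exactness of the mesh complex
  Pi e_i -> (+)_b Pi e_(src b) -> Pi e_i yields, by Tits' induction on the length, that I_w is "closed
  at i" if l(s_i w) > l(w).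

  For the longest element w_0 one has I_(w_0) I_i = I_(w_0) for all i, so I_(w_0) lies in every power of the
  arrow ideal and hence vanishes.  Since the arrow ideal to the power l(w_0) lies in I_(w_0), Pi is finite
  dimensional.  By exactness Pi is self-injective; its socle at each vertex is at most one-dimensional, so a
  linear form that is nonzero on these socles is a nondegenerate Frobenius form.  It identifies D I with
  Pi modulo the right annihilator of I as left modules, and with Pi modulo the left annihilator of I as right
  modules.  Closedness and the double annihilator property show, by induction, that the right annihilator of
  I_w is I_(w_0 w^-1), and then the left annihilator of I_w is I_(w^-1 w_0).
*)

theory Submission
  imports Defs "HOL-Library.Poly_Mapping"
begin

section \<open>Algebras modulo an ideal\<close>

text \<open>Two choices shape the proof. First, no quotient is formed in the main argument: elements
  are finitely supported functions on all words, walks or not, so that multiplication is total and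
  associative on a vector space. Words that are not paths go into the ideal \<open>J\<close>, ideals
  of the quotient are ideals containing \<open>J\<close>, and equality is congruence modulo
  \<open>J\<close>. The sum of the vertex idempotents is then a unit only modulo \<open>J\<close>,
  which is why the basic locale has no unit. Second, what is specific to the mesh relations is
  condensed into one exactness axiom about right multiplication by the arrows into a vertex. It is
  verified on generators of \<open>J\<close> by deleting the last arrow of a word, and it acts
  twice: in carrying closedness across two adjacent letters, and in extending right linear maps by
  one generator at a time. The left-handed counterparts come from the Frobenius form: in finite
  dimension a form nondegenerate on one side is nondegenerate on the other, and left annihilators
  follow from right ones by the double annihilator property.\<close>

locale algebra_mod = vector_space scale
  for scale :: "'k::field \<Rightarrow> 'r::ab_group_add \<Rightarrow> 'r" (infixr "*s" 75) +
  fixes mult :: "'r \<Rightarrow> 'r \<Rightarrow> 'r" (infixl "\<star>" 70)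
    and J :: "'r set"
  assumes mult_add_left: "(x + y) \<star> z = x \<star> z + y \<star> z"
    and mult_add_right: "x \<star> (y + z) = x \<star> y + x \<star> z"
    and mult_scale_left: "(c *s x) \<star> y = c *s (x \<star> y)"
    and mult_scale_right: "x \<star> (c *s y) = c *s (x \<star> y)"
    and mult_assoc: "x \<star> y \<star> z = x \<star> (y \<star> z)"
    and subspace_J: "subspace J"
    and J_mult_left: "x \<in> J \<Longrightarrow> y \<star> x \<in> J"
    and J_mult_right: "x \<in> J \<Longrightarrow> x \<star> y \<in> J"
begin

lemma mult_zero_left [simp]: "0 \<star> x = 0"
  using mult_add_left[of 0 0 x] by simp

lemma mult_zero_right [simp]: "x \<star> 0 = 0"
  using mult_add_right[of x 0 0] by simp

lemma mult_minus_left: "(- x) \<star> y = - (x \<star> y)"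
  using mult_add_left[of x "- x" y] by (simp add: eq_neg_iff_add_eq_0 add.commute)

lemma mult_minus_right: "x \<star> (- y) = - (x \<star> y)"
  using mult_add_right[of x y "- y"] by (simp add: eq_neg_iff_add_eq_0 add.commute)

lemma mult_diff_left: "(x - y) \<star> z = x \<star> z - y \<star> z"
  using mult_add_left[of x "- y" z] by (simp add: mult_minus_left)

lemma mult_diff_right: "x \<star> (y - z) = x \<star> y - x \<star> z"
  using mult_add_right[of x y "- z"] by (simp add: mult_minus_right)

lemma mult_sum_left: "sum f A \<star> y = (\<Sum>a\<in>A. f a \<star> y)"
  by (induction A rule: infinite_finite_induct) (auto simp: mult_add_left)

lemma mult_sum_right: "x \<star> sum f A = (\<Sum>a\<in>A. x \<star> f a)"
  by (induction A rule: infinite_finite_induct) (auto simp: mult_add_right)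

definition eqv :: "'r \<Rightarrow> 'r \<Rightarrow> bool" (infix "\<approx>" 50)
  where "x \<approx> y \<longleftrightarrow> x - y \<in> J"

lemma eqv_refl [simp]: "x \<approx> x"
  using subspace_J by (simp add: eqv_def subspace_0)

lemma eqv_zero: "x \<approx> 0 \<longleftrightarrow> x \<in> J"
  by (simp add: eqv_def)

lemma eqv_sym: "x \<approx> y \<Longrightarrow> y \<approx> x"
  using subspace_neg[OF subspace_J, of "x - y"] by (simp add: eqv_def)

lemma eqv_trans [trans]: "x \<approx> y \<Longrightarrow> y \<approx> z \<Longrightarrow> x \<approx> z"
  using subspace_add[OF subspace_J, of "x - y" "y - z"] by (simp add: eqv_def)

lemma eqv_add: "x \<approx> x' \<Longrightarrow> y \<approx> y' \<Longrightarrow> x + y \<approx> x' + y'"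
  using subspace_add[OF subspace_J, of "x - x'" "y - y'"] by (simp add: eqv_def algebra_simps)

lemma eqv_scale: "x \<approx> y \<Longrightarrow> c *s x \<approx> c *s y"
  using subspace_scale[OF subspace_J, of "x - y" c] by (simp add: eqv_def scale_right_diff_distrib)

lemma eqv_sum: "(\<And>a. a \<in> A \<Longrightarrow> f a \<approx> g a) \<Longrightarrow> sum f A \<approx> sum g A"
  using subspace_sum[OF subspace_J, of A "\<lambda>a. f a - g a"] by (simp add: eqv_def sum_subtractf)

lemma eqv_mult_left: "x \<approx> y \<Longrightarrow> z \<star> x \<approx> z \<star> y"
  using J_mult_left[of "x - y" z] by (simp add: eqv_def mult_diff_right)

lemma eqv_mult_right: "x \<approx> y \<Longrightarrow> x \<star> z \<approx> y \<star> z"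
  using J_mult_right[of "x - y" z] by (simp add: eqv_def mult_diff_left)

text \<open>Two-sided ideals of the quotient, encoded by their full preimages. The condition
  \<open>J \<subseteq> X\<close> makes membership invariant under \<open>\<approx>\<close>.\<close>

definition two_sided :: "'r set \<Rightarrow> bool" where
  "two_sided X \<longleftrightarrow> subspace X \<and> J \<subseteq> X \<and> (\<forall>x\<in>X. \<forall>y. x \<star> y \<in> X \<and> y \<star> x \<in> X)"

lemma two_sidedD:
  assumes "two_sided X"
  shows "subspace X" "J \<subseteq> X" "x \<in> X \<Longrightarrow> x \<star> y \<in> X" "x \<in> X \<Longrightarrow> y \<star> x \<in> X"
  using assms unfolding two_sided_def by auto

lemma eqv_mem: "subspace X \<Longrightarrow> J \<subseteq> X \<Longrightarrow> x \<approx> y \<Longrightarrow> y \<in> X \<Longrightarrow> x \<in> X"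
  using subspace_add[of X "x - y" y] by (auto simp: eqv_def)

lemma two_sided_eqv: "two_sided X \<Longrightarrow> x \<approx> y \<Longrightarrow> y \<in> X \<Longrightarrow> x \<in> X"
  using eqv_mem two_sidedD by blast

lemma two_sided_J: "two_sided J"
  unfolding two_sided_def using subspace_J J_mult_left J_mult_right by auto

lemma two_sided_UNIV: "two_sided UNIV"
  unfolding two_sided_def by auto

lemma two_sided_span:
  assumes "\<And>x y. x \<in> S \<Longrightarrow> x \<star> y \<in> span (J \<union> S)" "\<And>x y. x \<in> S \<Longrightarrow> y \<star> x \<in> span (J \<union> S)"
  shows "two_sided (span (J \<union> S))"
proof -
  have "x \<star> y \<in> span (J \<union> S) \<and> y \<star> x \<in> span (J \<union> S)" if "x \<in> span (J \<union> S)" for x y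
    using that
  proof (induction rule: span_induct_alt)
    case base
    then show ?case by (simp add: span_zero)
  next
    case (step c x z)
    then have "x \<star> y \<in> span (J \<union> S) \<and> y \<star> x \<in> span (J \<union> S)"
      using assms J_mult_left J_mult_right span_base by auto
    then show ?case
      using step by (simp add: mult_add_left mult_add_right mult_scale_left mult_scale_right
          span_add span_scale)
  qed
  then show ?thesis
    unfolding two_sided_def by (auto intro: span_base)
qed

text \<open>The spanning set contains \<open>J\<close>, so that the product of two ideals is again a
  full preimage.\<close>

definition iprod :: "'r set \<Rightarrow> 'r set \<Rightarrow> 'r set" where
  "iprod X Y = span (J \<union> {x \<star> y | x y. x \<in> X \<and> y \<in> Y})"

lemma J_subset_iprod: "J \<subseteq> iprod X Y"
  unfolding iprod_def by (auto intro: span_base)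

lemma subspace_iprod: "subspace (iprod X Y)"
  unfolding iprod_def by (rule subspace_span)

lemma mult_in_iprod: "x \<in> X \<Longrightarrow> y \<in> Y \<Longrightarrow> x \<star> y \<in> iprod X Y"
  unfolding iprod_def by (rule span_base) auto

lemma iprod_least:
  assumes "subspace Z" "J \<subseteq> Z" "\<And>x y. x \<in> X \<Longrightarrow> y \<in> Y \<Longrightarrow> x \<star> y \<in> Z"
  shows "iprod X Y \<subseteq> Z"
  unfolding iprod_def using assms by (intro span_minimal) auto

lemma two_sided_iprod:
  assumes "two_sided X" "two_sided Y"
  shows "two_sided (iprod X Y)"
  unfolding iprod_def
proof (rule two_sided_span)
  fix x y assume "x \<in> {x \<star> y |x y. x \<in> X \<and> y \<in> Y}"
  then obtain a b where x: "x = a \<star> b" "a \<in> X" "b \<in> Y" by auto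
  have "a \<star> (b \<star> y) \<in> iprod X Y" "(y \<star> a) \<star> b \<in> iprod X Y"
    using x assms by (auto intro!: mult_in_iprod dest: two_sidedD)
  then show "x \<star> y \<in> span (J \<union> {x \<star> y |x y. x \<in> X \<and> y \<in> Y})"
    "y \<star> x \<in> span (J \<union> {x \<star> y |x y. x \<in> X \<and> y \<in> Y})"
    using x by (auto simp: mult_assoc iprod_def)
qed

lemma iprod_subset_left: "two_sided X \<Longrightarrow> iprod X Y \<subseteq> X"
  by (intro iprod_least) (auto dest: two_sidedD)

lemma iprod_subset_right: "two_sided Y \<Longrightarrow> iprod X Y \<subseteq> Y"
  by (intro iprod_least) (auto dest: two_sidedD)

lemma iprod_mono: "X \<subseteq> X' \<Longrightarrow> Y \<subseteq> Y' \<Longrightarrow> iprod X Y \<subseteq> iprod X' Y'"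
  unfolding iprod_def by (intro span_mono) auto

lemma subspace_left_preimage: "subspace Z \<Longrightarrow> subspace {x. x \<star> y \<in> Z}"
  unfolding subspace_def by (auto simp: mult_add_left mult_scale_left)

lemma subspace_right_preimage: "subspace Z \<Longrightarrow> subspace {x. y \<star> x \<in> Z}"
  unfolding subspace_def by (auto simp: mult_add_right mult_scale_right)

text \<open>Makes the solvability of x = sum of the F b (y b) modulo Z a linear condition on x, so
  that splitting off a last or first arrow need only be checked on spanning elements.\<close>

lemma subspace_combinations:
  assumes X: "subspace X" and Z: "subspace Z"
    and F: "\<And>b x y. F b (x + y) = F b x + F b y" "\<And>b c x. F b (c *s x) = c *s F b x"
  shows "subspace {x. \<exists>y. (\<forall>b. y b \<in> X) \<and> x - (\<Sum>b\<in>S. F b (y b)) \<in> Z}"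
proof (rule subspaceI)
  have "F b 0 = 0" for b using F(2)[of b 0 0] by simp
  then show "0 \<in> {x. \<exists>y. (\<forall>b. y b \<in> X) \<and> x - (\<Sum>b\<in>S. F b (y b)) \<in> Z}"
    using subspace_0[OF X] subspace_0[OF Z] by (auto intro!: exI[of _ "\<lambda>_. 0"])
next
  fix x x'
  assume "x \<in> {x. \<exists>y. (\<forall>b. y b \<in> X) \<and> x - (\<Sum>b\<in>S. F b (y b)) \<in> Z}"
    "x' \<in> {x. \<exists>y. (\<forall>b. y b \<in> X) \<and> x - (\<Sum>b\<in>S. F b (y b)) \<in> Z}"
  then obtain y y' where y: "\<And>b. y b \<in> X" "x - (\<Sum>b\<in>S. F b (y b)) \<in> Z"
    and y': "\<And>b. y' b \<in> X" "x' - (\<Sum>b\<in>S. F b (y' b)) \<in> Z" by blast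
  have "(x + x') - (\<Sum>b\<in>S. F b (y b + y' b)) \<in> Z"
    using subspace_add[OF Z y(2) y'(2)] by (simp add: F(1) sum.distrib algebra_simps)
  then show "x + x' \<in> {x. \<exists>y. (\<forall>b. y b \<in> X) \<and> x - (\<Sum>b\<in>S. F b (y b)) \<in> Z}"
    using y(1) y'(1) subspace_add[OF X] by (intro CollectI exI[of _ "\<lambda>b. y b + y' b"]) auto
next
  fix c x assume "x \<in> {x. \<exists>y. (\<forall>b. y b \<in> X) \<and> x - (\<Sum>b\<in>S. F b (y b)) \<in> Z}"
  then obtain y where y: "\<And>b. y b \<in> X" "x - (\<Sum>b\<in>S. F b (y b)) \<in> Z" by blast
  have "c *s x - (\<Sum>b\<in>S. F b (c *s y b)) \<in> Z"
    using subspace_scale[OF Z y(2), of c] by (simp add: F(2) scale_right_diff_distrib scale_sum_right)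
  then show "c *s x \<in> {x. \<exists>y. (\<forall>b. y b \<in> X) \<and> x - (\<Sum>b\<in>S. F b (y b)) \<in> Z}"
    using y(1) subspace_scale[OF X] by (intro CollectI exI[of _ "\<lambda>b. c *s y b"]) auto
qed

lemma iprod_assoc: "iprod (iprod X Y) Z = iprod X (iprod Y Z)"
proof
  show "iprod (iprod X Y) Z \<subseteq> iprod X (iprod Y Z)"
  proof (rule iprod_least[OF subspace_iprod J_subset_iprod])
    fix p z assume "p \<in> iprod X Y" and z: "z \<in> Z"
    moreover have "iprod X Y \<subseteq> {p. p \<star> z \<in> iprod X (iprod Y Z)}"
    proof (rule iprod_least[OF subspace_left_preimage[OF subspace_iprod]])
      show "J \<subseteq> {p. p \<star> z \<in> iprod X (iprod Y Z)}"
        using J_mult_right J_subset_iprod by blast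
      show "x \<star> y \<in> {p. p \<star> z \<in> iprod X (iprod Y Z)}" if "x \<in> X" "y \<in> Y" for x y
        using that z by (simp add: mult_assoc mult_in_iprod)
    qed
    ultimately show "p \<star> z \<in> iprod X (iprod Y Z)" by auto
  qed
  show "iprod X (iprod Y Z) \<subseteq> iprod (iprod X Y) Z"
  proof (rule iprod_least[OF subspace_iprod J_subset_iprod])
    fix x p assume x: "x \<in> X" and "p \<in> iprod Y Z"
    moreover have "iprod Y Z \<subseteq> {p. x \<star> p \<in> iprod (iprod X Y) Z}"
    proof (rule iprod_least[OF subspace_right_preimage[OF subspace_iprod]])
      show "J \<subseteq> {p. x \<star> p \<in> iprod (iprod X Y) Z}"
        using J_mult_left J_subset_iprod by blast
      show "y \<star> z \<in> {p. x \<star> p \<in> iprod (iprod X Y) Z}" if "y \<in> Y" "z \<in> Z" for y z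
        using that x by (simp add: mult_assoc[symmetric] mult_in_iprod)
    qed
    ultimately show "x \<star> p \<in> iprod (iprod X Y) Z" by auto
  qed
qed

end

section \<open>Mesh algebras\<close>

text \<open>
  \<open>J\<close> is an ideal of an algebra \<open>'r\<close>, and all statements are about \<open>'r / J\<close>, which is never formed.
  The sets \<open>D n\<close> are the powers of the arrow ideal. The axiom \<open>exact\<close> says that the complex
  \<open>\<Pi> e\<^sub>i \<rightarrow> \<Oplus>\<^sub>b \<Pi> e\<^bsub>src b\<^esub> \<rightarrow> \<Pi> e\<^sub>i\<close> is exact in the middle, where \<open>b\<close> runs over the arrows into \<open>i\<close>.
\<close>

locale mesh_algebra = algebra_mod scale mult J
  for scale :: "'k::field \<Rightarrow> 'r::ab_group_add \<Rightarrow> 'r" (infixr "*s" 75)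
    and mult :: "'r \<Rightarrow> 'r \<Rightarrow> 'r" (infixl "\<star>" 70) and J +
  fixes V :: "'v set" and B :: "'b set" and src tgt :: "'b \<Rightarrow> 'v" and rev_arrow :: "'b \<Rightarrow> 'b"
    and \<tau> :: "'b \<Rightarrow> 'k" and e :: "'v \<Rightarrow> 'r" and ar :: "'b \<Rightarrow> 'r" and D :: "nat \<Rightarrow> 'r set"
  assumes finite_V: "finite V" and finite_B: "finite B"
    and src_in_V: "b \<in> B \<Longrightarrow> src b \<in> V" and tgt_in_V: "b \<in> B \<Longrightarrow> tgt b \<in> V"
    and rev_in_B: "b \<in> B \<Longrightarrow> rev_arrow b \<in> B"
    and src_rev: "b \<in> B \<Longrightarrow> src (rev_arrow b) = tgt b"
    and tgt_rev: "b \<in> B \<Longrightarrow> tgt (rev_arrow b) = src b"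
    and rev_rev: "b \<in> B \<Longrightarrow> rev_arrow (rev_arrow b) = b"
    and no_loops: "b \<in> B \<Longrightarrow> src b \<noteq> tgt b"
    and simply_laced: "b \<in> B \<Longrightarrow> c \<in> B \<Longrightarrow> src b = src c \<Longrightarrow> tgt b = tgt c \<Longrightarrow> b = c"
    and \<tau>_nz: "b \<in> B \<Longrightarrow> \<tau> b \<noteq> 0"
    and e_idem: "i \<in> V \<Longrightarrow> e i \<star> e i = e i"
    and e_orth: "i \<in> V \<Longrightarrow> j \<in> V \<Longrightarrow> i \<noteq> j \<Longrightarrow> e i \<star> e j = 0"
    and right_unit: "x \<star> (\<Sum>v\<in>V. e v) \<approx> x" and left_unit: "(\<Sum>v\<in>V. e v) \<star> x \<approx> x"
    and e_src: "b \<in> B \<Longrightarrow> e (src b) \<star> ar b = ar b"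
    and e_tgt: "b \<in> B \<Longrightarrow> ar b \<star> e (tgt b) = ar b"
    and D_0: "D 0 = UNIV" and subspace_D: "subspace (D n)" and J_subset_D: "J \<subseteq> D n"
    and D_mult: "x \<in> D m \<Longrightarrow> y \<in> D n \<Longrightarrow> x \<star> y \<in> D (m + n)"
    and D_antimono: "D (Suc n) \<subseteq> D n"
    and ar_in_D: "b \<in> B \<Longrightarrow> ar b \<in> D 1"
    and D_right: "x \<in> D (Suc n) \<Longrightarrow> \<exists>y. (\<forall>b. y b \<in> D n) \<and> x \<approx> (\<Sum>b\<in>B. y b \<star> ar b)"
    and D_left: "x \<in> D 1 \<Longrightarrow> \<exists>y. x \<approx> (\<Sum>b\<in>B. ar b \<star> y b)"
    and D_0_split: "\<exists>c. x - (\<Sum>v\<in>V. c v *s e v) \<in> D 1"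
    and D_Inter: "(\<And>n. x \<in> D n) \<Longrightarrow> x \<in> J"
    and mesh: "i \<in> V \<Longrightarrow> (\<Sum>b | b \<in> B \<and> tgt b = i. \<tau> b *s (ar (rev_arrow b) \<star> ar b)) \<in> J"
    and exact: "i \<in> V \<Longrightarrow> (\<Sum>b | b \<in> B \<and> tgt b = i. z b \<star> ar b) \<in> J \<Longrightarrow>
      \<exists>x. \<forall>b. b \<in> B \<and> tgt b = i \<longrightarrow> z b \<star> e (src b) \<approx> \<tau> b *s (x \<star> ar (rev_arrow b))"
begin

section \<open>Vertex components and the ideals generated by vertex idempotents\<close>

abbreviation into :: "'v \<Rightarrow> 'b set" where "into i \<equiv> {b \<in> B. tgt b = i}"

lemma finite_into [simp]: "finite (into i)"
  using finite_B by simp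

lemma e_ar: "i \<in> V \<Longrightarrow> b \<in> B \<Longrightarrow> e i \<star> ar b = (if i = src b then ar b else 0)"
  by (metis e_orth e_src mult_assoc mult_zero_left src_in_V)

lemma ar_e: "i \<in> V \<Longrightarrow> b \<in> B \<Longrightarrow> ar b \<star> e i = (if i = tgt b then ar b else 0)"
  by (metis e_orth e_tgt mult_assoc mult_zero_right tgt_in_V)

lemma sum_mult_e: "x \<approx> (\<Sum>v\<in>V. x \<star> e v)"
  using eqv_sym[OF right_unit[of x]] by (simp add: mult_sum_right)

lemma sum_e_mult: "x \<approx> (\<Sum>v\<in>V. e v \<star> x)"
  using eqv_sym[OF left_unit[of x]] by (simp add: mult_sum_left)

lemma D_Suc_0_le: "x \<in> D 1 \<Longrightarrow> \<exists>y. x \<approx> (\<Sum>b\<in>B. y b \<star> ar b)"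
  using D_right[of x 0] by auto

text \<open>The scalar is the coefficient of x at e i modulo \<open>D 1\<close>; right
  multiplication by e i kills the other idempotents and all arrows not ending at i.\<close>

lemma right_decomp:
  assumes i: "i \<in> V"
  shows "\<exists>c y. x \<star> e i \<approx> c *s e i + (\<Sum>b\<in>into i. y b \<star> ar b)"
proof -
  obtain c where "x - (\<Sum>v\<in>V. c v *s e v) \<in> D 1" using D_0_split by blast
  then obtain y where "x - (\<Sum>v\<in>V. c v *s e v) \<approx> (\<Sum>b\<in>B. y b \<star> ar b)"
    using D_Suc_0_le by blast
  then have "x \<approx> (\<Sum>v\<in>V. c v *s e v) + (\<Sum>b\<in>B. y b \<star> ar b)"
    by (simp add: eqv_def algebra_simps)
  then have "x \<star> e i \<approx> ((\<Sum>v\<in>V. c v *s e v) + (\<Sum>b\<in>B. y b \<star> ar b)) \<star> e i"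
    by (rule eqv_mult_right)
  also have "((\<Sum>v\<in>V. c v *s e v) + (\<Sum>b\<in>B. y b \<star> ar b)) \<star> e i
      = (\<Sum>v\<in>V. c v *s (e v \<star> e i)) + (\<Sum>b\<in>B. y b \<star> (ar b \<star> e i))"
    by (simp add: mult_add_left mult_sum_left mult_scale_left mult_assoc)
  also have "(\<Sum>v\<in>V. c v *s (e v \<star> e i)) = (\<Sum>v\<in>V. if v = i then c i *s e i else 0)"
    using i by (intro sum.cong) (auto simp: e_idem e_orth)
  also have "\<dots> = c i *s e i"
    using i finite_V by (simp add: sum.delta)
  also have "(\<Sum>b\<in>B. y b \<star> (ar b \<star> e i)) = (\<Sum>b\<in>into i. y b \<star> ar b)"
    using i finite_B by (intro sum.mono_neutral_cong_right) (auto simp: ar_e)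
  finally show ?thesis by blast
qed

text \<open>The ideal generated by the e v with v outside S. For S = {i} it is the ideal of 1 - e i,
  that is I_i; two-element sets S give the common value of both sides of a braid relation.\<close>

definition K :: "'v set \<Rightarrow> 'r set" where
  "K S = span (J \<union> {x \<star> e v \<star> y | x v y. v \<in> V - S})"

lemma two_sided_K: "two_sided (K S)"
  unfolding K_def
proof (rule two_sided_span)
  fix x y assume "x \<in> {x \<star> e v \<star> y |x v y. v \<in> V - S}"
  then obtain a v b where x: "x = a \<star> e v \<star> b" "v \<in> V - S" by blast
  then have "x \<star> y = a \<star> e v \<star> (b \<star> y)" "y \<star> x = (y \<star> a) \<star> e v \<star> b"
    by (auto simp: mult_assoc)
  with x show "x \<star> y \<in> span (J \<union> {x \<star> e v \<star> y |x v y. v \<in> V - S})"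
    "y \<star> x \<in> span (J \<union> {x \<star> e v \<star> y |x v y. v \<in> V - S})"
    by (auto intro!: span_base)
qed

lemma e_in_K: "v \<in> V - S \<Longrightarrow> e v \<in> K S"
proof -
  assume v: "v \<in> V - S"
  then have "e v = e v \<star> e v \<star> e v" by (simp add: e_idem)
  with v show ?thesis unfolding K_def by (intro span_base) blast
qed

lemma ar_in_K: "b \<in> B \<Longrightarrow> src b \<notin> S \<or> tgt b \<notin> S \<Longrightarrow> ar b \<in> K S"
  by (metis DiffI e_in_K e_src e_tgt src_in_V tgt_in_V two_sidedD(3,4) two_sided_K)

lemma K_induct:
  assumes "t \<in> K S" "subspace Z" "J \<subseteq> Z" "\<And>x v y. v \<in> V - S \<Longrightarrow> x \<star> e v \<star> y \<in> Z"
  shows "t \<in> Z"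
proof -
  have "K S \<subseteq> Z" unfolding K_def using assms by (intro span_minimal) auto
  with assms(1) show ?thesis by auto
qed

lemma K_subset:
  assumes "two_sided Z" "\<And>v. v \<in> V - S \<Longrightarrow> e v \<in> Z"
  shows "K S \<subseteq> Z"
  using two_sidedD[OF assms(1)] assms(2) by (auto elim!: K_induct)

text \<open>All e v with v different from i lie in \<open>K {i}\<close>, so membership can fail only
  at i. There the scalar part of \<open>right_decomp\<close> is killed by the factor e v of an
  element of \<open>K {i}\<close>, while every arrow into i lies in \<open>K {i}\<close> because
  there are no loops.\<close>

lemma iprod_K_iff:
  assumes X: "two_sided X" and i: "i \<in> V"
  shows "x \<in> iprod X (K {i}) \<longleftrightarrow>
    x \<in> X \<and> (\<exists>y. (\<forall>b. y b \<in> X) \<and> x \<star> e i \<approx> (\<Sum>b\<in>into i. y b \<star> ar b))"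
proof
  let ?Z = "{x \<in> X. \<exists>y. (\<forall>b. y b \<in> X) \<and> x \<star> e i \<approx> (\<Sum>b\<in>into i. y b \<star> ar b)}"
  note X' = two_sidedD[OF X]
  have J: "J \<subseteq> ?Z"
  proof
    fix x assume x: "x \<in> J"
    then have "x \<star> e i \<approx> (\<Sum>b\<in>into i. 0 \<star> ar b)" by (simp add: eqv_def J_mult_right)
    moreover have "0 \<in> X" using X' by (simp add: subspace_0)
    ultimately show "x \<in> ?Z" using x X'(2) by (auto intro!: exI[of _ "\<lambda>_. 0"])
  qed
  have "?Z = X \<inter> {x. x \<star> e i \<in> {x. \<exists>y. (\<forall>b. y b \<in> X) \<and> x - (\<Sum>b\<in>into i. y b \<star> ar b) \<in> J}}"
    by (auto simp: eqv_def)
  then have sub: "subspace ?Z"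
    using subspace_inter[OF X'(1) subspace_left_preimage[OF subspace_combinations[OF X'(1) subspace_J,
          of "\<lambda>b y. y \<star> ar b" "into i"]]]
    by (simp add: mult_add_left mult_scale_left)
  have "iprod X (K {i}) \<subseteq> ?Z"
  proof (rule iprod_least[OF sub J])
    fix x k assume x: "x \<in> X" and k: "k \<in> K {i}"
    have "k \<in> {k. x \<star> k \<in> ?Z}"
    proof (rule K_induct[OF k])
      show "subspace {k. x \<star> k \<in> ?Z}" by (rule subspace_right_preimage[OF sub])
      show "J \<subseteq> {k. x \<star> k \<in> ?Z}" using J J_mult_left by blast
      fix z v t assume v: "v \<in> V - {i}"
      obtain c y where cy: "t \<star> e i \<approx> c *s e i + (\<Sum>b\<in>into i. y b \<star> ar b)"
        using right_decomp[OF i] by blast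
      have "(x \<star> (z \<star> e v \<star> t)) \<star> e i = (x \<star> z \<star> e v) \<star> (t \<star> e i)" by (simp add: mult_assoc)
      also have "\<dots> \<approx> (x \<star> z \<star> e v) \<star> (c *s e i + (\<Sum>b\<in>into i. y b \<star> ar b))"
        by (rule eqv_mult_left[OF cy])
      also have "\<dots> = x \<star> z \<star> (c *s (e v \<star> e i)) + (\<Sum>b\<in>into i. (x \<star> z \<star> e v \<star> y b) \<star> ar b)"
        by (simp add: mult_add_right mult_scale_right mult_assoc mult_sum_right)
      also have "\<dots> = (\<Sum>b\<in>into i. (x \<star> z \<star> e v \<star> y b) \<star> ar b)"
        using v i by (simp add: e_orth)
      finally show "z \<star> e v \<star> t \<in> {k. x \<star> k \<in> ?Z}"
        using x X' by (auto intro!: exI[of _ "\<lambda>b. x \<star> z \<star> e v \<star> y b"] simp: mult_assoc)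
    qed
    then show "x \<star> k \<in> ?Z" by simp
  qed
  then show "x \<in> iprod X (K {i}) \<Longrightarrow> x \<in> X \<and> (\<exists>y. (\<forall>b. y b \<in> X) \<and> x \<star> e i \<approx> (\<Sum>b\<in>into i. y b \<star> ar b))"
    by auto
next
  assume "x \<in> X \<and> (\<exists>y. (\<forall>b. y b \<in> X) \<and> x \<star> e i \<approx> (\<Sum>b\<in>into i. y b \<star> ar b))"
  then obtain y where y: "x \<in> X" "\<And>b. y b \<in> X" "x \<star> e i \<approx> (\<Sum>b\<in>into i. y b \<star> ar b)" by auto
  have two: "two_sided (iprod X (K {i}))" using X two_sided_K two_sided_iprod by blast
  have "x \<star> e v \<in> iprod X (K {i})" if v: "v \<in> V" for v
  proof (cases "v = i")
    case True
    have "y b \<star> ar b \<in> iprod X (K {i})" if "b \<in> into i" for b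
      using that y no_loops by (auto intro!: mult_in_iprod ar_in_K)
    then have "(\<Sum>b\<in>into i. y b \<star> ar b) \<in> iprod X (K {i})"
      by (intro subspace_sum[OF subspace_iprod])
    then show ?thesis using True y(3) two two_sided_eqv by blast
  qed (use v y in \<open>auto intro!: mult_in_iprod e_in_K\<close>)
  then have "(\<Sum>v\<in>V. x \<star> e v) \<in> iprod X (K {i})"
    by (intro subspace_sum[OF subspace_iprod])
  then show "x \<in> iprod X (K {i})"
    using two two_sided_eqv sum_mult_e by blast
qed

text \<open>\<open>\<Pi> / X\<close> has no nonzero element at the vertex \<open>i\<close> that is killed by all arrows.\<close>

definition closed_at :: "'v \<Rightarrow> 'r set \<Rightarrow> bool" where
  "closed_at i X \<longleftrightarrow> (\<forall>x. (\<forall>b\<in>B. src b = i \<longrightarrow> x \<star> ar b \<in> X) \<longrightarrow> x \<star> e i \<in> X)"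

lemma closed_at_UNIV: "closed_at i UNIV"
  unfolding closed_at_def by auto

text \<open>The factor \<open>K {j}\<close> contains e i, hence the part of X ending at i survives
  the product: x e i = (x e i) e i.\<close>

lemma closed_at_iprod:
  assumes X: "two_sided X" "closed_at i X" and ij: "i \<in> V" "j \<in> V" "i \<noteq> j"
  shows "closed_at i (iprod X (K {j}))"
  unfolding closed_at_def
proof (intro allI impI)
  fix x assume "\<forall>b\<in>B. src b = i \<longrightarrow> x \<star> ar b \<in> iprod X (K {j})"
  then have "x \<star> e i \<in> X" using X iprod_subset_left unfolding closed_at_def by blast
  then have "(x \<star> e i) \<star> e i \<in> iprod X (K {j})" using ij by (intro mult_in_iprod e_in_K) auto
  then show "x \<star> e i \<in> iprod X (K {j})" using ij by (simp add: mult_assoc e_idem)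
qed

text \<open>Exactness at j turns an expression of x c through the arrows into j into a single
  element z. Closedness of X at j puts z e j into X. Then x e i is, up to the term y c e i, a
  multiple of z followed by the reverse of c, which lies in X I_i.\<close>

lemma closed_at_iprod_adjacent:
  assumes X: "two_sided X" "closed_at i X" "closed_at j X"
    and c: "c \<in> B" "src c = i" "tgt c = j"
  shows "closed_at i (iprod (iprod X (K {i})) (K {j}))"
  unfolding closed_at_def
proof (intro allI impI)
  define Y where "Y = iprod X (K {i})"
  have ij: "i \<in> V" "j \<in> V" "i \<noteq> j" using c src_in_V tgt_in_V no_loops by auto
  have Y: "two_sided Y" "Y \<subseteq> X"
    unfolding Y_def using X(1) two_sided_K two_sided_iprod iprod_subset_left by auto
  note X' = two_sidedD[OF X(1)] and Y' = two_sidedD[OF Y(1)]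
  fix x assume "\<forall>b\<in>B. src b = i \<longrightarrow> x \<star> ar b \<in> iprod (iprod X (K {i})) (K {j})"
  then have x: "x \<star> ar b \<in> iprod Y (K {j})" if "b \<in> B" "src b = i" for b
    using that unfolding Y_def by auto
  have "x \<star> ar b \<in> X" if "b \<in> B" "src b = i" for b
    using x[OF that] iprod_subset_left[OF Y(1)] Y(2) by auto
  then have xi: "x \<star> e i \<in> X" using X(2) unfolding closed_at_def by auto
  obtain y where y: "\<And>b. y b \<in> Y" "(x \<star> ar c) \<star> e j \<approx> (\<Sum>b\<in>into j. y b \<star> ar b)"
    using iprod_K_iff[OF Y(1) ij(2), THEN iffD1, OF x[OF c(1,2)]] by blast
  \<comment> \<open>The difference of the two expressions for x c, hence a cycle of the mesh complex
    at j.\<close>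
  define y' where "y' = (\<lambda>b. if b = c then x - y c else - y b)"
  have "(\<Sum>b\<in>into j. y' b \<star> ar b) = (\<Sum>b\<in>into j. (if b = c then x \<star> ar c else 0) - y b \<star> ar b)"
    by (intro sum.cong) (auto simp: y'_def mult_diff_left mult_minus_left)
  also have "\<dots> = x \<star> ar c - (\<Sum>b\<in>into j. y b \<star> ar b)"
    using c finite_B by (simp add: sum_subtractf sum.delta)
  finally have "(\<Sum>b\<in>into j. y' b \<star> ar b) \<in> J"
    using y(2) c(3) e_tgt[OF c(1)] by (simp add: mult_assoc eqv_def)
  then obtain z where z: "\<And>b. b \<in> into j \<Longrightarrow> y' b \<star> e (src b) \<approx> \<tau> b *s (z \<star> ar (rev_arrow b))"
    using exact[OF ij(2)] by blast
  \<comment> \<open>Every arrow a out of j is the reverse of some b into j, so the components of the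
    cycle control all products z a; the nonzero scalar is divided out.\<close>
  have "z \<star> ar a \<in> X" if a: "a \<in> B" "src a = j" for a
  proof -
    define b where "b = rev_arrow a"
    have b: "b \<in> into j" "rev_arrow b = a" "\<tau> b \<noteq> 0"
      using a by (auto simp: b_def rev_in_B tgt_rev rev_rev \<tau>_nz)
    have "y' b \<star> e (src b) \<in> X"
      using xi X'(3)[OF subsetD[OF Y(2) y(1)]] subspace_diff[OF X'(1)] subspace_neg[OF X'(1)] c
      by (simp add: y'_def mult_diff_left mult_minus_left)
    then have "\<tau> b *s (z \<star> ar a) \<in> X"
      using z[OF b(1)] b(2) two_sided_eqv[OF X(1) eqv_sym] by auto
    then have "inverse (\<tau> b) *s (\<tau> b *s (z \<star> ar a)) \<in> X" using X'(1) subspace_scale by blast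
    then show ?thesis using b(3) by simp
  qed
  then have zj: "z \<star> e j \<in> X" using X(3) unfolding closed_at_def by auto
  have rc: "rev_arrow c \<in> B" "src (rev_arrow c) = j" "tgt (rev_arrow c) = i"
    using c by (auto simp: rev_in_B src_rev tgt_rev)
  have "(z \<star> e j) \<star> ar (rev_arrow c) \<in> Y"
    unfolding Y_def using zj rc ij by (intro mult_in_iprod ar_in_K) auto
  then have "z \<star> ar (rev_arrow c) \<in> Y" using rc ij by (simp add: mult_assoc e_ar)
  then have "\<tau> c *s (z \<star> ar (rev_arrow c)) + y c \<star> e i \<in> Y"
    using Y' y by (simp add: subspace_add subspace_scale)
  moreover have "x \<star> e i \<approx> \<tau> c *s (z \<star> ar (rev_arrow c)) + y c \<star> e i"
    using z[of c] c by (simp add: y'_def eqv_def mult_diff_left algebra_simps)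
  ultimately have "x \<star> e i \<in> Y" using two_sided_eqv[OF Y(1)] by blast
  then have "(x \<star> e i) \<star> e i \<in> iprod Y (K {j})" using ij by (intro mult_in_iprod e_in_K) auto
  then show "x \<star> e i \<in> iprod (iprod X (K {i})) (K {j})" using ij by (simp add: mult_assoc e_idem Y_def)
qed

section \<open>Braid relations for the vertex ideals\<close>

lemma connect_nonadjacent:
  assumes ij: "i \<in> V" "j \<in> V" "i \<noteq> j" and na: "\<And>b. b \<in> B \<Longrightarrow> src b = j \<Longrightarrow> tgt b = i \<Longrightarrow> False"
  shows "e j \<star> x \<star> e i \<in> K {i, j}"
proof -
  obtain c y where cy: "x \<star> e i \<approx> c *s e i + (\<Sum>b\<in>into i. y b \<star> ar b)"
    using right_decomp[OF ij(1)] by blast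
  \<comment> \<open>Such an arrow starts outside {i, j}: not at i, as there are no loops, and not at
    j, by \<open>na\<close>.\<close>
  have "ar b \<in> K {i, j}" if "b \<in> into i" for b
    using that na[of b] no_loops[of b] by (intro ar_in_K) auto
  then have "(\<Sum>b\<in>into i. e j \<star> y b \<star> ar b) \<in> K {i, j}"
    by (intro subspace_sum two_sidedD two_sided_K) auto
  moreover have "e j \<star> x \<star> e i \<approx> (\<Sum>b\<in>into i. e j \<star> y b \<star> ar b)"
    using eqv_mult_left[OF cy, of "e j"] ij
    by (simp add: mult_add_right mult_scale_right mult_sum_right e_orth mult_assoc)
  ultimately show ?thesis using two_sided_eqv[OF two_sided_K] by blast
qed

text \<open>In the mesh relation at j every other summand passes through a vertex outside {i, j}, as
  there are no loops and no second arrow from i to j.\<close>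

lemma ar_rev_ar:
  assumes c: "c \<in> B" "src c = i" "tgt c = j"
  shows "ar (rev_arrow c) \<star> ar c \<in> K {i, j}"
proof -
  have ij: "i \<in> V" "j \<in> V" "i \<noteq> j" using c src_in_V tgt_in_V no_loops by auto
  note K' = two_sidedD[OF two_sided_K[of "{i, j}"]]
  have "ar b \<in> K {i, j}" if "b \<in> into j - {c}" for b
    using that simply_laced[of b c] c no_loops[of b] by (intro ar_in_K) auto
  then have "(\<Sum>b\<in>into j - {c}. \<tau> b *s (ar (rev_arrow b) \<star> ar b)) \<in> K {i, j}"
    by (intro subspace_sum) (auto intro!: K' subspace_scale[OF K'(1)])
  moreover have "(\<Sum>b\<in>into j. \<tau> b *s (ar (rev_arrow b) \<star> ar b)) \<in> K {i, j}"
    using mesh[OF ij(2)] K'(2) by auto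
  moreover have "(\<Sum>b\<in>into j. \<tau> b *s (ar (rev_arrow b) \<star> ar b)) = \<tau> c *s (ar (rev_arrow c) \<star> ar c)
     + (\<Sum>b\<in>into j - {c}. \<tau> b *s (ar (rev_arrow b) \<star> ar b))"
    using c finite_B by (intro sum.remove) auto
  ultimately have "\<tau> c *s (ar (rev_arrow c) \<star> ar c) \<in> K {i, j}"
    using subspace_diff[OF K'(1), of "\<tau> c *s (ar (rev_arrow c) \<star> ar c)
     + (\<Sum>b\<in>into j - {c}. \<tau> b *s (ar (rev_arrow b) \<star> ar b))"] by fastforce
  then have "inverse (\<tau> c) *s \<tau> c *s (ar (rev_arrow c) \<star> ar c) \<in> K {i, j}"
    by (rule subspace_scale[OF K'(1)])
  then show ?thesis using \<tau>_nz[OF c(1)] by simp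
qed

text \<open>Modulo \<open>K {i, j}\<close> the algebra behaves like the preprojective algebra of
  type A_2, where the part from i to j is spanned by the arrow c.\<close>

lemma connect_adjacent:
  assumes c: "c \<in> B" "src c = i" "tgt c = j"
  shows "\<exists>\<mu>. e i \<star> x \<star> e j - \<mu> *s ar c \<in> K {i, j}"
proof -
  have ij: "i \<in> V" "j \<in> V" "i \<noteq> j" using c src_in_V tgt_in_V no_loops by auto
  note K' = two_sidedD[OF two_sided_K[of "{i, j}"]]
  obtain c0 y where cy: "x \<star> e j \<approx> c0 *s e j + (\<Sum>b\<in>into j. y b \<star> ar b)"
    using right_decomp[OF ij(2)] by blast
  \<comment> \<open>The coefficient of c appears on splitting a second time, now at i; the remaining
    terms end in b c with b into i and are absorbed by \<open>K {i, j}\<close>.\<close>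
  obtain \<mu> y' where \<mu>: "y c \<star> e i \<approx> \<mu> *s e i + (\<Sum>b\<in>into i. y' b \<star> ar b)"
    using right_decomp[OF ij(1)] by blast
  have "ar b \<in> K {i, j}" if "b \<in> into j - {c}" for b
    using that simply_laced[of b c] c no_loops[of b] by (intro ar_in_K) auto
  then have 1: "(\<Sum>b\<in>into j - {c}. e i \<star> y b \<star> ar b) \<in> K {i, j}"
    by (intro subspace_sum) (auto intro!: K')
  have "ar b \<star> ar c \<in> K {i, j}" if b: "b \<in> into i" for b
  proof (cases "src b = j")
    case True
    then have "b = rev_arrow c" using simply_laced[of b "rev_arrow c"] b c
      by (auto simp: rev_in_B src_rev tgt_rev)
    then show ?thesis using ar_rev_ar[OF c] by simp
  next
    case False
    then have "ar b \<in> K {i, j}" using b no_loops by (intro ar_in_K) auto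
    then show ?thesis by (rule K')
  qed
  then have 2: "(\<Sum>b\<in>into i. e i \<star> y' b \<star> (ar b \<star> ar c)) \<in> K {i, j}"
    by (intro subspace_sum[OF K'(1)]) (rule K'(4))
  have "e i \<star> x \<star> e j \<approx> e i \<star> (c0 *s e j + (\<Sum>b\<in>into j. y b \<star> ar b))"
    using eqv_mult_left[OF cy, of "e i"] by (simp add: mult_assoc)
  also have "\<dots> = (\<Sum>b\<in>into j. e i \<star> y b \<star> ar b)"
    using ij by (simp add: mult_add_right mult_scale_right mult_sum_right e_orth mult_assoc)
  also have "\<dots> = e i \<star> (y c \<star> e i) \<star> ar c + (\<Sum>b\<in>into j - {c}. e i \<star> y b \<star> ar b)"
    using c finite_B ij by (subst sum.remove[of _ c]) (auto simp: mult_assoc e_ar)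
  also have "\<dots> \<approx> e i \<star> (\<mu> *s e i + (\<Sum>b\<in>into i. y' b \<star> ar b)) \<star> ar c
      + (\<Sum>b\<in>into j - {c}. e i \<star> y b \<star> ar b)"
    by (intro eqv_add eqv_mult_right eqv_mult_left \<mu> eqv_refl)
  also have "\<dots> = \<mu> *s ar c + ((\<Sum>b\<in>into i. e i \<star> y' b \<star> (ar b \<star> ar c))
      + (\<Sum>b\<in>into j - {c}. e i \<star> y b \<star> ar b))"
    using ij c by (simp add: mult_add_right mult_add_left mult_scale_right mult_scale_left e_idem
        mult_sum_right mult_sum_left mult_assoc e_ar)
  finally have "e i \<star> x \<star> e j - \<mu> *s ar c \<approx> (\<Sum>b\<in>into i. e i \<star> y' b \<star> (ar b \<star> ar c))
      + (\<Sum>b\<in>into j - {c}. e i \<star> y b \<star> ar b)"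
    by (simp add: eqv_def algebra_simps)
  then show ?thesis
    using subspace_add[OF K'(1) 2 1] two_sided_eqv[OF two_sided_K] by blast
qed

text \<open>The generators e v of \<open>K S\<close> are idempotent, so \<open>K S\<close> lies in
  its own square. This is the easy inclusion in both braid relations.\<close>

lemma K_subset_iprod:
  assumes "K S \<subseteq> X" "K S \<subseteq> Y"
  shows "K S \<subseteq> iprod X Y"
proof (rule subset_trans)
  show "K S \<subseteq> iprod (K S) (K S)"
  proof (rule K_subset[OF two_sided_iprod[OF two_sided_K two_sided_K]])
    fix v assume v: "v \<in> V - S"
    then have "e v \<star> e v \<in> iprod (K S) (K S)" by (intro mult_in_iprod e_in_K)
    then show "e v \<in> iprod (K S) (K S)" using v by (simp add: e_idem)
  qed
  show "iprod (K S) (K S) \<subseteq> iprod X Y" using assms by (intro iprod_mono)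
qed

lemma K_antimono: "S \<subseteq> T \<Longrightarrow> K T \<subseteq> K S"
  unfolding K_def by (intro span_mono) auto

text \<open>Left factors are absorbed by Z, so an element of \<open>K S\<close> may be replaced by e
  v y with v outside S.\<close>

lemma K_mult_memI:
  assumes "p \<in> K S" "two_sided Z" "\<And>v y. v \<in> V - S \<Longrightarrow> e v \<star> y \<star> q \<in> Z"
  shows "p \<star> q \<in> Z"
proof -
  note Z = two_sidedD[OF assms(2)]
  have "p \<in> {p. p \<star> q \<in> Z}"
  proof (rule K_induct[OF assms(1) subspace_left_preimage[OF Z(1)]])
    show "J \<subseteq> {p. p \<star> q \<in> Z}" using J_mult_right Z(2) by auto
    show "x \<star> e v \<star> y \<in> {p. p \<star> q \<in> Z}" if "v \<in> V - S" for x v y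
      using Z(4)[OF assms(3)[OF that, of y], of x] by (simp add: mult_assoc)
  qed
  then show ?thesis by simp
qed

lemma mult_K_memI:
  assumes "q \<in> K S" "two_sided Z" "\<And>v x. v \<in> V - S \<Longrightarrow> p \<star> x \<star> e v \<in> Z"
  shows "p \<star> q \<in> Z"
proof -
  note Z = two_sidedD[OF assms(2)]
  have "q \<in> {q. p \<star> q \<in> Z}"
  proof (rule K_induct[OF assms(1) subspace_right_preimage[OF Z(1)]])
    show "J \<subseteq> {q. p \<star> q \<in> Z}" using J_mult_left Z(2) by auto
    show "x \<star> e v \<star> y \<in> {q. p \<star> q \<in> Z}" if "v \<in> V - S" for x v y
      using Z(3)[OF assms(3)[OF that, of x], of y] by (simp add: mult_assoc)
  qed
  then show ?thesis by simp
qed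

lemma iprod_K_nonadjacent:
  assumes ij: "i \<in> V" "j \<in> V" "i \<noteq> j" and na: "\<And>b. b \<in> B \<Longrightarrow> src b = j \<Longrightarrow> tgt b = i \<Longrightarrow> False"
  shows "iprod (K {i}) (K {j}) = K {i, j}"
proof
  note K' = two_sidedD[OF two_sided_K[of "{i, j}"]]
  show "K {i, j} \<subseteq> iprod (K {i}) (K {j})"
    by (intro K_subset_iprod K_antimono) auto
  show "iprod (K {i}) (K {j}) \<subseteq> K {i, j}"
  proof (rule iprod_least[OF K'(1,2)])
    fix p q assume p: "p \<in> K {i}" and q: "q \<in> K {j}"
    show "p \<star> q \<in> K {i, j}"
    proof (rule K_mult_memI[OF p two_sided_K], rule mult_K_memI[OF q two_sided_K])
      fix v y w x assume vw: "v \<in> V - {i}" "w \<in> V - {j}"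
      have "e v \<star> (y \<star> x) \<star> e w \<in> K {i, j}"
      \<comment> \<open>As v is not i and w is not j, this is the only pair inside {i, j}.\<close>
      proof (cases "v = j \<and> w = i")
        case True
        then show ?thesis using connect_nonadjacent[OF ij na] by auto
      next
        case False
        then have "e v \<in> K {i, j} \<or> e w \<in> K {i, j}" using vw e_in_K by auto
        then show ?thesis using K' by auto
      qed
      then show "e v \<star> y \<star> x \<star> e w \<in> K {i, j}" by (simp add: mult_assoc)
    qed
  qed
qed

text \<open>After reduction to idempotents only e j s e i t e j can escape \<open>K {i, j}\<close>.
  Each half is a multiple of an arrow there, and \<open>ar_rev_ar\<close> handles the product of the
  two arrows. The resulting value is symmetric in i and j.\<close>

lemma iprod_K_adjacent:
  assumes c: "c \<in> B" "src c = i" "tgt c = j"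
  shows "iprod (iprod (K {i}) (K {j})) (K {i}) = K {i, j}"
proof
  have ij: "i \<in> V" "j \<in> V" "i \<noteq> j" using c src_in_V tgt_in_V no_loops by auto
  note K' = two_sidedD[OF two_sided_K[of "{i, j}"]]
  have rc: "rev_arrow c \<in> B" "src (rev_arrow c) = j" "tgt (rev_arrow c) = i"
    using c by (auto simp: rev_in_B src_rev tgt_rev)
  show "K {i, j} \<subseteq> iprod (iprod (K {i}) (K {j})) (K {i})"
    by (intro K_subset_iprod K_antimono) auto
  have key: "e v \<star> s \<star> e w \<star> t \<star> e u \<in> K {i, j}"
    if "v \<in> V - {i}" "w \<in> V - {j}" "u \<in> V - {i}" for v w u s t
  proof (cases "v = j \<and> w = i \<and> u = j")
    case True
    obtain \<mu> where \<mu>: "e j \<star> s \<star> e i - \<mu> *s ar (rev_arrow c) \<in> K {i, j}"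
      using connect_adjacent[OF rc, of s] unfolding insert_commute[of j i] by blast
    obtain \<nu> where \<nu>: "e i \<star> t \<star> e j - \<nu> *s ar c \<in> K {i, j}"
      using connect_adjacent[OF c, of t] by blast
    have "e j \<star> s \<star> e i \<star> t \<star> e j = (e j \<star> s \<star> e i) \<star> (e i \<star> t \<star> e j)"
      using ij mult_assoc[of "e i" "e i"] by (simp add: mult_assoc e_idem)
    \<comment> \<open>Telescoping: the two factors are replaced by their arrow parts one after the
      other.\<close>
    also have "\<dots> = (e j \<star> s \<star> e i - \<mu> *s ar (rev_arrow c)) \<star> (e i \<star> t \<star> e j)
        + (\<mu> *s ar (rev_arrow c)) \<star> (e i \<star> t \<star> e j - \<nu> *s ar c)
        + (\<mu> * \<nu>) *s (ar (rev_arrow c) \<star> ar c)"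
      by (simp add: mult_diff_left mult_diff_right mult_scale_left mult_scale_right
          scale_right_diff_distrib)
    also have "\<dots> \<in> K {i, j}"
      using subspace_add[OF K'(1) subspace_add[OF K'(1) K'(3)[OF \<mu>] K'(4)[OF \<nu>]]
          subspace_scale[OF K'(1) ar_rev_ar[OF c]]] .
    finally show ?thesis using True by simp
  next
    case False
    then have "e v \<in> K {i, j} \<or> e w \<in> K {i, j} \<or> e u \<in> K {i, j}" using that e_in_K by auto
    then show ?thesis using K' by auto
  qed
  have key: "p \<star> q \<star> t \<in> K {i, j}" if p: "p \<in> K {i}" and q: "q \<in> K {j}" and t: "t \<in> K {i}" for p q t
    unfolding mult_assoc
  proof (rule K_mult_memI[OF p two_sided_K], unfold mult_assoc[symmetric], rule mult_K_memI[OF t two_sided_K])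
    fix v y u x assume vu: "v \<in> V - {i}" "u \<in> V - {i}"
    have "q \<star> (x \<star> e u) \<in> {z. (e v \<star> y) \<star> z \<in> K {i, j}}"
    proof -
      have "q \<in> {q. q \<star> (x \<star> e u) \<in> {z. (e v \<star> y) \<star> z \<in> K {i, j}}}"
      proof (rule K_induct[OF q subspace_left_preimage[OF subspace_right_preimage[OF K'(1)]]])
        show "J \<subseteq> {q. q \<star> (x \<star> e u) \<in> {z. (e v \<star> y) \<star> z \<in> K {i, j}}}"
          using J_mult_left J_mult_right K'(2) by blast
        show "x' \<star> e w \<star> y' \<in> {q. q \<star> (x \<star> e u) \<in> {z. (e v \<star> y) \<star> z \<in> K {i, j}}}"
          if "w \<in> V - {j}" for x' w y'
          using key[OF vu(1) that vu(2), of "y \<star> x'" "y' \<star> x"] by (simp add: mult_assoc)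
      qed
      then show ?thesis by simp
    qed
    then show "e v \<star> y \<star> q \<star> x \<star> e u \<in> K {i, j}" by (simp add: mult_assoc)
  qed
  show "iprod (iprod (K {i}) (K {j})) (K {i}) \<subseteq> K {i, j}"
  proof (rule iprod_least[OF K'(1,2)])
    fix r t assume r: "r \<in> iprod (K {i}) (K {j})" and t: "t \<in> K {i}"
    have "iprod (K {i}) (K {j}) \<subseteq> {r. r \<star> t \<in> K {i, j}}"
      by (rule iprod_least[OF subspace_left_preimage[OF K'(1)]]) (use J_mult_right K'(2) key t in auto)
    with r show "r \<star> t \<in> K {i, j}" by auto
  qed
qed

lemma iprod_K_idem: "iprod (K S) (K S) = K S"
  by (intro equalityI iprod_subset_left[OF two_sided_K] K_subset_iprod order_refl)

end


section \<open>Linear forms\<close>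

context algebra_mod begin

definition linear_form :: "('r \<Rightarrow> 'k) \<Rightarrow> bool" where
  "linear_form f \<longleftrightarrow> (\<forall>x y. f (x + y) = f x + f y) \<and> (\<forall>c x. f (c *s x) = c * f x)"

lemma linear_formD:
  fixes f :: "'r \<Rightarrow> 'k"
  assumes "linear_form f"
  shows "f (x + y) = f x + f y" "f (c *s x) = c * f x" "f 0 = 0" "f (- x) = - f x"
    "f (x - y) = f x - f y" "f (sum g A) = (\<Sum>a\<in>A. f (g a))"
proof -
  show add: "f (x + y) = f x + f y" and scale: "f (c *s x) = c * f x" for x y c
    using assms unfolding linear_form_def by auto
  show 0: "f 0 = 0" using scale[of 0 0] by simp
  show neg: "f (- x) = - f x" for x using add[of x "- x"] 0 by (simp add: eq_neg_iff_add_eq_0 add.commute)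
  show "f (x - y) = f x - f y" using add[of x "- y"] neg by simp
  show "f (sum g A) = (\<Sum>a\<in>A. f (g a))"
    by (induction A rule: infinite_finite_induct) (auto simp: 0 add)
qed

lemma linear_form_iff: "linear_form f \<longleftrightarrow> Vector_Spaces.linear scale (*) f"
proof -
  have "vector_space ((*) :: 'k \<Rightarrow> 'k \<Rightarrow> 'k)" by unfold_locales (auto simp: algebra_simps)
  then show ?thesis
    unfolding linear_form_def Vector_Spaces.linear_iff using vector_space_axioms by auto
qed

lemma subspace_linear_form_kernel: "linear_form f \<Longrightarrow> subspace {x. f x = 0}"
  by (auto simp: subspace_def linear_formD)

lemma separating_form:
  assumes M: "subspace M" and x: "x \<notin> M"
  shows "\<exists>f. linear_form f \<and> (\<forall>m\<in>M. f m = 0) \<and> f x = 1"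
proof -
  interpret K: vector_space "(*) :: 'k \<Rightarrow> 'k \<Rightarrow> 'k" by unfold_locales (auto simp: algebra_simps)
  interpret P: vector_space_pair scale "(*) :: 'k \<Rightarrow> 'k \<Rightarrow> 'k" ..
  obtain C where C: "C \<subseteq> M" "independent C" "M \<subseteq> span C"
    using maximal_independent_subset by blast
  have "x \<notin> span C" using C M x span_minimal by blast
  then have "independent (insert x C)" "x \<notin> C"
    using C independent_insertI span_base by auto
  then obtain g where g: "Vector_Spaces.linear scale (*) g"
      "\<forall>y\<in>insert x C. g y = (if y = x then 1 else 0)"
    using P.linear_independent_extend[of "insert x C" "\<lambda>y. if y = x then 1 else 0"] by blast
  have lin: "linear_form g" using g linear_form_iff by simp
  have "span C \<subseteq> {y. g y = 0}"
    using g \<open>x \<notin> C\<close> by (intro span_minimal subspace_linear_form_kernel lin) auto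
  with lin g C(3) show ?thesis by auto
qed

text \<open>A linear injection of a finite dimensional space into its dual is onto. \<open>C\<close>
  is a basis of a complement of \<open>J\<close>, and \<open>T\<close> is the map into the dual
  written in the basis dual to \<open>C\<close>, so that it becomes an endomorphism of
  \<open>span C\<close>.\<close>

lemma nondegenerate_form_represents:
  assumes S: "finite S" "span (J \<union> S) = UNIV"
    and lin: "\<And>x. linear_form (\<beta> x)" "\<And>y. linear_form (\<lambda>x. \<beta> x y)"
    and J0: "\<And>x y. y \<in> J \<Longrightarrow> \<beta> x y = 0"
    and nondeg: "\<And>x. (\<And>y. \<beta> x y = 0) \<Longrightarrow> x \<in> J"
    and f: "linear_form f" "\<And>x. x \<in> J \<Longrightarrow> f x = 0"
  shows "\<exists>x. \<forall>y. \<beta> x y = f y"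
proof -
  obtain C0 where C0: "C0 \<subseteq> J" "independent C0" "J \<subseteq> span C0"
    using maximal_independent_subset by blast
  \<comment> \<open>Extending a basis of \<open>J\<close> inside \<open>C0 \<union> S\<close> keeps
    the added part \<open>C\<close> finite.\<close>
  obtain C1 where C1: "C0 \<subseteq> C1" "C1 \<subseteq> C0 \<union> S" "independent C1" "C0 \<union> S \<subseteq> span C1"
    using maximal_independent_subset_extend[of C0 "C0 \<union> S"] C0 by blast
  define C where "C = C1 - C0"
  have C: "finite C" "independent C"
    using S(1) C1 finite_subset[of C S] independent_mono[of C1 C] unfolding C_def by auto
  have spanJ: "span C0 = J" using C0 subspace_J span_minimal by blast
  have "J \<union> S \<subseteq> span C1" using C1 spanJ span_mono by blast
  then have C1_UNIV: "span C1 = UNIV" using S(2) span_minimal[OF _ subspace_span] by blast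
  have un: "C1 = C \<union> C0" using C1 unfolding C_def by auto
  have int: "x = 0" if x: "x \<in> span C" "x \<in> J" for x
  proof (rule ccontr)
    assume nz: "x \<noteq> 0"
    obtain u where u: "x = (\<Sum>c\<in>C. u c *s c)" using x(1) C(1) by (auto simp: span_finite)
    then have "\<exists>c\<in>C. u c *s c \<noteq> 0" using nz sum.neutral[of C "\<lambda>c. u c *s c"] by blast
    then obtain c where c: "c \<in> C" "u c \<noteq> 0" by auto
    have "u c *s c = x - (\<Sum>c\<in>C - {c}. u c *s c)"
      using u C(1) c(1) by (simp add: sum.remove)
    also have "\<dots> \<in> span (C1 - {c})"
    proof (intro span_diff)
      show "x \<in> span (C1 - {c})"
        using x(2) spanJ span_mono[of C0 "C1 - {c}"] c(1) C1(1) unfolding C_def by auto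
      show "(\<Sum>c\<in>C - {c}. u c *s c) \<in> span (C1 - {c})"
        using un by (intro span_sum span_scale span_base) auto
    qed
    finally have "inverse (u c) *s u c *s c \<in> span (C1 - {c})" by (rule span_scale)
    then have "c \<in> span (C1 - {c})" using c(2) by simp
    then show False using C1(3) c(1) un by (auto simp: dependent_def)
  qed
  have dec: "\<exists>y\<in>span C. \<exists>j\<in>J. x = y + j" for x
    using C1_UNIV unfolding un span_Un spanJ by blast
  have ext: "g = h" if "linear_form g" "linear_form h" "\<And>x. x \<in> J \<Longrightarrow> g x = 0" "\<And>x. x \<in> J \<Longrightarrow> h x = 0"
    "\<And>c. c \<in> C \<Longrightarrow> g c = h c" for g h
  proof
    fix x
    obtain y j where x: "y \<in> span C" "j \<in> J" "x = y + j" using dec by blast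
    obtain u where "y = (\<Sum>c\<in>C. u c *s c)" using x(1) C(1) by (auto simp: span_finite)
    then show "g x = h x" using x that by (simp add: linear_formD)
  qed
  define T where "T = (\<lambda>x. \<Sum>c\<in>C. \<beta> x c *s c)"
  have T_in: "T x \<in> span C" for x unfolding T_def by (intro span_sum span_scale span_base)
  have T_lin: "Vector_Spaces.linear scale scale T"
    unfolding Vector_Spaces.linear_iff T_def using vector_space_axioms lin(2)
    by (auto simp: linear_formD[OF lin(2)] scale_left_distrib sum.distrib scale_sum_right)
  interpret T: Vector_Spaces.linear scale scale T by (rule T_lin)
  interpret P: vector_space_pair scale scale ..
  have coeffs: "u c = v c" if "(\<Sum>c\<in>C. u c *s c) = (\<Sum>c\<in>C. v c *s c)" "c \<in> C" for u v c
  proof -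
    have "(\<Sum>c\<in>C. (u c - v c) *s c) = 0"
      using that by (simp add: scale_left_diff_distrib sum_subtractf)
    then show ?thesis using independentD[OF C(2,1) order_refl, of "\<lambda>c. u c - v c"] that(2) by simp
  qed
  have inj: "inj_on T (span C)"
  proof (rule inj_onI)
    fix x y assume xy: "x \<in> span C" "y \<in> span C" "T x = T y"
    have "\<beta> x = \<beta> y"
      using xy(3) coeffs unfolding T_def by (intro ext lin J0) auto
    then have "\<beta> (x - y) z = 0" for z
      using linear_formD(5)[OF lin(2)[of z], of x y] by simp
    then have "x - y \<in> J" by (rule nondeg)
    then show "x = y" using int[of "x - y"] xy span_diff by simp
  qed
  have indep: "independent (T ` C)"
    using P.linear_independent_injective_image[OF T_lin C(2) inj] .
  \<comment> \<open>The image of \<open>C\<close> is independent and has as many elements as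
    \<open>C\<close>; a missing vector would give too many independent vectors in
    \<open>span C\<close>.\<close>
  have "span C \<subseteq> span (T ` C)"
  proof (rule ccontr)
    assume "\<not> span C \<subseteq> span (T ` C)"
    then obtain y where y: "y \<in> span C" "y \<notin> span (T ` C)" by blast
    have "finite (insert y (T ` C)) \<and> card (insert y (T ` C)) \<le> card C"
      using indep y T_in C by (intro independent_span_bound independent_insertI) auto
    moreover have "card (insert y (T ` C)) = Suc (card C)"
      using C y(2) span_base[of y "T ` C"] card_image[OF inj_on_subset[OF inj span_superset]] by (subst card_insert_disjoint) auto
    ultimately show False by simp
  qed
  then have "(\<Sum>c\<in>C. f c *s c) \<in> T ` span C"
    using T.span_image[of C] span_sum[of C "\<lambda>c. f c *s c" C] span_scale span_base by auto
  then obtain x where "T x = (\<Sum>c\<in>C. f c *s c)" by auto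
  then have "\<beta> x = f" using coeffs unfolding T_def by (intro ext lin f J0) auto
  then show ?thesis by auto
qed

end

section \<open>Nilpotent mesh algebras are Frobenius\<close>

context algebra_mod begin

definition right_ideal :: "'r set \<Rightarrow> bool" where
  "right_ideal M \<longleftrightarrow> subspace M \<and> J \<subseteq> M \<and> (\<forall>m\<in>M. \<forall>a. m \<star> a \<in> M)"

text \<open>A homomorphism of right modules from M to the algebra, represented by a map that is
  linear on the whole of 'r; compatibility with right multiplication is asked on M only and modulo
  \<open>J\<close>. An extension to a larger M may thus alter the map outside M.\<close>

definition right_linear_on :: "'r set \<Rightarrow> ('r \<Rightarrow> 'r) \<Rightarrow> bool" where
  "right_linear_on M F \<longleftrightarrow> (\<forall>x y. F (x + y) = F x + F y) \<and> (\<forall>c x. F (c *s x) = c *s F x) \<and>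
     (\<forall>x\<in>J. F x \<in> J) \<and> (\<forall>m\<in>M. \<forall>a. F (m \<star> a) \<approx> F m \<star> a)"

lemma right_linear_onD:
  assumes "right_linear_on M F"
  shows "F (x + y) = F x + F y" "F (c *s x) = c *s F x" "F 0 = 0" "F (- x) = - F x"
    "F (x - y) = F x - F y" "F (sum g A) = (\<Sum>a\<in>A. F (g a))" "x \<in> J \<Longrightarrow> F x \<in> J"
    "x \<approx> y \<Longrightarrow> F x \<approx> F y" "m \<in> M \<Longrightarrow> F (m \<star> a) \<approx> F m \<star> a"
proof -
  show add: "F (x + y) = F x + F y" and scale: "F (c *s x) = c *s F x"
    and J: "x \<in> J \<Longrightarrow> F x \<in> J" and "m \<in> M \<Longrightarrow> F (m \<star> a) \<approx> F m \<star> a" for x y c m a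
    using assms unfolding right_linear_on_def by auto
  show 0: "F 0 = 0" using add[of 0 0] by simp
  show neg: "F (- x) = - F x" for x using add[of x "- x"] 0 by (simp add: eq_neg_iff_add_eq_0 add.commute)
  show diff: "F (x - y) = F x - F y" using add[of x "- y"] neg by simp
  show "F (sum g A) = (\<Sum>a\<in>A. F (g a))"
    by (induction A rule: infinite_finite_induct) (auto simp: 0 add)
  show "x \<approx> y \<Longrightarrow> F x \<approx> F y" using J[of "x - y"] diff by (simp add: eqv_def)
qed

definition rann :: "'r set \<Rightarrow> 'r set" where "rann X = {a. \<forall>x\<in>X. x \<star> a \<in> J}"
definition lann :: "'r set \<Rightarrow> 'r set" where "lann X = {a. \<forall>x\<in>X. a \<star> x \<in> J}"

text \<open>Representability of all forms is bundled with nondegeneracy, so that the dimension count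
  occurs once, in \<open>frobenius_formI\<close>.\<close>

definition frobenius_form :: "('r \<Rightarrow> 'k) \<Rightarrow> bool" where
  "frobenius_form lam \<longleftrightarrow> linear_form lam \<and> (\<forall>x\<in>J. lam x = 0) \<and>
     (\<forall>x. (\<forall>a. lam (x \<star> a) = 0) \<longrightarrow> x \<in> J) \<and> (\<forall>x. (\<forall>a. lam (a \<star> x) = 0) \<longrightarrow> x \<in> J) \<and>
     (\<forall>f. linear_form f \<longrightarrow> (\<forall>x\<in>J. f x = 0) \<longrightarrow>
       (\<exists>a. \<forall>x. f x = lam (x \<star> a)) \<and> (\<exists>a. \<forall>x. f x = lam (a \<star> x)))"

lemma frobenius_formD:
  assumes "frobenius_form lam"
  shows "linear_form lam" "x \<in> J \<Longrightarrow> lam x = 0"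
    "(\<And>a. lam (x \<star> a) = 0) \<Longrightarrow> x \<in> J" "(\<And>a. lam (a \<star> x) = 0) \<Longrightarrow> x \<in> J"
    "linear_form f \<Longrightarrow> (\<And>x. x \<in> J \<Longrightarrow> f x = 0) \<Longrightarrow> \<exists>a. \<forall>x. f x = lam (x \<star> a)"
    "linear_form f \<Longrightarrow> (\<And>x. x \<in> J \<Longrightarrow> f x = 0) \<Longrightarrow> \<exists>a. \<forall>x. f x = lam (a \<star> x)"
  using assms unfolding frobenius_form_def by blast+

text \<open>Nondegeneracy in the first variable represents each form by left multiplication. Applied
  to a form that is nonzero at x, this gives nondegeneracy in the second variable, and then
  representation by right multiplication.\<close>

lemma frobenius_formI:
  assumes S: "finite S" "span (J \<union> S) = UNIV"
    and lam: "linear_form lam" "\<And>x. x \<in> J \<Longrightarrow> lam x = 0"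
    and nondeg: "\<And>x. (\<And>a. lam (x \<star> a) = 0) \<Longrightarrow> x \<in> J"
  shows "frobenius_form lam"
proof -
  have lin: "linear_form (\<lambda>y. lam (x \<star> y))" "linear_form (\<lambda>x. lam (x \<star> y))" for x y
    using lam(1) by (auto simp: linear_form_def mult_add_left mult_add_right mult_scale_left mult_scale_right)
  have rep: "\<exists>a. \<forall>x. lam (a \<star> x) = f x" if "linear_form f" "\<And>x. x \<in> J \<Longrightarrow> f x = 0" for f
    by (rule nondegenerate_form_represents[where \<beta> = "\<lambda>x y. lam (x \<star> y)", OF S lin _ nondeg that])
       (intro lam(2) J_mult_left)
  have nondeg': "x \<in> J" if x: "\<And>a. lam (a \<star> x) = 0" for x
  proof (rule ccontr)
    assume "x \<notin> J"
    then obtain f where "linear_form f" "\<forall>m\<in>J. f m = 0" "f x = 1"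
      using separating_form[OF subspace_J] by blast
    moreover from this obtain a where "lam (a \<star> x) = f x" using rep[of f] by blast
    ultimately show False using x[of a] by simp
  qed
  have rep': "\<exists>a. \<forall>x. lam (x \<star> a) = f x" if "linear_form f" "\<And>x. x \<in> J \<Longrightarrow> f x = 0" for f
    by (rule nondegenerate_form_represents[where \<beta> = "\<lambda>x y. lam (y \<star> x)", OF S lin(2,1) _ nondeg' that])
       (intro lam(2) J_mult_right)
  show ?thesis
    unfolding frobenius_form_def
  proof (intro conjI allI impI ballI)
    fix f assume "linear_form f" "\<forall>x\<in>J. f x = 0"
    then show "\<exists>a. \<forall>x. f x = lam (x \<star> a)" "\<exists>a. \<forall>x. f x = lam (a \<star> x)"
      using rep[of f] rep'[of f] by metis+
  next
    show "x \<in> J" if "\<forall>a. lam (x \<star> a) = 0" for x by (rule nondeg) (use that in blast)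
    show "x \<in> J" if "\<forall>a. lam (a \<star> x) = 0" for x by (rule nondeg') (use that in blast)
  qed (fact lam)+
qed

text \<open>A form that vanishes on X but not at x is given by right multiplication by some a. Since
  X is a left ideal, nondegeneracy shows that a lies in \<open>rann X\<close>; so x a lies in
  \<open>J\<close> and the form vanishes at x after all.\<close>

lemma lann_rann:
  assumes "frobenius_form lam" and X: "two_sided X"
  shows "lann (rann X) = X"
proof
  show "X \<subseteq> lann (rann X)" unfolding lann_def rann_def by auto
  show "lann (rann X) \<subseteq> X"
  proof (rule ccontr)
    assume "\<not> lann (rann X) \<subseteq> X"
    then obtain x where x: "x \<in> lann (rann X)" "x \<notin> X" by blast
    then obtain f where f: "linear_form f" "\<forall>m\<in>X. f m = 0" "f x = 1"
      using separating_form two_sidedD(1)[OF X] by blast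
    then obtain a where a: "\<And>x. f x = lam (x \<star> a)"
      using frobenius_formD(5)[OF assms(1) f(1)] two_sidedD(2)[OF X] by blast
    have "y \<star> a \<in> J" if "y \<in> X" for y
    proof -
      have "lam (t \<star> (y \<star> a)) = 0" for t
        using f(2) two_sidedD(4)[OF X that, of t] a[of "t \<star> y"] by (simp add: mult_assoc)
      then show ?thesis by (rule frobenius_formD(4)[OF assms(1)])
    qed
    then have "x \<star> a \<in> J" using x(1) unfolding lann_def rann_def by auto
    then show False using a[of x] f(3) frobenius_formD(2)[OF assms(1)] by simp
  qed
qed

lemma rann_lann:
  assumes "frobenius_form lam" and X: "two_sided X"
  shows "rann (lann X) = X"
proof
  show "X \<subseteq> rann (lann X)" unfolding lann_def rann_def by auto
  show "rann (lann X) \<subseteq> X"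
  proof (rule ccontr)
    assume "\<not> rann (lann X) \<subseteq> X"
    then obtain x where x: "x \<in> rann (lann X)" "x \<notin> X" by blast
    then obtain f where f: "linear_form f" "\<forall>m\<in>X. f m = 0" "f x = 1"
      using separating_form two_sidedD(1)[OF X] by blast
    then obtain a where a: "\<And>x. f x = lam (a \<star> x)"
      using frobenius_formD(6)[OF assms(1) f(1)] two_sidedD(2)[OF X] by blast
    have "a \<star> y \<in> J" if "y \<in> X" for y
    proof -
      have "lam ((a \<star> y) \<star> t) = 0" for t
        using f(2) two_sidedD(3)[OF X that, of t] a[of "y \<star> t"] by (simp add: mult_assoc)
      then show ?thesis by (rule frobenius_formD(3)[OF assms(1)])
    qed
    then have "a \<star> x \<in> J" using x(1) unfolding lann_def rann_def by auto
    then show False using a[of x] f(3) frobenius_formD(2)[OF assms(1)] by simp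
  qed
qed

lemma two_sided_rann: "two_sided X \<Longrightarrow> two_sided (rann X)"
  unfolding two_sided_def rann_def
  by (auto simp: mult_add_right mult_scale_right subspace_def subspace_add[OF subspace_J]
      subspace_0[OF subspace_J] subspace_scale[OF subspace_J] J_mult_left J_mult_right mult_assoc[symmetric])

end

section \<open>Self-injectivity by climbing the arrow filtration\<close>

context mesh_algebra begin

text \<open>In the intended picture T consists of the paths of length n. The condition t e i = t
  gives each generator an end vertex, as the extension of right linear maps by one generator
  requires.\<close>

lemma D_layer_span:
  "\<exists>T. finite T \<and> T \<subseteq> D n \<and> (\<forall>t\<in>T. \<exists>i\<in>V. t \<star> e i = t) \<and> (\<forall>x\<in>D n. \<exists>y\<in>span T. x - y \<in> D (Suc n))"
proof (induction n)
  case 0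
  have "\<exists>y\<in>span (e ` V). x - y \<in> D (Suc 0)" for x
  proof -
    obtain c where "x - (\<Sum>v\<in>V. c v *s e v) \<in> D 1" using D_0_split by blast
    moreover have "(\<Sum>v\<in>V. c v *s e v) \<in> span (e ` V)" by (intro span_sum span_scale span_base) auto
    ultimately show ?thesis by auto
  qed
  moreover have "\<forall>t\<in>e ` V. \<exists>i\<in>V. t \<star> e i = t" using e_idem by blast
  ultimately show ?case using finite_V by (intro exI[of _ "e ` V"]) (auto simp: D_0)
next
  case (Suc n)
  then obtain T where T: "finite T" "T \<subseteq> D n" "\<And>x. x \<in> D n \<Longrightarrow> \<exists>y\<in>span T. x - y \<in> D (Suc n)" by auto
  define T' where "T' = (\<lambda>(t, b). t \<star> ar b) ` (T \<times> B)"
  have "finite T'" unfolding T'_def using T(1) finite_B by auto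
  moreover have "T' \<subseteq> D (Suc n)" unfolding T'_def using T(2) D_mult[OF _ ar_in_D, of _ n] by auto
  moreover have "\<exists>i\<in>V. t \<star> e i = t" if t: "t \<in> T'" for t
  proof -
    obtain s b where "t = s \<star> ar b" "b \<in> B" using t unfolding T'_def by auto
    then show ?thesis by (intro bexI[of _ "tgt b"]) (auto simp: mult_assoc e_tgt tgt_in_V)
  qed
  moreover have "\<exists>y\<in>span T'. x - y \<in> D (Suc (Suc n))" if x: "x \<in> D (Suc n)" for x
  proof -
    obtain y where y: "\<And>b. y b \<in> D n" "x \<approx> (\<Sum>b\<in>B. y b \<star> ar b)" using D_right[OF x] by auto
    obtain s where s: "\<And>b. s b \<in> span T" "\<And>b. y b - s b \<in> D (Suc n)" using T(3)[OF y(1)] by metis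
    have "t \<star> ar b \<in> span T'" if "t \<in> span T" "b \<in> B" for t b
    proof -
      have "span T \<subseteq> {t. t \<star> ar b \<in> span T'}"
        using that by (intro span_minimal subspace_left_preimage) (auto simp: T'_def intro!: span_base)
      then show ?thesis using that by auto
    qed
    then have "(\<Sum>b\<in>B. s b \<star> ar b) \<in> span T'" using s by (intro span_sum) auto
    moreover have "(\<Sum>b\<in>B. (y b - s b) \<star> ar b) \<in> D (Suc (Suc n))"
      using D_mult[OF s(2) ar_in_D] by (intro subspace_sum[OF subspace_D]) simp
    moreover have "x - (\<Sum>b\<in>B. s b \<star> ar b) \<approx> (\<Sum>b\<in>B. (y b - s b) \<star> ar b)"
      using y(2) by (simp add: eqv_def mult_diff_left sum_subtractf)
    ultimately show ?thesis using eqv_mem[OF subspace_D J_subset_D] by blast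
  qed
  ultimately show ?case by (intro exI[of _ T'] conjI ballI) auto
qed

text \<open>With \<open>D N \<subseteq> J\<close> this makes the quotient finite
  dimensional.\<close>

lemma finite_span_mod_D: "\<exists>S. finite S \<and> (\<forall>x. \<exists>y\<in>span S. x - y \<in> D n)"
proof (induction n)
  case 0
  show ?case by (rule exI[of _ "{}"]) (simp add: D_0)
next
  case (Suc n)
  then obtain S where S: "finite S" "\<And>x. \<exists>y\<in>span S. x - y \<in> D n" by blast
  obtain T where T: "finite T" "\<And>x. x \<in> D n \<Longrightarrow> \<exists>y\<in>span T. x - y \<in> D (Suc n)"
    using D_layer_span[of n] by blast
  have "\<exists>y\<in>span (S \<union> T). x - y \<in> D (Suc n)" for x
  proof -
    obtain y where y: "y \<in> span S" "x - y \<in> D n" using S(2) by blast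
    obtain z where z: "z \<in> span T" "x - y - z \<in> D (Suc n)" using T(2)[OF y(2)] by blast
    have "y + z \<in> span (S \<union> T)"
      using y(1) z(1) span_mono[of S "S \<union> T"] span_mono[of T "S \<union> T"] by (intro span_add) auto
    moreover have "x - (y + z) \<in> D (Suc n)" using z(2) by (simp add: algebra_simps)
    ultimately show ?thesis by blast
  qed
  then show ?case using S(1) T(1) by (intro exI[of _ "S \<union> T"]) auto
qed

text \<open>The scalars c and the remainder a1 depend on a alone. Hence right multiplication by a
  has the same scalar part on any two elements with the same end vertex, in particular on an element
  and on its prescribed image.\<close>

lemma right_mult_split:
  "\<exists>c a1. a1 \<in> D 1 \<and> (\<forall>i\<in>V. \<forall>x. x \<star> e i \<approx> x \<longrightarrow> x \<star> a \<approx> c i *s x + x \<star> a1)"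
proof -
  obtain c where c: "a - (\<Sum>v\<in>V. c v *s e v) \<in> D 1" using D_0_split by blast
  have "x \<star> a \<approx> c i *s x + x \<star> (a - (\<Sum>v\<in>V. c v *s e v))" if i: "i \<in> V" "x \<star> e i \<approx> x" for i x
  proof -
    have "x \<star> e v \<approx> (if v = i then x else 0)" if v: "v \<in> V" for v
    proof -
      have "x \<star> e v \<approx> x \<star> e i \<star> e v" using eqv_mult_right[OF eqv_sym[OF i(2)]] .
      also have "x \<star> e i \<star> e v = (if v = i then x \<star> e i else 0)"
        using i(1) v by (simp add: mult_assoc e_orth e_idem)
      also have "\<dots> \<approx> (if v = i then x else 0)" using i(2) by simp
      finally show ?thesis .
    qed
    then have "(\<Sum>v\<in>V. c v *s (x \<star> e v)) \<approx> (\<Sum>v\<in>V. c v *s (if v = i then x else 0))"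
      by (intro eqv_sum eqv_scale)
    also have "\<dots> = (\<Sum>v\<in>V. if v = i then c i *s x else 0)" by (intro sum.cong) auto
    also have "\<dots> = c i *s x" using finite_V i(1) by simp
    finally have "(\<Sum>v\<in>V. c v *s (x \<star> e v)) \<approx> c i *s x" .
    then show ?thesis
      by (simp add: eqv_def mult_diff_right mult_sum_right mult_scale_right algebra_simps)
  qed
  with c show ?thesis by blast
qed

text \<open>
  This is where exactness enters: the values of \<open>F\<close> on the elements \<open>x c\<close>, for the arrows \<open>c\<close>, form a
  cycle of the mesh complex because of the mesh relation, so they are \<open>z c\<close> for a single \<open>z\<close>,
  and \<open>x\<close> can be sent to \<open>z\<close>.
\<close>

lemma extend_right_linear_step:
  assumes M: "right_ideal M" and F: "right_linear_on M F"
    and x: "i \<in> V" "x \<star> e i \<approx> x" "\<And>a. a \<in> D 1 \<Longrightarrow> x \<star> a \<in> M"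
  shows "right_ideal (span (insert x M)) \<and> (\<exists>F'. right_linear_on (span (insert x M)) F' \<and> (\<forall>m\<in>M. F' m = F m))"
proof (cases "x \<in> M")
  case True
  then have "span (insert x M) = M" using M by (simp add: insert_absorb right_ideal_def)
  then show ?thesis using M F by auto
next
  case False
  have subM: "subspace M" and JM: "J \<subseteq> M" and Mr: "\<And>m a. m \<in> M \<Longrightarrow> m \<star> a \<in> M"
    using M unfolding right_ideal_def by auto
  note F' = right_linear_onD[OF F]
  define M' where "M' = span (insert x M)"
  have subM': "subspace M'" "M \<subseteq> M'" "x \<in> M'"
    unfolding M'_def by (auto intro: span_base)
  have M'_cases: "\<exists>k m. m \<in> M \<and> y = m + k *s x" if y: "y \<in> M'" for y
  proof -
    have "span M = M" using subM by (simp add: span_eq_iff)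
    then obtain k where "y - k *s x \<in> M" using y unfolding M'_def span_breakdown_eq by blast
    then show ?thesis by (intro exI[of _ k] exI[of _ "y - k *s x"]) auto
  qed
  have xa: "x \<star> ar c \<in> M" if "c \<in> B" for c using x(3) ar_in_D that by blast
  have "(\<Sum>b\<in>into i. (\<tau> b *s F (x \<star> ar (rev_arrow b))) \<star> ar b) \<in> J"
  proof -
    have "x \<star> (\<Sum>b\<in>into i. \<tau> b *s (ar (rev_arrow b) \<star> ar b)) \<in> J" by (rule J_mult_left[OF mesh[OF x(1)]])
    then have "F (x \<star> (\<Sum>b\<in>into i. \<tau> b *s (ar (rev_arrow b) \<star> ar b))) \<in> J" by (rule F'(7))
    then have "(\<Sum>b\<in>into i. \<tau> b *s F (x \<star> ar (rev_arrow b) \<star> ar b)) \<in> J"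
      by (simp add: mult_sum_right mult_scale_right F'(2,6) mult_assoc)
    moreover have "(\<Sum>b\<in>into i. (\<tau> b *s F (x \<star> ar (rev_arrow b))) \<star> ar b)
        \<approx> (\<Sum>b\<in>into i. \<tau> b *s F (x \<star> ar (rev_arrow b) \<star> ar b))"
      unfolding mult_scale_left by (intro eqv_sum eqv_scale eqv_sym[OF F'(9)] xa) (auto simp: rev_in_B)
    ultimately show ?thesis using two_sided_eqv[OF two_sided_J] by blast
  qed
  then obtain z where z: "\<And>b. b \<in> into i \<Longrightarrow>
      (\<tau> b *s F (x \<star> ar (rev_arrow b))) \<star> e (src b) \<approx> \<tau> b *s (z \<star> ar (rev_arrow b))"
    using exact[OF x(1), of "\<lambda>b. \<tau> b *s F (x \<star> ar (rev_arrow b))"] by blast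
  \<comment> \<open>Cut down to end at i, as x does, so that x and z' have the same scalar part
    under right multiplication and both kill, modulo \<open>J\<close>, the arrows that do not start
    at i.\<close>
  define z' where "z' = z \<star> e i"
  have z'_ar: "F (x \<star> ar c) \<approx> z' \<star> ar c" if c: "c \<in> B" for c
  proof (cases "src c = i")
    case True
    define b where "b = rev_arrow c"
    have b: "b \<in> into i" "rev_arrow b = c" "src b = tgt c" "\<tau> b \<noteq> 0"
      using c True by (auto simp: b_def rev_in_B tgt_rev src_rev rev_rev \<tau>_nz)
    have "\<tau> b *s F (x \<star> ar c) = \<tau> b *s F (x \<star> ar c \<star> e (tgt c))"
      using c by (simp add: mult_assoc e_tgt)
    also have "\<dots> \<approx> \<tau> b *s (F (x \<star> ar c) \<star> e (tgt c))" by (intro eqv_scale F'(9) xa c)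
    also have "\<dots> \<approx> \<tau> b *s (z \<star> ar c)" using z[OF b(1)] b by (simp add: mult_scale_left)
    finally have "inverse (\<tau> b) *s \<tau> b *s F (x \<star> ar c) \<approx> inverse (\<tau> b) *s \<tau> b *s (z \<star> ar c)"
      by (rule eqv_scale)
    then show ?thesis using b(4) c x(1) True by (simp add: z'_def mult_assoc e_ar)
  next
    case False
    then have "x \<star> e i \<star> ar c = 0" "z' \<star> ar c = 0"
      using c x(1) by (auto simp: z'_def mult_assoc e_ar)
    then have "x \<star> ar c \<in> J" using eqv_mult_right[OF eqv_sym[OF x(2)], of "ar c"] by (simp add: eqv_def)
    then show ?thesis using F'(7) \<open>z' \<star> ar c = 0\<close> by (simp add: eqv_def)
  qed
  have z'_D: "F (x \<star> a) \<approx> z' \<star> a" if a: "a \<in> D 1" for a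
  proof -
    obtain t where t: "a \<approx> (\<Sum>b\<in>B. ar b \<star> t b)" using D_left[OF a] by blast
    have "F (x \<star> a) \<approx> F (x \<star> (\<Sum>b\<in>B. ar b \<star> t b))" by (intro F'(8) eqv_mult_left t)
    also have "\<dots> = (\<Sum>b\<in>B. F (x \<star> ar b \<star> t b))" by (simp add: mult_sum_right F' mult_assoc)
    also have "\<dots> \<approx> (\<Sum>b\<in>B. F (x \<star> ar b) \<star> t b)" by (intro eqv_sum F'(9) xa)
    also have "\<dots> \<approx> (\<Sum>b\<in>B. z' \<star> ar b \<star> t b)" by (intro eqv_sum eqv_mult_right z'_ar)
    also have "\<dots> = z' \<star> (\<Sum>b\<in>B. ar b \<star> t b)" by (simp add: mult_sum_right mult_assoc)
    also have "\<dots> \<approx> z' \<star> a" by (intro eqv_mult_left eqv_sym[OF t])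
    finally show ?thesis .
  qed
  obtain \<phi> where \<phi>: "linear_form \<phi>" "\<And>m. m \<in> M \<Longrightarrow> \<phi> m = 0" "\<phi> x = 1"
    using separating_form[OF subM False] by blast
  \<comment> \<open>As \<open>\<phi>\<close> is 0 on M and 1 at x, this keeps F on M, sends x to z',
    and is still linear on all of 'r.\<close>
  define G where "G = (\<lambda>w. F w + \<phi> w *s (z' - F x))"
  have G_M: "G m = F m" if "m \<in> M" for m using that \<phi> by (simp add: G_def)
  have G_x: "G x = z'" using \<phi> by (simp add: G_def)
  have G_add: "G (v + w) = G v + G w" for v w
    by (simp add: G_def F' linear_formD[OF \<phi>(1)] scale_left_distrib algebra_simps)
  have G_scale: "G (c *s v) = c *s G v" for c v
    by (simp add: G_def F' linear_formD[OF \<phi>(1)] scale_right_distrib)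
  have G_J: "G j \<in> J" if "j \<in> J" for j using that G_M JM F'(7) by auto
  have G_eqv: "G v \<approx> G w" if "v \<approx> w" for v w
    using G_J[of "v - w"] G_add[of "v - w" w] that by (simp add: eqv_def)
  have z'_i: "z' \<star> e i \<approx> z'" using x(1) by (simp add: z'_def mult_assoc e_idem)
  have "m \<star> a \<in> M' \<and> G (m \<star> a) \<approx> G m \<star> a" if m: "m \<in> M'" for m a
  proof -
    obtain k m0 where k: "m0 \<in> M" "m = m0 + k *s x" using M'_cases[OF m] by blast
    obtain c a1 where a1: "a1 \<in> D 1"
      and c: "\<And>i x. i \<in> V \<Longrightarrow> x \<star> e i \<approx> x \<Longrightarrow> x \<star> a \<approx> c i *s x + x \<star> a1"
      using right_mult_split by blast
    have xa: "x \<star> a \<approx> c i *s x + x \<star> a1" by (rule c[OF x(1,2)])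
    have "c i *s x + x \<star> a1 \<in> M'" using subM' x(3)[OF a1] by (auto simp: subspace_add subspace_scale)
    then have "x \<star> a \<in> M'" using eqv_mem[OF subM'(1) _ xa] JM subM'(2) by auto
    then have "m \<star> a \<in> M'"
      using k Mr subM' by (auto simp: mult_add_left mult_scale_left intro!: subspace_add subspace_scale)
    moreover have "G (x \<star> a) \<approx> z' \<star> a"
    proof -
      have "G (x \<star> a) \<approx> G (c i *s x + x \<star> a1)" by (rule G_eqv[OF xa])
      also have "\<dots> = c i *s z' + F (x \<star> a1)" by (simp add: G_add G_scale G_x G_M[OF x(3)[OF a1]])
      also have "\<dots> \<approx> c i *s z' + z' \<star> a1" by (intro eqv_add eqv_refl z'_D a1)
      also have "\<dots> \<approx> z' \<star> a" by (rule eqv_sym[OF c[OF x(1) z'_i]])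
      finally show ?thesis .
    qed
    moreover have "G (m \<star> a) = F (m0 \<star> a) + k *s G (x \<star> a)"
      using k by (simp add: mult_add_left mult_scale_left G_add G_scale G_M Mr)
    moreover have "G m \<star> a = F m0 \<star> a + k *s (z' \<star> a)"
      using k by (simp add: mult_add_left mult_scale_left G_add G_scale G_M G_x)
    ultimately show ?thesis using F'(9)[OF k(1)] by (auto intro!: eqv_add eqv_scale)
  qed
  then have "right_ideal M'" "right_linear_on M' G"
    unfolding right_ideal_def right_linear_on_def
    using subM' JM G_add G_scale G_J by auto
  then show ?thesis using G_M unfolding M'_def by blast
qed

lemma extend_right_linear_finite:
  assumes "finite T" and M: "right_ideal M" "right_linear_on M F"
    and "\<And>t. t \<in> T \<Longrightarrow> \<exists>i\<in>V. t \<star> e i = t" "\<And>t a. t \<in> T \<Longrightarrow> a \<in> D 1 \<Longrightarrow> t \<star> a \<in> M"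
  shows "right_ideal (span (T \<union> M)) \<and> (\<exists>F'. right_linear_on (span (T \<union> M)) F' \<and> (\<forall>m\<in>M. F' m = F m))"
  using assms(1,4,5)
proof (induction T)
  case empty
  have "span M = M" using M(1) by (simp add: span_eq_iff right_ideal_def)
  then show ?case using M by (metis Un_empty_left)
next
  case (insert t T)
  then obtain F1 where F1: "right_ideal (span (T \<union> M))" "right_linear_on (span (T \<union> M)) F1" "\<forall>m\<in>M. F1 m = F m"
    by auto
  obtain i where i: "i \<in> V" "t \<star> e i = t" using insert.prems(1)[of t] by auto
  have "t \<star> a \<in> span (T \<union> M)" if "a \<in> D 1" for a
    using insert.prems(2)[of t a] that by (auto intro: span_base)
  moreover have "span (insert t (span (T \<union> M))) = span (insert t T \<union> M)"
    by (simp add: span_insert span_span)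
  ultimately show ?case
    using extend_right_linear_step[OF F1(1,2) i(1), of t] i(2) F1(3) span_base[of _ "T \<union> M"]
    by (auto 0 3)
qed

text \<open>Right multiplication by \<open>D 1\<close> carries the generators of a layer into the
  next deeper one, on which the map already lives; so layers can be added from \<open>D N\<close>
  upwards.\<close>

lemma extend_right_linear_down:
  assumes nil: "D N \<subseteq> J" and M: "right_ideal M" "right_linear_on M F"
  shows "\<exists>M' F'. right_ideal M' \<and> D (N - k) \<subseteq> M' \<and> M \<subseteq> M' \<and> right_linear_on M' F' \<and> (\<forall>m\<in>M. F' m = F m)"
proof (induction k)
  case 0
  show ?case using M nil by (intro exI[of _ M] exI[of _ F]) (auto simp: right_ideal_def)
next
  case (Suc k)
  then obtain M' F' where M': "right_ideal M'" "D (N - k) \<subseteq> M'" "M \<subseteq> M'" "right_linear_on M' F'"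
    "\<forall>m\<in>M. F' m = F m" by blast
  show ?case
  proof (cases "k < N")
    case False
    then have "N - Suc k = N - k" by simp
    then show ?thesis using M' by auto
  next
    case True
    define n where "n = N - Suc k"
    have n: "N - k = Suc n" using True by (simp add: n_def)
    obtain T where T: "finite T" "T \<subseteq> D n" "\<forall>t\<in>T. \<exists>i\<in>V. t \<star> e i = t"
      "\<forall>x\<in>D n. \<exists>y\<in>span T. x - y \<in> D (Suc n)" using D_layer_span[of n] by blast
    have "t \<star> a \<in> M'" if "t \<in> T" "a \<in> D 1" for t a
      using D_mult[of t n a 1] T(2) that M'(2) n by auto
    then obtain F'' where F'': "right_ideal (span (T \<union> M'))" "right_linear_on (span (T \<union> M')) F''"
        "\<forall>m\<in>M'. F'' m = F' m"
      using extend_right_linear_finite[OF T(1) M'(1,4)] T(3) by blast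
    have "D n \<subseteq> span (T \<union> M')"
    proof
      fix x assume "x \<in> D n"
      then obtain y where y: "y \<in> span T" "x - y \<in> M'" using T(4) M'(2) n by auto
      have "y + (x - y) \<in> span (T \<union> M')"
        using y span_mono[of T "T \<union> M'"] by (intro span_add) (auto intro: span_base)
      then show "x \<in> span (T \<union> M')" by simp
    qed
    then show ?thesis using F'' M' span_base[of _ "T \<union> M'"] unfolding n_def[symmetric] by (metis (no_types, lifting) UnCI subset_iff)
  qed
qed

text \<open>As in Baer's criterion: once extended to the whole algebra, the map is left
  multiplication by its value at the unit, here the sum of the e v.\<close>

lemma right_self_injective:
  assumes nil: "D N \<subseteq> J" and M: "right_ideal M" "right_linear_on M F"
  shows "\<exists>c. \<forall>m\<in>M. F m \<approx> c \<star> m"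
proof -
  obtain M' F' where F': "D 0 \<subseteq> M'" "right_linear_on M' F'" "\<forall>m\<in>M. F' m = F m"
    using extend_right_linear_down[OF nil M, of N] by auto
  have "F' m \<approx> F' (\<Sum>v\<in>V. e v) \<star> m" for m
  proof -
    have "F' m \<approx> F' ((\<Sum>v\<in>V. e v) \<star> m)"
      by (intro right_linear_onD(8)[OF F'(2)] eqv_sym[OF left_unit])
    also have "\<dots> \<approx> F' (\<Sum>v\<in>V. e v) \<star> m"
      using F'(1) D_0 by (intro right_linear_onD(9)[OF F'(2)]) auto
    finally show ?thesis .
  qed
  then show ?thesis using F'(3) by metis
qed

section \<open>Socles and the construction of a Frobenius form\<close>

definition socle :: "'v \<Rightarrow> 'r set" where
  "socle i = {x. x \<star> e i \<approx> x \<and> (\<forall>b\<in>B. x \<star> ar b \<in> J)}"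

lemma socle_mult_left: "x \<in> socle i \<Longrightarrow> a \<star> x \<in> socle i"
  unfolding socle_def by (auto simp: mult_assoc intro: eqv_mult_left J_mult_left)

lemma socle_mult_D: "x \<in> socle i \<Longrightarrow> a \<in> D 1 \<Longrightarrow> x \<star> a \<in> J"
proof -
  assume x: "x \<in> socle i" and a: "a \<in> D 1"
  obtain t where t: "a \<approx> (\<Sum>b\<in>B. ar b \<star> t b)" using D_left[OF a] by blast
  have "x \<star> a \<approx> (\<Sum>b\<in>B. x \<star> ar b \<star> t b)"
    using eqv_mult_left[OF t, of x] by (simp add: mult_sum_right mult_assoc)
  moreover have "(\<Sum>b\<in>B. x \<star> ar b \<star> t b) \<in> J"
    using x by (intro subspace_sum[OF subspace_J]) (auto simp: socle_def intro: J_mult_right)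
  ultimately show "x \<star> a \<in> J" using two_sided_eqv[OF two_sided_J] by blast
qed

text \<open>Right multiplication acts on both \<open>x\<close> and \<open>y\<close> by the same scalars, so \<open>x \<mapsto> y\<close> extends by self-injectivity.\<close>

lemma socle_transitive:
  assumes nil: "D N \<subseteq> J" and i: "i \<in> V" and x: "x \<in> socle i" "x \<notin> J" and y: "y \<in> socle i"
  shows "\<exists>c. y \<approx> c \<star> x"
proof -
  obtain \<phi> where \<phi>: "linear_form \<phi>" "\<And>m. m \<in> J \<Longrightarrow> \<phi> m = 0" "\<phi> x = 1"
    using separating_form[OF subspace_J x(2)] by blast
  define M where "M = span (insert x J)"
  have sp: "span J = J" using subspace_J by (simp add: span_eq_iff)
  have M: "m \<in> M \<longleftrightarrow> m \<approx> \<phi> m *s x" for m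
  proof
    assume "m \<in> M"
    then obtain k where k: "m - k *s x \<in> J" unfolding M_def span_breakdown_eq sp by blast
    then have "\<phi> m = k" using \<phi> by (force simp: linear_formD[OF \<phi>(1)])
    with k show "m \<approx> \<phi> m *s x" by (simp add: eqv_def)
  next
    assume "m \<approx> \<phi> m *s x"
    then show "m \<in> M" unfolding M_def span_breakdown_eq sp eqv_def by blast
  qed
  have \<phi>_eqv: "\<phi> v = \<phi> w" if "v \<approx> w" for v w
    using \<phi>(2)[of "v - w"] that by (simp add: eqv_def linear_formD[OF \<phi>(1)])
  have act: "\<exists>c. x \<star> a \<approx> c *s x \<and> y \<star> a \<approx> c *s y" for a
  proof -
    obtain c a1 where a1: "a1 \<in> D 1"
      and c: "\<And>i x. i \<in> V \<Longrightarrow> x \<star> e i \<approx> x \<Longrightarrow> x \<star> a \<approx> c i *s x + x \<star> a1"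
      using right_mult_split by blast
    have "w \<star> a \<approx> c i *s w" if w: "w \<in> socle i" for w
    proof -
      have "w \<star> a \<approx> c i *s w + w \<star> a1" using c[OF i] w by (auto simp: socle_def)
      also have "\<dots> \<approx> c i *s w + 0" using socle_mult_D[OF w a1] by (intro eqv_add) (auto simp: eqv_zero)
      finally show ?thesis by simp
    qed
    then show ?thesis using x y by blast
  qed
  have "m \<star> a \<in> M \<and> \<phi> (m \<star> a) *s y \<approx> (\<phi> m *s y) \<star> a" if m: "m \<in> M" for m a
  proof -
    obtain c where c: "x \<star> a \<approx> c *s x" "y \<star> a \<approx> c *s y" using act by blast
    have "m \<star> a \<approx> \<phi> m *s (x \<star> a)"
      using eqv_mult_right[OF m[unfolded M], of a] by (simp add: mult_scale_left)
    also have "\<dots> \<approx> \<phi> m *s c *s x" by (intro eqv_scale c)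
    finally have ma: "m \<star> a \<approx> (\<phi> m * c) *s x" by simp
    then have "\<phi> (m \<star> a) = \<phi> m * c" using \<phi>_eqv[OF ma] \<phi>(3) by (simp add: linear_formD[OF \<phi>(1)])
    moreover have "(\<phi> m *s y) \<star> a \<approx> \<phi> m *s c *s y" unfolding mult_scale_left by (intro eqv_scale c)
    ultimately show ?thesis using ma unfolding M by (auto intro: eqv_sym)
  qed
  moreover have "J \<subseteq> M" unfolding M_def using span_base by blast
  ultimately have "right_ideal M" "right_linear_on M (\<lambda>w. \<phi> w *s y)"
    unfolding right_ideal_def right_linear_on_def
    by (auto simp: M_def linear_formD[OF \<phi>(1)] scale_left_distrib \<phi>(2) subspace_0[OF subspace_J])
  then obtain c where "\<forall>m\<in>M. \<phi> m *s y \<approx> c \<star> m"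
    using right_self_injective[OF nil] by blast
  moreover have "x \<in> M" unfolding M_def by (auto intro: span_base)
  ultimately show ?thesis using \<phi>(3) by force
qed

text \<open>Take a nonzero socle element as deep in the filtration as possible, cut down to a
  starting vertex j. Any other one is c times it; the radical part of c would push it one layer
  deeper, where the socle is zero, so only the scalar of c at e j remains.\<close>

lemma socle_one_dim:
  assumes nil: "D N \<subseteq> J" and i: "i \<in> V"
  shows "\<exists>z\<in>socle i. \<forall>y\<in>socle i. \<exists>\<mu>. y \<approx> \<mu> *s z"
proof (cases "socle i \<subseteq> J")
  case True
  have "0 \<in> socle i" by (auto simp: socle_def subspace_0[OF subspace_J])
  with True show ?thesis by (auto simp: eqv_def intro!: bexI[of _ 0])
next
  case False
  define P where "P = (\<lambda>n. \<exists>z\<in>socle i \<inter> D n. z \<notin> J)"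
  have "P 0" "\<not> P N" using False nil by (auto simp: P_def D_0)
  then have "\<exists>n. P n \<and> \<not> P (Suc n)" by (induction N) auto
  then obtain n z where z: "z \<in> socle i" "z \<in> D n" "z \<notin> J"
    and n: "\<And>w. w \<in> socle i \<Longrightarrow> w \<in> D (Suc n) \<Longrightarrow> w \<in> J" unfolding P_def by blast
  have "\<exists>j\<in>V. e j \<star> z \<notin> J"
  proof (rule ccontr)
    assume "\<not> ?thesis"
    then have "(\<Sum>v\<in>V. e v \<star> z) \<in> J" by (intro subspace_sum[OF subspace_J]) auto
    then show False using z(3) sum_e_mult[of z] two_sided_eqv[OF two_sided_J] by blast
  qed
  then obtain j where j: "j \<in> V" "e j \<star> z \<notin> J" by blast
  have "\<exists>\<mu>. y \<approx> \<mu> *s (e j \<star> z)" if y: "y \<in> socle i" for y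
  proof -
    obtain c where c: "y \<approx> c \<star> (e j \<star> z)"
      using socle_transitive[OF nil i socle_mult_left[OF z(1)] j(2) y] by blast
    obtain d where d: "c - (\<Sum>v\<in>V. d v *s e v) \<in> D 1" using D_0_split by blast
    have "(c - (\<Sum>v\<in>V. d v *s e v)) \<star> (e j \<star> z) \<in> J"
    proof (rule n[OF socle_mult_left[OF socle_mult_left[OF z(1)]]])
      show "(c - (\<Sum>v\<in>V. d v *s e v)) \<star> (e j \<star> z) \<in> D (Suc n)"
        using D_mult[OF d D_mult[OF _ z(2), of "e j" 0]] by (simp add: D_0)
    qed
    then have "c \<star> (e j \<star> z) \<approx> (\<Sum>v\<in>V. d v *s (e v \<star> (e j \<star> z)))"
      by (simp add: eqv_def mult_diff_left mult_sum_left mult_scale_left)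
    also have "\<dots> = (\<Sum>v\<in>V. if v = j then d j *s (e j \<star> z) else 0)"
      using j(1) by (intro sum.cong) (auto simp: mult_assoc[symmetric] e_idem e_orth)
    also have "\<dots> = d j *s (e j \<star> z)" using finite_V j(1) by simp
    finally show ?thesis using eqv_trans[OF c] by blast
  qed
  then show ?thesis using socle_mult_left[OF z(1)] by blast
qed

text \<open>\<open>lam\<close> adds up, over the vertices, forms that detect the generator z i of
  the socle at i. It is nondegenerate because every nonzero right ideal meets the socle: x is
  multiplied as deep as possible without becoming zero, and then cut down to one end vertex.\<close>

lemma exists_frobenius_form:
  assumes nil: "D N \<subseteq> J"
  shows "\<exists>lam. frobenius_form lam"
proof -
  obtain z where z: "\<And>i. i \<in> V \<Longrightarrow> z i \<in> socle i"
      "\<And>i y. i \<in> V \<Longrightarrow> y \<in> socle i \<Longrightarrow> \<exists>\<mu>. y \<approx> \<mu> *s z i"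
    using socle_one_dim[OF nil] by metis
  have "\<exists>f. linear_form f \<and> (\<forall>m\<in>J. f m = 0) \<and> (z i \<notin> J \<longrightarrow> f (z i) = 1)" for i
  proof (cases "z i \<in> J")
    case True
    then show ?thesis by (intro exI[of _ "\<lambda>_. 0"]) (auto simp: linear_form_def)
  qed (use separating_form[OF subspace_J] in blast)
  then obtain \<phi> where \<phi>: "\<And>i. linear_form (\<phi> i)" "\<And>i m. m \<in> J \<Longrightarrow> \<phi> i m = 0"
      "\<And>i. z i \<notin> J \<Longrightarrow> \<phi> i (z i) = 1" by metis
  have \<phi>_eqv: "\<phi> i v = \<phi> i w" if "v \<approx> w" for i v w
    using \<phi>(2)[of "v - w" i] that by (simp add: eqv_def linear_formD[OF \<phi>(1)])
  define lam where "lam = (\<lambda>x. \<Sum>i\<in>V. \<phi> i (x \<star> e i))"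
  have lin: "linear_form lam"
    unfolding linear_form_def lam_def
    by (auto simp: mult_add_left mult_scale_left linear_formD[OF \<phi>(1)] sum.distrib sum_distrib_left)
  have J0: "lam x = 0" if "x \<in> J" for x
    unfolding lam_def using that \<phi>(2) J_mult_right by (intro sum.neutral) auto
  have lam_eqv: "lam v = lam w" if "v \<approx> w" for v w
    using J0[of "v - w"] that by (simp add: eqv_def linear_formD[OF lin])
  have lam_z: "lam (z i) = 1" if i: "i \<in> V" "z i \<notin> J" for i
  proof -
    have zi: "z i \<star> e i \<approx> z i" using z(1)[OF i(1)] by (auto simp: socle_def)
    have "\<phi> j (z i \<star> e j) = (if j = i then 1 else 0)" if j: "j \<in> V" for j
    proof -
      have "\<phi> j (z i \<star> e j) = \<phi> j (z i \<star> e i \<star> e j)"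
        by (intro \<phi>_eqv eqv_mult_right eqv_sym[OF zi])
      also have "\<dots> = (if j = i then \<phi> i (z i \<star> e i) else 0)"
        using i(1) j by (auto simp: mult_assoc e_orth e_idem linear_formD[OF \<phi>(1)])
      finally show ?thesis using \<phi>_eqv[OF zi] \<phi>(3)[OF i(2)] by auto
    qed
    then have "lam (z i) = (\<Sum>j\<in>V. if j = i then 1 else 0)" unfolding lam_def by (intro sum.cong) auto
    then show ?thesis using finite_V i(1) by simp
  qed
  have nondeg: "x \<in> J" if x: "\<And>a. lam (x \<star> a) = 0" for x
  proof (rule ccontr)
    assume xJ: "x \<notin> J"
    define P where "P = (\<lambda>n. \<exists>a\<in>D n. x \<star> a \<notin> J)"
    have "x \<star> (\<Sum>v\<in>V. e v) \<notin> J"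
      using xJ two_sided_eqv[OF two_sided_J eqv_sym[OF right_unit]] by blast
    then have "P 0" by (auto simp: P_def D_0)
    moreover have "\<not> P N" using nil J_mult_left by (auto simp: P_def)
    ultimately have "\<exists>n. P n \<and> \<not> P (Suc n)" by (induction N) auto
    then obtain n a where a: "a \<in> D n" "x \<star> a \<notin> J" and n: "\<And>b. b \<in> D (Suc n) \<Longrightarrow> x \<star> b \<in> J"
      unfolding P_def by blast
    have "\<exists>i\<in>V. x \<star> a \<star> e i \<notin> J"
    proof (rule ccontr)
      assume "\<not> ?thesis"
      then have "(\<Sum>v\<in>V. x \<star> a \<star> e v) \<in> J" by (intro subspace_sum[OF subspace_J]) auto
      then show False using a(2) sum_mult_e[of "x \<star> a"] two_sided_eqv[OF two_sided_J] by blast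
    qed
    then obtain i where i: "i \<in> V" "x \<star> a \<star> e i \<notin> J" by blast
    have "x \<star> (a \<star> (e i \<star> ar b)) \<in> J" if "b \<in> B" for b
      using n D_mult[OF a(1) D_mult[OF _ ar_in_D[OF that], of "e i" 0]] by (simp add: D_0)
    then have "x \<star> a \<star> e i \<in> socle i"
      using i(1) by (auto simp: socle_def mult_assoc e_idem)
    then obtain \<mu> where \<mu>: "x \<star> a \<star> e i \<approx> \<mu> *s z i" using z(2)[OF i(1)] by blast
    then have nz: "\<mu> *s z i \<notin> J" using i(2) two_sided_eqv[OF two_sided_J] by blast
    then have "z i \<notin> J" using subspace_scale[OF subspace_J] by blast
    then have "lam (x \<star> a \<star> e i) = \<mu>" using lam_eqv[OF \<mu>] lam_z[OF i(1)] by (simp add: linear_formD[OF lin])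
    moreover have "lam (x \<star> a \<star> e i) = 0" using x by (simp add: mult_assoc)
    ultimately show False using nz by (auto simp: subspace_0[OF subspace_J])
  qed
  obtain S where S: "finite S" "\<And>x. \<exists>y\<in>span S. x - y \<in> D N" using finite_span_mod_D by blast
  have "span (J \<union> S) = UNIV"
  proof -
    have "x \<in> span (J \<union> S)" for x
    proof -
      obtain y where y: "y \<in> span S" "x - y \<in> J" using S(2) nil by blast
      then have "(x - y) + y \<in> span (J \<union> S)"
        using span_mono[of S "J \<union> S"] by (intro span_add) (auto intro: span_base)
      then show ?thesis by simp
    qed
    then show ?thesis by auto
  qed
  then have "frobenius_form lam" using frobenius_formI[OF S(1) _ lin J0 nondeg] by blast
  then show ?thesis by blast
qed

end


section \<open>Words in simple reflections\<close>

text \<open>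
  The simply laced Coxeter group of the graph \<open>adj\<close> in its reflection representation on the root
  lattice \<open>L\<close>. Group elements are represented by words, equality of group elements by \<open>eqw\<close>.
\<close>

locale weyl_words =
  fixes V :: "'v set" and adj :: "'v \<Rightarrow> 'v \<Rightarrow> bool"
  assumes finite_vertices: "finite V"
    and adj_sym: "i \<in> V \<Longrightarrow> j \<in> V \<Longrightarrow> adj i j \<Longrightarrow> adj j i"
    and adj_irrefl: "i \<in> V \<Longrightarrow> \<not> adj i i"
begin

definition L :: "('v \<Rightarrow> int) set" where "L = {x. \<forall>v. v \<notin> V \<longrightarrow> x v = 0}"

definition nsum :: "'v \<Rightarrow> ('v \<Rightarrow> int) \<Rightarrow> int" where
  "nsum i x = (\<Sum>j | j \<in> V \<and> adj i j. x j)"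

text \<open>The simple reflection in coordinates: with a simply laced Cartan matrix, x i minus the
  pairing 2 x i - \<open>nsum i x\<close> equals \<open>nsum i x - x i\<close>.\<close>

definition refl :: "'v \<Rightarrow> ('v \<Rightarrow> int) \<Rightarrow> ('v \<Rightarrow> int)" where
  "refl i x = x(i := nsum i x - x i)"

definition \<alpha> :: "'v \<Rightarrow> 'v \<Rightarrow> int" where "\<alpha> i = (\<lambda>j. if j = i then 1 else 0)"

lemma nsum_upd:
  assumes "j \<in> V"
  shows "nsum i (x(j := a)) = nsum i x + (if adj i j then a - x j else 0)"
proof -
  have fin: "finite {k. k \<in> V \<and> adj i k}" using finite_vertices by simp
  show ?thesis
  proof (cases "adj i j")
    case True
    then have "nsum i (x(j := a)) = a + (\<Sum>k\<in>{k. k \<in> V \<and> adj i k} - {j}. (x(j := a)) k)"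
      unfolding nsum_def using fin assms by (subst sum.remove[of _ j]) auto
    also have "(\<Sum>k\<in>{k. k \<in> V \<and> adj i k} - {j}. (x(j := a)) k) = (\<Sum>k\<in>{k. k \<in> V \<and> adj i k} - {j}. x k)"
      by (intro sum.cong) auto
    also have "\<dots> = nsum i x - x j"
      unfolding nsum_def using fin assms True by (subst sum.remove[of _ j x]) auto
    finally have "nsum i (x(j := a)) = a + (nsum i x - x j)" .
    then show ?thesis using True by (simp del: fun_upd_apply)
  next
    case False
    then show ?thesis unfolding nsum_def by (auto intro: sum.cong)
  qed
qed

lemma refl_refl: "i \<in> V \<Longrightarrow> refl i (refl i x) = x"
  by (simp add: refl_def nsum_upd adj_irrefl)

lemma refl_commute:
  "i \<in> V \<Longrightarrow> j \<in> V \<Longrightarrow> \<not> adj i j \<Longrightarrow> refl i (refl j x) = refl j (refl i x)"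
  using adj_sym[of j i] by (cases "i = j") (auto simp: refl_def nsum_upd fun_upd_twist)

lemma refl_braid:
  "i \<in> V \<Longrightarrow> j \<in> V \<Longrightarrow> adj i j \<Longrightarrow> refl i (refl j (refl i x)) = refl j (refl i (refl j x))"
  using adj_sym[of i j] adj_irrefl[of i] adj_irrefl[of j]
  by (cases "i = j") (auto simp: refl_def nsum_upd fun_eq_iff)

lemma refl_add: "refl i (\<lambda>v. x v + y v) = (\<lambda>v. refl i x v + refl i y v)"
  by (auto simp: refl_def nsum_def sum.distrib)

lemma refl_scale: "refl i (\<lambda>v. c * x v) = (\<lambda>v. c * refl i x v)"
  by (auto simp: refl_def nsum_def sum_distrib_left algebra_simps)

lemma refl_in_L: "i \<in> V \<Longrightarrow> x \<in> L \<Longrightarrow> refl i x \<in> L"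
  by (auto simp: L_def refl_def)

lemma \<alpha>_in_L: "i \<in> V \<Longrightarrow> \<alpha> i \<in> L"
  by (auto simp: L_def \<alpha>_def)

lemma nsum_\<alpha>: "j \<in> V \<Longrightarrow> nsum i (\<alpha> j) = (if adj i j then 1 else 0)"
  unfolding nsum_def \<alpha>_def using finite_vertices by (auto simp: sum.delta if_distrib)

lemma refl_\<alpha>: "i \<in> V \<Longrightarrow> refl i (\<alpha> i) = (\<lambda>v. (-1) * \<alpha> i v)"
  using adj_irrefl[of i] by (auto simp: refl_def nsum_\<alpha>) (auto simp: \<alpha>_def)

lemma refl_\<alpha>_adj: "i \<in> V \<Longrightarrow> j \<in> V \<Longrightarrow> adj i j \<Longrightarrow> refl i (\<alpha> j) = (\<lambda>v. \<alpha> i v + \<alpha> j v)"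
  using adj_irrefl[of i] by (auto simp: refl_def nsum_\<alpha>) (auto simp: \<alpha>_def)

lemma refl_\<alpha>_nonadj: "i \<in> V \<Longrightarrow> j \<in> V \<Longrightarrow> i \<noteq> j \<Longrightarrow> \<not> adj i j \<Longrightarrow> refl i (\<alpha> j) = \<alpha> j"
  by (auto simp: refl_def nsum_\<alpha>) (auto simp: \<alpha>_def)

definition act :: "'v list \<Rightarrow> ('v \<Rightarrow> int) \<Rightarrow> ('v \<Rightarrow> int)" where "act u = foldr refl u"

lemma act_simps [simp]: "act [] x = x" "act (i # u) x = refl i (act u x)"
  "act (u @ v) x = act u (act v x)"
  by (auto simp: act_def)

lemma act_add: "act u (\<lambda>v. x v + y v) = (\<lambda>v. act u x v + act u y v)"
  by (induction u) (auto simp: refl_add)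

lemma act_scale: "act u (\<lambda>v. c * x v) = (\<lambda>v. c * act u x v)"
  by (induction u) (auto simp: refl_scale)

lemma act_in_L: "set u \<subseteq> V \<Longrightarrow> x \<in> L \<Longrightarrow> act u x \<in> L"
  by (induction u) (auto simp: refl_in_L)

lemma act_rev: "set u \<subseteq> V \<Longrightarrow> act u (act (rev u) x) = x"
  by (induction u arbitrary: x) (auto simp: refl_refl)

lemma act_rev': "set u \<subseteq> V \<Longrightarrow> act (rev u) (act u x) = x"
  using act_rev[of "rev u"] by simp

text \<open>Tested on \<open>L\<close>, since \<open>refl\<close> acts on all functions whereas
  elements of the Weyl group are maps on the root lattice.\<close>

definition eqw :: "'v list \<Rightarrow> 'v list \<Rightarrow> bool" where
  "eqw u v \<longleftrightarrow> (\<forall>x\<in>L. act u x = act v x)"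

lemma eqw_refl [simp]: "eqw u u" by (simp add: eqw_def)
lemma eqw_sym: "eqw u v \<Longrightarrow> eqw v u" by (simp add: eqw_def)
lemma eqw_trans [trans]: "eqw u v \<Longrightarrow> eqw v w \<Longrightarrow> eqw u w" by (simp add: eqw_def)

lemma eqw_append: "set v \<subseteq> V \<Longrightarrow> eqw u u' \<Longrightarrow> eqw v v' \<Longrightarrow> eqw (u @ v) (u' @ v')"
  unfolding eqw_def using act_in_L by (metis act_simps(3))

lemma eqw_left: "set v \<subseteq> V \<Longrightarrow> eqw u u' \<Longrightarrow> eqw (u @ v) (u' @ v)"
  by (simp add: eqw_append)

lemma eqw_right: "eqw v v' \<Longrightarrow> eqw (u @ v) (u @ v')"
  by (simp add: eqw_def)

lemma eqw_cancel_left: "set p \<subseteq> V \<Longrightarrow> eqw (p @ u) (p @ v) \<Longrightarrow> eqw u v"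
  unfolding eqw_def by (metis act_rev' act_simps(3))

lemma eqw_cancel_right:
  assumes p: "set p \<subseteq> V" and e: "eqw (u @ p) (v @ p)"
  shows "eqw u v"
  unfolding eqw_def
proof
  fix x assume x: "x \<in> L"
  then have "act (rev p) x \<in> L" using p by (intro act_in_L) auto
  then show "act u x = act v x" using e p unfolding eqw_def by (metis act_rev act_simps(3))
qed

lemma eqw_rev:
  assumes "set u \<subseteq> V" "set v \<subseteq> V" "eqw u v"
  shows "eqw (rev u) (rev v)"
  unfolding eqw_def
proof
  fix x assume x: "x \<in> L"
  have "act (rev u) x = act (rev u) (act v (act (rev v) x))" using assms by (simp add: act_rev)
  also have "\<dots> = act (rev u) (act u (act (rev v) x))"
    using assms x act_in_L[of "rev v" x] by (simp add: eqw_def)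
  finally show "act (rev u) x = act (rev v) x" using assms by (simp add: act_rev')
qed

lemma eqw_cons_cons: "i \<in> V \<Longrightarrow> eqw (i # i # u) u"
  by (simp add: eqw_def refl_refl)

lemma eqw_snoc_snoc: "i \<in> V \<Longrightarrow> eqw (u @ [i, i]) u"
  by (simp add: eqw_def refl_refl)

section \<open>Length, reduced words and descents\<close>

definition len :: "'v list \<Rightarrow> nat" where
  "len u = (LEAST n. \<exists>v. set v \<subseteq> V \<and> eqw v u \<and> length v = n)"

definition reduced :: "'v list \<Rightarrow> bool" where
  "reduced u \<longleftrightarrow> set u \<subseteq> V \<and> len u = length u"

lemma len_eqw: "eqw u v \<Longrightarrow> len u = len v"
  unfolding len_def by (metis eqw_sym eqw_trans)

lemma len_le: "set v \<subseteq> V \<Longrightarrow> eqw v u \<Longrightarrow> len u \<le> length v"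
  unfolding len_def by (rule Least_le) auto

lemma exists_reduced:
  assumes "set u \<subseteq> V"
  shows "\<exists>v. reduced v \<and> eqw v u \<and> length v = len u"
proof -
  have "\<exists>v. set v \<subseteq> V \<and> eqw v u \<and> length v = len u"
    unfolding len_def by (rule LeastI_ex) (use assms in auto)
  then show ?thesis using len_eqw unfolding reduced_def by metis
qed

lemma len_append_le: "set u \<subseteq> V \<Longrightarrow> set v \<subseteq> V \<Longrightarrow> len (u @ v) \<le> len u + len v"
proof -
  assume uv: "set u \<subseteq> V" "set v \<subseteq> V"
  obtain u' v' where "reduced u'" "eqw u' u" "length u' = len u" "reduced v'" "eqw v' v" "length v' = len v"
    using exists_reduced uv by metis
  then show ?thesis using len_le[of "u' @ v'" "u @ v"] eqw_append[of v' u' u v] by (auto simp: reduced_def)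
qed

lemma len_rev_le: "set u \<subseteq> V \<Longrightarrow> len (rev u) \<le> len u"
  using exists_reduced[of u] eqw_rev[of _ u] len_le[of "rev _" "rev u"]
  by (metis length_rev reduced_def set_rev)

lemma len_rev: "set u \<subseteq> V \<Longrightarrow> len (rev u) = len u"
  using len_rev_le[of u] len_rev_le[of "rev u"] by simp

lemma len_snoc_le: "set u \<subseteq> V \<Longrightarrow> i \<in> V \<Longrightarrow> len (u @ [i]) \<le> Suc (len u)"
  using len_append_le[of u "[i]"] len_le[of "[i]" "[i]"] by simp

lemma len_le_snoc: "set u \<subseteq> V \<Longrightarrow> i \<in> V \<Longrightarrow> len u \<le> Suc (len (u @ [i]))"
  using len_snoc_le[of "u @ [i]" i] len_eqw[OF eqw_snoc_snoc[of i u]] by simp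

lemma reduced_appendD:
  assumes "reduced (u @ v)"
  shows "reduced u" "reduced v"
proof -
  have uv: "set u \<subseteq> V" "set v \<subseteq> V" "len (u @ v) = length u + length v" using assms by (auto simp: reduced_def)
  with len_append_le[of u v] len_le[of u u] len_le[of v v] show "reduced u" "reduced v"
    by (auto simp: reduced_def)
qed

lemma reduced_eqw: "reduced u \<Longrightarrow> reduced v \<Longrightarrow> eqw u v \<Longrightarrow> length u = length v"
  by (metis len_eqw reduced_def)

text \<open>
  Tits' argument: strip off the last letter \<open>j\<close> of a reduced word and, if the length then still
  drops on appending \<open>i\<close>, also an \<open>i\<close>; this reduces to a shorter word \<open>s\<close> with
  \<open>u \<alpha>\<^sub>i = s \<alpha>\<^sub>j\<close>.
\<close>

lemma act_simple_root_nonneg: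
  assumes "set u \<subseteq> V" "i \<in> V" "len u \<le> len (u @ [i])"
  shows "0 \<le> act u (\<alpha> i) v"
  using assms
proof (induction "len u" arbitrary: u i v rule: less_induct)
  case less
  obtain u' where u': "reduced u'" "eqw u' u" "length u' = len u" using exists_reduced less.prems by blast
  have act_u: "act u (\<alpha> i) = act u' (\<alpha> i)" using u'(2) \<alpha>_in_L less.prems(2) by (auto simp: eqw_def)
  show ?case
  proof (cases u' rule: rev_cases)
    case Nil
    then show ?thesis using act_u by (simp add: \<alpha>_def)
  next
    case (snoc t j)
    have t: "reduced t" "set t \<subseteq> V" "j \<in> V" "Suc (len t) = len u"
      using u' snoc reduced_appendD[of t "[j]"] by (auto simp: reduced_def)
    have len_tj: "len (t @ [j]) = len u" using len_eqw[OF u'(2)] snoc by simp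
    have len_ui: "len (t @ [j, i]) = len (u @ [i])"
      using len_eqw[OF eqw_left[of "[i]" u' u]] less.prems u' snoc by simp
    have ij: "i \<noteq> j" using len_eqw[OF eqw_snoc_snoc[OF t(3), of t]] len_ui less.prems(3) t(4) by auto
    have ui: "act u (\<alpha> i) = act t (refl j (\<alpha> i))" using act_u snoc by simp
    show ?thesis
    proof (cases "len t \<le> len (t @ [i])")
      case True
      then have nn: "0 \<le> act t (\<alpha> i) v" using less.hyps[of t i] t less.prems(2) by simp
      show ?thesis
      \<comment> \<open>Reflecting \<alpha> i at j gives \<alpha> i + \<alpha> j or \<alpha> i, and
        by induction t sends these summands to nonnegative vectors.\<close>
      proof (cases "adj j i")
        case True
        have "0 \<le> act t (\<alpha> j) v" using less.hyps[of t j] t len_tj by simp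
        then show ?thesis using nn ui True t(3) less.prems(2) by (simp add: refl_\<alpha>_adj act_add)
      next
        case False
        then show ?thesis using nn ui t(3) less.prems(2) ij by (simp add: refl_\<alpha>_nonadj)
      qed
    next
      case False
      define s where "s = t @ [i]"
      have s: "set s \<subseteq> V" "Suc (len s) = len t" "eqw t (s @ [i])"
        using False t(2) less.prems(2) len_le_snoc[of t i] eqw_sym[OF eqw_snoc_snoc[of i t]] by (auto simp: s_def)
      show ?thesis
      proof (cases "adj j i")
        case True
        have "len s \<le> len (s @ [j])"
        \<comment> \<open>Otherwise u followed by i, which equals s followed by j i j by the braid
          relation, would be shorter than u.\<close>
        proof (rule ccontr)
          assume "\<not> len s \<le> len (s @ [j])"
          moreover have "eqw (t @ [j, i]) (s @ [j, i, j])"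
          proof -
            have "eqw (t @ [j, i]) ((s @ [i]) @ [j, i])" using s(3) t less.prems(2) by (intro eqw_left) auto
            also have "eqw ((s @ [i]) @ [j, i]) (s @ [j, i, j])"
              using refl_braid[of j i] True t(3) less.prems(2) by (simp add: eqw_def)
            finally show ?thesis .
          qed
          then have "len (u @ [i]) = len (s @ [j] @ [i] @ [j])" using len_eqw len_ui by simp
          moreover have "len ((s @ [j]) @ [i]) \<le> Suc (len (s @ [j]))" "len ((s @ [j] @ [i]) @ [j]) \<le> Suc (len (s @ [j] @ [i]))"
            using s(1) t(3) less.prems(2) by (intro len_snoc_le; auto)+
          ultimately show False using less.prems(3) s(2) t(4) by simp
        qed
        then have "0 \<le> act s (\<alpha> j) v" using less.hyps[of s j] s t by simp
        moreover have "act u (\<alpha> i) = act s (\<alpha> j)"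
        proof -
          have "act u (\<alpha> i) = act (s @ [i]) (refl j (\<alpha> i))"
            using ui s(3) t(3) less.prems(2) \<alpha>_in_L refl_in_L unfolding eqw_def by metis
          also have "\<dots> = act s (refl i (\<lambda>v. \<alpha> j v + \<alpha> i v))" using True t(3) less.prems(2) by (simp add: refl_\<alpha>_adj)
          also have "refl i (\<lambda>v. \<alpha> j v + \<alpha> i v) = \<alpha> j"
            using adj_sym[OF _ _ True] t(3) less.prems(2) by (simp add: refl_add refl_\<alpha>_adj refl_\<alpha>)
          finally show ?thesis .
        qed
        ultimately show ?thesis by simp
      next
        case False
        \<comment> \<open>Here u followed by i equals s followed by j, which is too short, so this
          case does not occur.\<close>
        have "eqw (t @ [j, i]) ((s @ [i]) @ [j, i])" using s(3) t less.prems(2) by (intro eqw_left) auto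
        also have "eqw ((s @ [i]) @ [j, i]) (s @ [j])"
          using refl_commute[of j i] False t(3) less.prems(2) by (simp add: eqw_def refl_refl)
        finally have "len (u @ [i]) = len (s @ [j])" using len_eqw len_ui by simp
        then show ?thesis using less.prems(3) len_snoc_le[OF s(1) t(3)] s(2) t(4) by simp
      qed
    qed
  qed
qed

lemma act_simple_root_nonpos:
  assumes "set u \<subseteq> V" "i \<in> V" "len (u @ [i]) < len u"
  shows "act u (\<alpha> i) v \<le> 0"
proof -
  have "len ((u @ [i]) @ [i]) = len u" using len_eqw[OF eqw_snoc_snoc[OF assms(2), of u]] by simp
  then have "0 \<le> act (u @ [i]) (\<alpha> i) v" using assms by (intro act_simple_root_nonneg) auto
  then show ?thesis using assms(2) act_scale[of u "-1" "\<alpha> i"] by (simp add: refl_\<alpha>)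
qed

lemma act_simple_root_nonzero: "set u \<subseteq> V \<Longrightarrow> \<exists>v. act u (\<alpha> i) v \<noteq> 0"
proof (rule ccontr)
  assume u: "set u \<subseteq> V" and "\<nexists>v. act u (\<alpha> i) v \<noteq> 0"
  then have 0: "act u (\<alpha> i) = (\<lambda>v. 0 * 0)" by auto
  have "\<alpha> i = act (rev u) (\<lambda>v. 0 * 0)" using act_rev'[OF u, of "\<alpha> i"] 0 by simp
  also have "\<dots> = (\<lambda>v. 0)" using act_scale[of "rev u" 0 "\<lambda>_. 0"] by simp
  finally show False by (metis \<alpha>_def zero_neq_one)
qed

text \<open>The two sign lemmas exclude each other, since no simple root is sent to 0. Lengths are
  thereby compared through signs of vectors, which are easily transported along words.\<close>

lemma descent_iff:
  assumes "set u \<subseteq> V" "i \<in> V"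
  shows "len (u @ [i]) < len u \<longleftrightarrow> (\<forall>v. act u (\<alpha> i) v \<le> 0)"
  using act_simple_root_nonpos[OF assms] act_simple_root_nonneg[OF assms] act_simple_root_nonzero[OF assms(1), of i]
  by (metis linorder_not_le order_antisym)

lemma descent_len: "set u \<subseteq> V \<Longrightarrow> i \<in> V \<Longrightarrow> len (u @ [i]) < len u \<Longrightarrow> Suc (len (u @ [i])) = len u"
  using len_le_snoc by fastforce

text \<open>If the lengths were equal, \<open>act_simple_root_nonneg\<close> would apply to u
  followed by i, which sends \<alpha> i to the negative of its image under u; then i would be a
  descent of u.\<close>

lemma ascent_len:
  assumes "set u \<subseteq> V" "i \<in> V" "\<not> len (u @ [i]) < len u"
  shows "len (u @ [i]) = Suc (len u)"
proof -
  have "len (u @ [i]) \<noteq> len u"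
  proof
    assume e: "len (u @ [i]) = len u"
    have "len ((u @ [i]) @ [i]) = len u" using len_eqw[OF eqw_snoc_snoc[OF assms(2), of u]] by simp
    then have "0 \<le> act (u @ [i]) (\<alpha> i) v" for v
      using assms e by (intro act_simple_root_nonneg) auto
    then have "\<forall>v. act u (\<alpha> i) v \<le> 0" using assms(2) act_scale[of u "-1" "\<alpha> i"] by (simp add: refl_\<alpha>)
    then show False using descent_iff[OF assms(1,2)] assms(3) by simp
  qed
  then show ?thesis using assms len_snoc_le[OF assms(1,2)] by simp
qed

lemma len_cons: "set u \<subseteq> V \<Longrightarrow> i \<in> V \<Longrightarrow> len (i # u) = len (rev u @ [i])"
  using len_rev[of "i # u"] by simp

lemma left_descent_len: "set u \<subseteq> V \<Longrightarrow> i \<in> V \<Longrightarrow> len (i # u) < len u \<Longrightarrow> Suc (len (i # u)) = len u"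
  using descent_len[of "rev u" i] by (simp add: len_cons len_rev)

lemma left_ascent_len: "set u \<subseteq> V \<Longrightarrow> i \<in> V \<Longrightarrow> \<not> len (i # u) < len u \<Longrightarrow> len (i # u) = Suc (len u)"
  using ascent_len[of "rev u" i] by (simp add: len_cons len_rev)

lemma left_descent_iff:
  "set u \<subseteq> V \<Longrightarrow> i \<in> V \<Longrightarrow> len (i # u) < len u \<longleftrightarrow> (\<forall>v. act (rev u) (\<alpha> i) v \<le> 0)"
  using descent_iff[of "rev u" i] by (simp add: len_cons len_rev)

section \<open>Left descents and Matsumoto's theorem\<close>

lemma left_descent_reduced:
  assumes "set u \<subseteq> V" "i \<in> V" "len (i # u) < len u"
  shows "\<exists>x. reduced (i # x) \<and> eqw (i # x) u \<and> reduced x \<and> Suc (length x) = len u"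
proof -
  obtain x where x: "reduced x" "eqw x (i # u)" "length x = len (i # u)"
    using exists_reduced[of "i # u"] assms by auto
  have "eqw ([i] @ x) ([i] @ i # u)" by (rule eqw_right[OF x(2)])
  then have e: "eqw (i # x) u" using eqw_trans[OF _ eqw_cons_cons[OF assms(2)]] by simp
  then show ?thesis
    using x left_descent_len[OF assms] len_eqw[OF e] assms by (intro exI[of _ x]) (auto simp: reduced_def)
qed

text \<open>The reflection at i fixes \<alpha> j, so j is still a left descent after i has been
  cancelled.\<close>

lemma two_descents_nonadj:
  assumes u: "set u \<subseteq> V" "i \<in> V" "j \<in> V" "i \<noteq> j" "\<not> adj i j"
    and d: "len (i # u) < len u" "len (j # u) < len u"
  shows "\<exists>x. eqw (i # j # x) u \<and> set x \<subseteq> V \<and> length x + 2 = len u"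
proof -
  have "len (j # i # u) < len (i # u)"
    using d u left_descent_iff[of "i # u" j] left_descent_iff[of u j] by (simp add: refl_\<alpha>_nonadj)
  then have l: "Suc (Suc (len (j # i # u))) = len u"
    using left_descent_len[of "i # u" j] left_descent_len[of u i] d u by simp
  obtain x where x: "reduced x" "eqw x (j # i # u)" "length x = len (j # i # u)"
    using exists_reduced[of "j # i # u"] u by auto
  have "eqw ([i, j] @ x) ([i, j] @ j # i # u)" by (rule eqw_right[OF x(2)])
  also have "eqw ([i, j] @ j # i # u) u" using u by (simp add: eqw_def refl_refl)
  finally show ?thesis using x l by (auto simp: reduced_def)
qed

text \<open>The roots that decide the two further cancellations are \<alpha> i + \<alpha> j and
  \<alpha> j; the inverse of u sends both to nonpositive vectors.\<close>

lemma two_descents_adj: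
  assumes u: "set u \<subseteq> V" "i \<in> V" "j \<in> V" "adj i j"
    and d: "len (i # u) < len u" "len (j # u) < len u"
  shows "\<exists>x. eqw (i # j # i # x) u \<and> set x \<subseteq> V \<and> length x + 3 = len u"
proof -
  have ij: "i \<noteq> j" "adj j i" using u adj_irrefl adj_sym by auto
  have neg: "act (rev u) (\<alpha> i) v \<le> 0" "act (rev u) (\<alpha> j) v \<le> 0" for v
    using d u left_descent_iff by auto
  have 1: "len (j # i # u) < len (i # u)"
    using neg u left_descent_iff[of "i # u" j] by (simp add: refl_\<alpha>_adj act_add add_nonpos_nonpos)
  have "refl i (refl j (\<alpha> i)) = \<alpha> j" using u ij by (simp add: refl_\<alpha>_adj refl_add refl_\<alpha>)
  then have 2: "len (i # j # i # u) < len (j # i # u)"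
    using neg u left_descent_iff[of "j # i # u" i] by simp
  have l: "Suc (Suc (Suc (len (i # j # i # u)))) = len u"
    using left_descent_len[of "j # i # u" i] left_descent_len[of "i # u" j] left_descent_len[of u i] d u 1 2 by simp
  obtain x where x: "reduced x" "eqw x (i # j # i # u)" "length x = len (i # j # i # u)"
    using exists_reduced[of "i # j # i # u"] u by auto
  have "eqw ([i, j, i] @ x) ([i, j, i] @ i # j # i # u)" by (rule eqw_right[OF x(2)])
  also have "eqw ([i, j, i] @ i # j # i # u) u" using u by (simp add: eqw_def refl_refl)
  finally show ?thesis using x l by (auto simp: reduced_def)
qed

text \<open>A common first letter is cancelled. If the first letters i and j differ, both are left
  descents, so the element has reduced words beginning with the two sides of the relation between i
  and j; induction links each given word to one of them.\<close>

lemma matsumoto: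
  fixes f :: "'v list \<Rightarrow> 'x"
  assumes cons: "\<And>i u. f (i # u) = g i (f u)"
    and comm: "\<And>i j x. i \<in> V \<Longrightarrow> j \<in> V \<Longrightarrow> i \<noteq> j \<Longrightarrow> \<not> adj i j \<Longrightarrow> f (i # j # x) = f (j # i # x)"
    and braid: "\<And>i j x. i \<in> V \<Longrightarrow> j \<in> V \<Longrightarrow> adj i j \<Longrightarrow> f (i # j # i # x) = f (j # i # j # x)"
    and "reduced u" "reduced v" "eqw u v"
  shows "f u = f v"
  using assms(4-6)
proof (induction "length u" arbitrary: u v rule: less_induct)
  case less
  \<comment> \<open>Only one of the words is asked to be reduced; the other then is as well, having
    the same length and the same value.\<close>
  have IH: "f u' = f v'" if "reduced (i # u')" "eqw (i # u') (i # v')" "length v' = length u'"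
    "length u' < length u" "set v' \<subseteq> V" for i u' v'
  proof -
    have i: "i \<in> V" "reduced u'" using that(1) reduced_appendD[of "[i]" u'] by (auto simp: reduced_def)
    have e: "eqw u' v'" using eqw_cancel_left[of "[i]" u' v'] that i by simp
    then have "reduced v'" using len_eqw[OF e] i that by (auto simp: reduced_def)
    then show ?thesis using less.hyps[of u' v'] e i that by simp
  qed
  have len: "length u = length v" using reduced_eqw less.prems by blast
  show ?case
  proof (cases u)
    case Nil
    then show ?thesis using len by simp
  next
    case (Cons i u')
    then obtain j v' where v: "v = j # v'" using len by (cases v) auto
    have V: "i \<in> V" "j \<in> V" "set u' \<subseteq> V" "set v' \<subseteq> V" "set u \<subseteq> V" using less.prems Cons v by (auto simp: reduced_def)
    have du: "len (i # u) < len u"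
      using len_eqw[OF eqw_cons_cons[OF V(1), of u']] len_le[of u' u'] less.prems Cons V by (simp add: reduced_def)
    have "eqw ([j] @ u) ([j] @ v)" by (intro eqw_right less.prems)
    then have "len (j # u) = len v'"
      using len_eqw eqw_trans[OF _ eqw_cons_cons[OF V(2), of v']] v by (metis append_Cons append_Nil)
    then have dv: "len (j # u) < len u"
      using len_le[of v' v'] less.prems v V len by (simp add: reduced_def)
    show ?thesis
    proof (cases "i = j")
      case True
      then have "f u' = f v'" using IH[of i u' v'] less.prems Cons v len V by simp
      then show ?thesis using True Cons v cons by simp
    next
      case ij: False
      show ?thesis
      proof (cases "adj i j")
        case True
        obtain x where x: "eqw (i # j # i # x) u" "set x \<subseteq> V" "length x + 3 = len u"
          using two_descents_adj[OF V(5,1,2) True du dv] by blast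
        have x': "eqw (i # j # i # x) (j # i # j # x)" using refl_braid[OF V(1,2) True] by (simp add: eqw_def)
        have "f u' = f (j # i # x)"
          using IH[of i u' "j # i # x"] less.prems(1) Cons x V eqw_sym[OF x(1)] by (simp add: reduced_def)
        moreover have "f v' = f (i # j # x)"
          using IH[of j v' "i # j # x"] less.prems v x V len eqw_trans[OF eqw_sym[OF less.prems(3)] eqw_trans[OF eqw_sym[OF x(1)] x']]
          by (simp add: reduced_def)
        ultimately have "f u = f (i # j # i # x)" "f v = f (j # i # j # x)" using cons Cons v by simp_all
        then show ?thesis using braid[OF V(1,2) True] by simp
      next
        case False
        obtain x where x: "eqw (i # j # x) u" "set x \<subseteq> V" "length x + 2 = len u"
          using two_descents_nonadj[OF V(5,1,2) ij False du dv] by blast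
        have x': "eqw (i # j # x) (j # i # x)" using refl_commute[OF V(1,2) False] by (simp add: eqw_def)
        have "f u' = f (j # x)"
          using IH[of i u' "j # x"] less.prems(1) Cons x V eqw_sym[OF x(1)] by (simp add: reduced_def)
        moreover have "f v' = f (i # x)"
          using IH[of j v' "i # x"] less.prems v x V len eqw_trans[OF eqw_sym[OF less.prems(3)] eqw_trans[OF eqw_sym[OF x(1)] x']]
          by (simp add: reduced_def)
        ultimately have "f u = f (i # j # x)" "f v = f (j # i # x)" using cons Cons v by simp_all
        then show ?thesis using comm[OF V(1,2) ij False] by simp
      qed
    qed
  qed
qed

section \<open>The longest element\<close>

definition longest :: "'v list \<Rightarrow> bool" where
  "longest z \<longleftrightarrow> set z \<subseteq> V \<and> (\<forall>v. set v \<subseteq> V \<longrightarrow> len v \<le> len z)"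

lemma longestD: "longest z \<Longrightarrow> set z \<subseteq> V" "longest z \<Longrightarrow> set v \<subseteq> V \<Longrightarrow> len v \<le> len z"
  unfolding longest_def by auto

lemma longest_descent: "longest z \<Longrightarrow> i \<in> V \<Longrightarrow> len (z @ [i]) < len z"
  using ascent_len[of z i] longestD(1)[of z] longestD(2)[of z "z @ [i]"] by fastforce

lemma longest_left_descent: "longest z \<Longrightarrow> i \<in> V \<Longrightarrow> len (i # z) < len z"
  using left_ascent_len[of z i] longestD(1)[of z] longestD(2)[of z "i # z"] by fastforce

lemma L_decomp: "x \<in> L \<Longrightarrow> x = (\<lambda>v. \<Sum>i\<in>V. x i * \<alpha> i v)"
  using finite_vertices by (auto simp: L_def \<alpha>_def sum.delta' if_distrib fun_eq_iff cong: if_cong)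

lemma act_sum: "finite S \<Longrightarrow> act u (\<lambda>v. \<Sum>i\<in>S. c i * y i v) = (\<lambda>v. \<Sum>i\<in>S. c i * act u (y i) v)"
proof (induction S rule: finite_induct)
  case empty
  show ?case using act_scale[of u 0 "\<lambda>_. 0"] by simp
next
  case (insert a S)
  then show ?case using act_add[of u "\<lambda>v. c a * y a v" "\<lambda>v. \<Sum>i\<in>S. c i * y i v"] act_scale[of u "c a" "y a"] by simp
qed

text \<open>Let t be the inverse of u times z. Both factors send simple roots to nonpositive
  combinations, so t sends them to nonnegative ones. A nonempty reduced word for t would have a
  descent, forcing the image of a simple root to be 0.\<close>

lemma all_left_descents_longest:
  assumes z: "longest z" and u: "set u \<subseteq> V" "\<And>i. i \<in> V \<Longrightarrow> len (i # u) < len u"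
  shows "eqw u z"
proof -
  define t where "t = rev u @ z"
  have zV: "set z \<subseteq> V" and tV: "set t \<subseteq> V" using z u by (auto simp: longest_def t_def)
  have nonneg: "0 \<le> act t (\<alpha> i) v" if i: "i \<in> V" for i v
  proof -
    have zi: "act z (\<alpha> i) \<in> L" using zV i by (intro act_in_L \<alpha>_in_L)
    have "act t (\<alpha> i) = act (rev u) (act z (\<alpha> i))" by (simp add: t_def)
    also have "\<dots> = act (rev u) (\<lambda>v. \<Sum>j\<in>V. act z (\<alpha> i) j * \<alpha> j v)" using L_decomp[OF zi] by simp
    also have "\<dots> = (\<lambda>v. \<Sum>j\<in>V. act z (\<alpha> i) j * act (rev u) (\<alpha> j) v)" by (rule act_sum[OF finite_vertices])
    finally have "act t (\<alpha> i) v = (\<Sum>j\<in>V. act z (\<alpha> i) j * act (rev u) (\<alpha> j) v)" by simp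
    moreover have "act z (\<alpha> i) j \<le> 0" for j using act_simple_root_nonpos[OF zV i longest_descent[OF z i]] .
    moreover have "act (rev u) (\<alpha> j) v \<le> 0" if "j \<in> V" for j using left_descent_iff u that by blast
    ultimately show ?thesis by (auto intro!: sum_nonneg mult_nonpos_nonpos)
  qed
  obtain t' where t': "reduced t'" "eqw t' t" "length t' = len t" using exists_reduced[OF tV] by blast
  have "t' = []"
  proof (cases t' rule: rev_cases)
    case (snoc s j)
    have j: "j \<in> V" "set s \<subseteq> V" using t' snoc by (auto simp: reduced_def)
    have "len (t @ [j]) = len (s @ [j, j])"
      using len_eqw[OF eqw_left[of "[j]" t' t]] t'(2) j snoc by simp
    also have "\<dots> = len s" by (rule len_eqw[OF eqw_snoc_snoc[OF j(1)]])
    also have "\<dots> < len t" using len_le[of s s] j t' snoc by (auto simp: reduced_def)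
    finally have "act t (\<alpha> j) v \<le> 0" for v using descent_iff[OF tV j(1)] by blast
    then have "act t (\<alpha> j) v = 0" for v using nonneg[OF j(1)] by (simp add: order_antisym)
    then show ?thesis using act_simple_root_nonzero[OF tV] by blast
  qed
  then have "eqw (rev u @ z) (rev u @ u)"
    using t'(2) act_rev'[OF u(1)] by (simp add: eqw_def t_def)
  then show ?thesis using eqw_cancel_left[of "rev u" z u] u eqw_sym by simp
qed

text \<open>Left ascents are prepended as long as there is one; the length is bounded by that of z,
  and a word all of whose left letters are descents represents z.\<close>

lemma extend_to_longest:
  assumes z: "longest z" and u: "reduced u"
  shows "\<exists>p. set p \<subseteq> V \<and> eqw (p @ u) z \<and> length p + length u = len z"
  using u
proof (induction "len z - length u" arbitrary: u rule: less_induct)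
  case less
  have u: "set u \<subseteq> V" "len u = length u" using less.prems by (auto simp: reduced_def)
  show ?case
  proof (cases "\<forall>i\<in>V. len (i # u) < len u")
    case True
    then have "eqw u z" using all_left_descents_longest[OF z u(1)] by blast
    then show ?thesis using u len_eqw by (intro exI[of _ "[]"]) auto
  next
    case False
    then obtain i where i: "i \<in> V" "len (i # u) = Suc (len u)" using left_ascent_len[OF u(1)] by blast
    then have "len (i # u) \<le> len z" using longestD(2)[OF z, of "i # u"] u(1) by auto
    then have "len z - length (i # u) < len z - length u" "reduced (i # u)"
      using i u by (auto simp: reduced_def)
    then obtain p where "set p \<subseteq> V" "eqw (p @ i # u) z" "length p + length (i # u) = len z"
      using less.hyps by blast
    then show ?thesis using i by (intro exI[of _ "p @ [i]"]) auto
  qed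
qed

text \<open>Cancelling u from an extension of u to z leaves a word for v of the complementary
  length; so the lengths of w_0 w^-1 and w add up to that of w_0.\<close>

lemma longest_complement_length:
  assumes z: "longest z" and u: "reduced u" and v: "reduced v" and e: "eqw (v @ u) z"
  shows "length v + length u = len z"
proof -
  obtain p where p: "set p \<subseteq> V" "eqw (p @ u) z" "length p + length u = len z"
    using extend_to_longest[OF z u] by blast
  have uV: "set u \<subseteq> V" "set v \<subseteq> V" "len u = length u" "len v = length v" using u v by (auto simp: reduced_def)
  have "eqw (p @ u) (v @ u)" by (rule eqw_trans[OF p(2) eqw_sym[OF e]])
  then have "eqw p v" by (rule eqw_cancel_right[OF uV(1)])
  then have "len v \<le> length p" using len_le p by blast
  moreover have "len z \<le> len v + len u" using len_append_le[OF uV(2,1)] len_eqw[OF e] by simp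
  ultimately show ?thesis using p(3) uV by simp
qed

end


section \<open>The ideals of Weyl group elements\<close>

context mesh_algebra begin

definition adj :: "'v \<Rightarrow> 'v \<Rightarrow> bool" where "adj i j \<longleftrightarrow> (\<exists>c\<in>B. src c = i \<and> tgt c = j)"

sublocale weyl_words V adj
proof
  show "finite V" by (rule finite_V)
  show "adj j i" if a: "adj i j" for i j
  proof -
    obtain c where "c \<in> B" "src c = i" "tgt c = j" using a by (auto simp: adj_def)
    then show ?thesis unfolding adj_def by (intro bexI[of _ "rev_arrow c"]) (auto simp: src_rev tgt_rev rev_in_B)
  qed
  show "\<not> adj i i" for i using no_loops by (force simp: adj_def)
qed

text \<open>A new first letter multiplies from the right: the same reversal of the product as in
  I_w.\<close>

primrec idl :: "'v list \<Rightarrow> 'r set" where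
  "idl [] = UNIV"
| "idl (i # u) = iprod (idl u) (K {i})"

lemma two_sided_idl: "two_sided (idl u)"
  by (induction u) (auto intro: two_sided_UNIV two_sided_iprod two_sided_K)

lemma idl_reduced:
  assumes "reduced u" "reduced v" "eqw u v"
  shows "idl u = idl v"
proof (rule matsumoto[where f = idl and g = "\<lambda>i X. iprod X (K {i})", OF _ _ _ assms])
  fix i j x assume ij: "i \<in> V" "j \<in> V" "i \<noteq> j" "\<not> adj i j"
  then have na: "\<not> adj j i" using adj_sym by blast
  have "iprod (K {j}) (K {i}) = K {j, i}"
    using ij by (intro iprod_K_nonadjacent) (auto simp: adj_def)
  moreover have "iprod (K {i}) (K {j}) = K {i, j}"
    using ij na by (intro iprod_K_nonadjacent) (auto simp: adj_def)
  ultimately show "idl (i # j # x) = idl (j # i # x)" by (simp add: iprod_assoc insert_commute)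
next
  fix i j x assume ij: "i \<in> V" "j \<in> V" "adj i j"
  then obtain c where c: "c \<in> B" "src c = i" "tgt c = j" by (auto simp: adj_def)
  then have rc: "rev_arrow c \<in> B" "src (rev_arrow c) = j" "tgt (rev_arrow c) = i"
    by (auto simp: rev_in_B src_rev tgt_rev)
  from iprod_K_adjacent[OF c] iprod_K_adjacent[OF rc]
  show "idl (i # j # i # x) = idl (j # i # j # x)" by (simp add: iprod_assoc insert_commute)
qed simp

text \<open>Let u = j w. If i is no left descent of w, the factor I_j preserves closedness at i.
  Otherwise w = i x, where i and j must be adjacent and both ascents of x, and
  \<open>closed_at_iprod_adjacent\<close> applies.\<close>

lemma closed_at_idl:
  assumes "reduced u" "i \<in> V" "\<not> len (i # u) < len u"
  shows "closed_at i (idl u)"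
  using assms
proof (induction "length u" arbitrary: u i rule: less_induct)
  case less
  show ?case
  proof (cases u)
    case Nil
    then show ?thesis by (simp add: closed_at_UNIV)
  next
    case (Cons j w)
    have w: "reduced w" "set w \<subseteq> V" "len w = length w" "j \<in> V" "len u = Suc (length w)"
      using less.prems(1) reduced_appendD[of "[j]" w] Cons by (auto simp: reduced_def)
    have ij: "i \<noteq> j" using len_eqw[OF eqw_cons_cons[OF w(4), of w]] less.prems(3) Cons w by auto
    show ?thesis
    proof (cases "len (i # w) < len w")
      case False
      then have "closed_at i (idl w)" using less.hyps[of w i] Cons w less.prems(2) by simp
      then show ?thesis using closed_at_iprod[OF two_sided_idl] less.prems(2) w(4) ij Cons by simp
    next
      case True
      then obtain x where x: "reduced (i # x)" "eqw (i # x) w" "reduced x" "Suc (length x) = len w"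
        using left_descent_reduced[OF w(2) less.prems(2)] by blast
      have xV: "set x \<subseteq> V" "len x = length x" using x(3) by (auto simp: reduced_def)
      have iu: "eqw (i # u) (i # j # i # x)"
        using eqw_right[OF eqw_sym[OF x(2)], of "[i, j]"] Cons by simp
      show ?thesis
      proof (cases "adj i j")
        case False
        \<comment> \<open>For commuting i and j, the element i u = j x would be shorter than
          u.\<close>
        have "eqw (i # j # i # x) (j # x)"
          using False w(4) less.prems(2) refl_commute[of i j] by (simp add: eqw_def refl_refl)
        then have "len (i # u) = len (j # x)" using len_eqw eqw_trans[OF iu] by blast
        moreover have "len (j # x) \<le> Suc (length x)" using len_le[of "j # x" "j # x"] xV w(4) by simp
        ultimately show ?thesis using less.prems(3) x(4) w by simp
      next
        case True
        then obtain c where c: "c \<in> B" "src c = i" "tgt c = j" by (auto simp: adj_def)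
        have "closed_at i (idl x)"
          using less.hyps[of x i] x xV less.prems(2) Cons w by (simp add: reduced_def)
        moreover have "\<not> len (j # x) < len x"
        proof
          assume jx: "len (j # x) < len x"
          \<comment> \<open>If j were a left descent of x, this rewriting of i u would make it
            shorter than u.\<close>
          have "eqw (i # j # i # x) (j # i # j # x)"
            using refl_braid[OF less.prems(2) w(4) True] by (simp add: eqw_def)
          then have "eqw (i # u) (j # i # j # x)" by (rule eqw_trans[OF iu])
          then have "len (i # u) = len ([j, i] @ j # x)" using len_eqw by simp
          also have "\<dots> \<le> len [j, i] + len (j # x)" using xV w(4) less.prems(2) by (intro len_append_le) auto
          also have "\<dots> < 2 + len x" using len_le[of "[j, i]" "[j, i]"] jx w(4) less.prems(2) by simp
          finally show False using less.prems(3) w x(4) xV by simp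
        qed
        then have "closed_at j (idl x)" using less.hyps[of x j] x xV Cons w by simp
        ultimately have "closed_at i (iprod (iprod (idl x) (K {i})) (K {j}))"
          by (intro closed_at_iprod_adjacent[OF two_sided_idl _ _ c])
        moreover have "idl w = idl (i # x)" using idl_reduced[OF w(1) x(1) eqw_sym[OF x(2)]] .
        ultimately show ?thesis using Cons by simp
      qed
    qed
  qed
qed

text \<open>Every arrow lies in each \<open>K {i}\<close>, as there are no loops; a path of n arrows
  thus lies in a product of n such ideals.\<close>

lemma D_subset_idl: "set u \<subseteq> V \<Longrightarrow> D (length u) \<subseteq> idl u"
proof (induction u)
  case (Cons i u)
  show ?case
  proof
    fix x assume "x \<in> D (length (i # u))"
    then obtain y where y: "\<And>b. y b \<in> D (length u)" "x \<approx> (\<Sum>b\<in>B. y b \<star> ar b)"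
      using D_right[of x "length u"] by auto
    have "y b \<star> ar b \<in> idl (i # u)" if "b \<in> B" for b
      using Cons y(1)[of b] that no_loops[OF that] by (auto intro!: mult_in_iprod ar_in_K)
    then have "(\<Sum>b\<in>B. y b \<star> ar b) \<in> idl (i # u)"
      by (intro subspace_sum[OF two_sidedD(1)[OF two_sided_idl]])
    then show "x \<in> idl (i # u)" using two_sided_eqv[OF two_sided_idl y(2)] by blast
  qed
qed simp

text \<open>Stability at i rewrites x e i through the arrows into i with coefficients again in X, so
  X lies in every \<open>D n\<close>: a Nakayama argument valid before finite dimension is
  known.\<close>

lemma stable_two_sided_zero:
  assumes X: "two_sided X" and stable: "\<And>i. i \<in> V \<Longrightarrow> X \<subseteq> iprod X (K {i})"
  shows "X = J"
proof
  show "J \<subseteq> X" using two_sidedD(2)[OF X] .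
  have "X \<subseteq> D n" for n
  proof (induction n)
    case 0
    show ?case by (simp add: D_0)
  next
    case (Suc n)
    show ?case
    proof
      fix x assume x: "x \<in> X"
      have "x \<star> e i \<in> D (Suc n)" if i: "i \<in> V" for i
      proof -
        obtain y where y: "\<And>b. y b \<in> X" "x \<star> e i \<approx> (\<Sum>b\<in>into i. y b \<star> ar b)"
          using iprod_K_iff[OF X i, of x] stable[OF i] x by auto
        have "y b \<star> ar b \<in> D (Suc n)" if "b \<in> into i" for b
          using D_mult[of "y b" n "ar b" 1] y(1)[of b] Suc ar_in_D[of b] that by auto
        then have "(\<Sum>b\<in>into i. y b \<star> ar b) \<in> D (Suc n)" by (intro subspace_sum[OF subspace_D])
        then show ?thesis using eqv_mem[OF subspace_D J_subset_D y(2)] by blast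
      qed
      then have "(\<Sum>i\<in>V. x \<star> e i) \<in> D (Suc n)" by (intro subspace_sum[OF subspace_D])
      then show "x \<in> D (Suc n)" using eqv_mem[OF subspace_D J_subset_D sum_mult_e] by blast
    qed
  qed
  then show "X \<subseteq> J" using D_Inter by blast
qed

text \<open>A longest element has a reduced word starting with any given i, and I_i is idempotent;
  this yields the stability required.\<close>

lemma idl_longest:
  assumes z: "longest z" and r: "reduced r" "eqw r z"
  shows "idl r = J"
proof (rule stable_two_sided_zero[OF two_sided_idl])
  fix i assume i: "i \<in> V"
  have rV: "set r \<subseteq> V" using r by (simp add: reduced_def)
  have "longest r" using z rV len_eqw[OF r(2)] by (simp add: longest_def)
  then obtain x where x: "reduced (i # x)" "eqw (i # x) r"
    using left_descent_reduced[OF rV i longest_left_descent] i by blast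
  have e: "idl r = iprod (idl x) (K {i})" using idl_reduced[OF r(1) x(1) eqw_sym[OF x(2)]] by simp
  then have "iprod (idl r) (K {i}) = idl r" by (simp add: iprod_assoc iprod_K_idem)
  then show "idl r \<subseteq> iprod (idl r) (K {i})" by simp
qed

lemma exists_frobenius_form_longest:
  assumes z: "longest z"
  shows "\<exists>lam. frobenius_form lam"
proof -
  obtain r where r: "reduced r" "eqw r z" using exists_reduced longestD(1)[OF z] by blast
  then have "D (length r) \<subseteq> J" using D_subset_idl[of r] idl_longest[OF z r] by (simp add: reduced_def)
  then show ?thesis by (rule exists_frobenius_form)
qed

text \<open>Lets letters be removed at the end of a word. In the base case the whole algebra times
  I_j and I_j times the whole algebra both equal I_j, by idempotence.\<close>

lemma idl_snoc: "idl (u @ [j]) = iprod (K {j}) (idl u)"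
proof (induction u)
  case Nil
  have "iprod UNIV (K {j}) = K {j}"
  proof
    show "iprod UNIV (K {j}) \<subseteq> K {j}" by (rule iprod_subset_right[OF two_sided_K])
    show "K {j} \<subseteq> iprod UNIV (K {j})" using iprod_mono[of "K {j}" UNIV "K {j}" "K {j}"] by (simp add: iprod_K_idem)
  qed
  moreover have "iprod (K {j}) UNIV = K {j}"
  proof
    show "iprod (K {j}) UNIV \<subseteq> K {j}" by (rule iprod_subset_left[OF two_sided_K])
    show "K {j} \<subseteq> iprod (K {j}) UNIV" using iprod_mono[of "K {j}" "K {j}" "K {j}" UNIV] by (simp add: iprod_K_idem)
  qed
  ultimately show ?case by simp
next
  case (Cons i u)
  then show ?case by (simp add: iprod_assoc)
qed

text \<open>The form in which closedness is applied: \<open>K {j}\<close> contains the arrows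
  starting at j and all other idempotents.\<close>

lemma mem_of_mult_K:
  assumes X: "two_sided X" "closed_at j X" and j: "j \<in> V" and x: "\<And>k. k \<in> K {j} \<Longrightarrow> x \<star> k \<in> X"
  shows "x \<in> X"
proof -
  have "x \<star> e v \<in> X" if v: "v \<in> V" for v
  proof (cases "v = j")
    case True
    have "x \<star> ar b \<in> X" if "b \<in> B" "src b = j" for b
      using that no_loops[OF that(1)] by (intro x ar_in_K) auto
    then show ?thesis using X(2) True by (auto simp: closed_at_def)
  qed (use v x e_in_K in auto)
  then have "(\<Sum>v\<in>V. x \<star> e v) \<in> X" by (intro subspace_sum[OF two_sidedD(1)[OF X(1)]])
  then show ?thesis using two_sided_eqv[OF X(1) sum_mult_e] by blast
qed

text \<open>
  With \<open>R\<close> the right annihilator of \<open>I\<^sub>u\<close>, closedness of \<open>I\<^sub>u\<close> at \<open>j\<close> says that \<open>I\<^sub>j R\<close> and \<open>R\<close> have the same left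
  annihilator, so \<open>R = I\<^sub>j R\<close>, and this is \<open>I\<^sub>j\<close> times the right annihilator of \<open>I\<^sub>u I\<^sub>j\<close>.
\<close>

lemma rann_idl_aux:
  assumes lam: "frobenius_form lam" and z: "longest z"
    and "reduced u" "set v \<subseteq> V" "eqw (v @ u) z" "length v + length u = len z"
  shows "rann (idl u) = idl v"
  using assms(3-6)
proof (induction v arbitrary: u rule: rev_induct)
  case Nil
  \<comment> \<open>All of z has been moved into u, so I_u vanishes and its annihilator is
    everything.\<close>
  then have "idl u = J" using idl_longest[OF z] by simp
  then show ?case using J_mult_right by (auto simp: rann_def)
next
  case (snoc j v)
  have j: "j \<in> V" "set v \<subseteq> V" "set u \<subseteq> V" using snoc.prems by (auto simp: reduced_def)
  have "len (v @ j # u) = length (v @ j # u)" using len_eqw[OF snoc.prems(3)] snoc.prems(4) by simp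
  then have ju: "reduced (j # u)" using j reduced_appendD[of v "j # u"] by (simp add: reduced_def)
  have IH: "rann (idl (j # u)) = idl v" using snoc.IH[of "j # u"] ju j snoc.prems by simp
  have "\<not> len (j # u) < len u" using ju snoc.prems(1) by (simp add: reduced_def)
  then have closed: "closed_at j (idl u)" using closed_at_idl snoc.prems(1) j by blast
  define R where "R = rann (idl u)"
  have R: "two_sided R" unfolding R_def by (rule two_sided_rann[OF two_sided_idl])
  have lannR: "lann R = idl u" unfolding R_def by (rule lann_rann[OF lam two_sided_idl])
  have KR: "two_sided (iprod (K {j}) R)" by (rule two_sided_iprod[OF two_sided_K R])
  have "lann (iprod (K {j}) R) \<subseteq> lann R"
  proof
    fix x assume x: "x \<in> lann (iprod (K {j}) R)"
    have "x \<star> k \<in> lann R" if "k \<in> K {j}" for k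
      using x mult_in_iprod[OF that, of _ R] by (auto simp: lann_def mult_assoc)
    then show "x \<in> lann R" using mem_of_mult_K[OF two_sided_idl closed j(1)] lannR by auto
  qed
  \<comment> \<open>Taking right annihilators reverses the inclusion, and the double annihilator
    property then removes \<open>lann\<close> on both sides.\<close>
  then have "rann (lann R) \<subseteq> rann (lann (iprod (K {j}) R))" by (auto simp: rann_def)
  then have sub: "R \<subseteq> iprod (K {j}) R" using rann_lann[OF lam R] rann_lann[OF lam KR] by simp
  have "R \<subseteq> idl v"
    unfolding R_def IH[symmetric] using iprod_subset_left[OF two_sided_idl[of u]] by (auto simp: rann_def)
  then have "R \<subseteq> iprod (K {j}) (idl v)" using sub iprod_mono[of "K {j}" "K {j}" R "idl v"] by blast
  moreover have "iprod (K {j}) (idl v) \<subseteq> R"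
  proof (rule iprod_least[OF two_sidedD(1,2)[OF R]])
    fix k a assume k: "k \<in> K {j}" and a: "a \<in> idl v"
    have "x \<star> k \<star> a \<in> J" if "x \<in> idl u" for x
      using a mult_in_iprod[OF that k] unfolding IH[symmetric] by (simp add: rann_def)
    then show "k \<star> a \<in> R" by (simp add: R_def rann_def mult_assoc)
  qed
  ultimately show ?case by (simp add: R_def idl_snoc)
qed

lemma rann_idl:
  assumes lam: "frobenius_form lam" and z: "longest z"
    and uv: "reduced u" "reduced v" "eqw (v @ u) z"
  shows "rann (idl u) = idl v"
  using rann_idl_aux[OF lam z uv(1) _ uv(3) longest_complement_length[OF z uv]] uv(2) by (simp add: reduced_def)

lemma lann_idl:
  assumes lam: "frobenius_form lam" and z: "longest z"
    and uv: "reduced u" "reduced v" "eqw (v @ u) z"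
  shows "lann (idl v) = idl u"
  using lann_rann[OF lam two_sided_idl, of u] rann_idl[OF assms] by simp

end


section \<open>Path algebras on finitely supported functions\<close>

abbreviation lookup :: "('w \<Rightarrow>\<^sub>0 'k::zero) \<Rightarrow> 'w \<Rightarrow> 'k" where "lookup \<equiv> Poly_Mapping.lookup"
abbreviation keys :: "('w \<Rightarrow>\<^sub>0 'k::zero) \<Rightarrow> 'w set" where "keys \<equiv> Poly_Mapping.keys"

definition smul :: "'k::field \<Rightarrow> ('w \<Rightarrow>\<^sub>0 'k) \<Rightarrow> ('w \<Rightarrow>\<^sub>0 'k)" where
  "smul c f = Poly_Mapping.map ((*) c) f"

lemma lookup_smul [simp]: "lookup (smul c f) x = c * lookup f x"
  unfolding smul_def by (cases "lookup f x = 0") (simp_all add: Poly_Mapping.map.rep_eq)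

interpretation pm: vector_space "smul :: 'k::field \<Rightarrow> ('w \<Rightarrow>\<^sub>0 'k) \<Rightarrow> ('w \<Rightarrow>\<^sub>0 'k)"
  by unfold_locales (auto intro!: poly_mapping_eqI simp: lookup_add algebra_simps)

abbreviation wd :: "'w \<Rightarrow> 'w \<Rightarrow>\<^sub>0 'k::field" where "wd x \<equiv> Poly_Mapping.single x 1"

lemma lookup_wd: "lookup (wd x) y = (if x = y then 1 else 0)"
  by (simp add: lookup_single when_def)

lemma sum_words: "f = (\<Sum>x\<in>keys f. smul (lookup f x) (wd x))"
proof (rule poly_mapping_eqI)
  fix y
  have "lookup (\<Sum>x\<in>keys f. smul (lookup f x) (wd x)) y = (\<Sum>x\<in>keys f. if x = y then lookup f y else 0)"
    unfolding lookup_sum by (intro sum.cong) (auto simp: lookup_wd)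
  also have "\<dots> = lookup f y" by (simp add: in_keys_iff)
  finally show "lookup f y = lookup (\<Sum>x\<in>keys f. smul (lookup f x) (wd x)) y" by simp
qed

lemma word_induct:
  assumes "pm.subspace {f. P f}" "\<And>x. x \<in> keys f \<Longrightarrow> P (wd x)"
  shows "P f"
proof -
  have "(\<Sum>x\<in>keys f. smul (lookup f x) (wd x)) \<in> {f. P f}"
    using assms by (intro pm.subspace_sum pm.subspace_scale) auto
  then show ?thesis using sum_words[of f] by simp
qed

definition linear_op :: "(('w \<Rightarrow>\<^sub>0 'k::field) \<Rightarrow> ('u \<Rightarrow>\<^sub>0 'k)) \<Rightarrow> bool" where
  "linear_op F \<longleftrightarrow> (\<forall>f g. F (f + g) = F f + F g) \<and> (\<forall>c f. F (smul c f) = smul c (F f))"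

lemma linear_opD:
  assumes "linear_op F"
  shows "F (f + g) = F f + F g" "F (smul c f) = smul c (F f)" "F 0 = 0"
    "F (sum h A) = (\<Sum>a\<in>A. F (h a))"
proof -
  show add: "F (f + g) = F f + F g" and scale: "F (smul c f) = smul c (F f)" for f g c
    using assms unfolding linear_op_def by auto
  show 0: "F 0 = 0" using scale[of 0 0] by simp
  show "F (sum h A) = (\<Sum>a\<in>A. F (h a))"
    by (induction A rule: infinite_finite_induct) (auto simp: 0 add)
qed

lemma subspace_vimage: "linear_op F \<Longrightarrow> pm.subspace S \<Longrightarrow> pm.subspace {f. F f \<in> S}"
  by (auto simp: pm.subspace_def linear_opD)

lemma subspace_eq: "linear_op F \<Longrightarrow> linear_op G \<Longrightarrow> pm.subspace {f. F f = G f}"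
  by (auto simp: pm.subspace_def linear_opD)

lemma linear_op_comp: "linear_op F \<Longrightarrow> linear_op G \<Longrightarrow> linear_op (\<lambda>f. F (G f))"
  by (simp add: linear_op_def)

lemma linear_op_id: "linear_op (\<lambda>f. f)" by (simp add: linear_op_def)

lemma linear_op_diff: "linear_op F \<Longrightarrow> linear_op G \<Longrightarrow> linear_op (\<lambda>f. F f - G f)"
  by (simp add: linear_op_def pm.scale_right_diff_distrib)

lemma linear_op_eqI:
  assumes "linear_op F" "linear_op G" "\<And>x. F (wd x) = G (wd x)"
  shows "F f = G f"
  using word_induct[of "\<lambda>f. F f = G f", OF subspace_eq[OF assms(1,2)]] assms(3) by blast

lemma linear_op_memI:
  assumes "linear_op F" "pm.subspace S" "\<And>x. x \<in> keys f \<Longrightarrow> F (wd x) \<in> S"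
  shows "F f \<in> S"
  using word_induct[of "\<lambda>f. F f \<in> S", OF subspace_vimage[OF assms(1,2)]] assms(3) by blast

lemma linear_op_span:
  assumes "linear_op F" "pm.subspace S" "\<And>x. x \<in> X \<Longrightarrow> F x \<in> S" "f \<in> pm.span X"
  shows "F f \<in> S"
  using pm.span_minimal[of X "{f. F f \<in> S}"] subspace_vimage[OF assms(1,2)] assms(3,4) by blast

context wf_digraph begin

text \<open>The convolution of \<open>path_algebra\<close> on all words. It is associative even off
  the walks, because \<open>awlast\<close> is total and compatible with concatenation for every list
  of arrows.\<close>

definition fmul :: "('a \<times> 'b list \<Rightarrow> 'k::field) \<Rightarrow> ('a \<times> 'b list \<Rightarrow> 'k) \<Rightarrow> ('a \<times> 'b list \<Rightarrow> 'k)" where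
  "fmul f g = (\<lambda>(u, p). \<Sum>i\<le>length p. f (u, take i p) * g (awlast u (take i p), drop i p))"

lemma finite_fmul:
  assumes "finite {x. f x \<noteq> 0}" "finite {x. g x \<noteq> 0}"
  shows "finite {x. fmul f g x \<noteq> 0}"
proof (rule finite_subset)
  show "{x. fmul f g x \<noteq> 0} \<subseteq> (\<lambda>((u, p), (v, q)). (u, p @ q)) ` ({x. f x \<noteq> 0} \<times> {x. g x \<noteq> 0})"
  proof
    fix x assume "x \<in> {x. fmul f g x \<noteq> 0}"
    then obtain u p where x: "x = (u, p)" "fmul f g (u, p) \<noteq> 0" by (cases x) auto
    then obtain i where "f (u, take i p) * g (awlast u (take i p), drop i p) \<noteq> 0"
      unfolding fmul_def by (auto elim: sum.not_neutral_contains_not_neutral)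
    then have "((u, take i p), (awlast u (take i p), drop i p)) \<in> {x. f x \<noteq> 0} \<times> {x. g x \<noteq> 0}" by auto
    then show "x \<in> (\<lambda>((u, p), (v, q)). (u, p @ q)) ` ({x. f x \<noteq> 0} \<times> {x. g x \<noteq> 0})"
      unfolding x(1) by (rule rev_image_eqI) simp
  qed
qed (use assms in simp)

definition pmul :: "('a \<times> 'b list \<Rightarrow>\<^sub>0 'k::field) \<Rightarrow> ('a \<times> 'b list \<Rightarrow>\<^sub>0 'k) \<Rightarrow> ('a \<times> 'b list \<Rightarrow>\<^sub>0 'k)" where
  "pmul f g = Abs_poly_mapping (fmul (lookup f) (lookup g))"

lemma lookup_pmul: "lookup (pmul f g) = fmul (lookup f) (lookup g)"
  unfolding pmul_def by (intro lookup_Abs_poly_mapping finite_fmul) (auto simp: keys.rep_eq[symmetric])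

lemma linear_op_pmul_left: "linear_op (\<lambda>f. pmul f g)"
  by (auto simp: linear_op_def lookup_pmul fmul_def lookup_add algebra_simps sum.distrib sum_distrib_left
      intro!: poly_mapping_eqI)

lemma linear_op_pmul_right: "linear_op (pmul f)"
  by (auto simp: linear_op_def lookup_pmul fmul_def lookup_add algebra_simps sum.distrib sum_distrib_left
      intro!: poly_mapping_eqI)

lemmas linear_intros = linear_op_pmul_left linear_op_pmul_right linear_op_id linear_op_diff
  linear_op_comp[OF linear_op_pmul_left] linear_op_comp[OF linear_op_pmul_right]

lemma pmul_wd: "pmul (wd (u, p)) (wd (v, q) :: _ \<Rightarrow>\<^sub>0 'k::field) = (if awlast u p = v then wd (u, p @ q) else 0)"
proof (rule poly_mapping_eqI)
  fix x :: "'a \<times> 'b list"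
  obtain u' s where x: "x = (u', s)" by (cases x)
  have "lookup (pmul (wd (u, p)) (wd (v, q) :: _ \<Rightarrow>\<^sub>0 'k)) x = (\<Sum>i\<le>length s. if i = length p then
      (if u' = u \<and> s = p @ q \<and> awlast u p = v then 1 else 0) else 0)"
    unfolding lookup_pmul fmul_def x prod.case
  proof (intro sum.cong refl)
    fix i assume "i \<in> {..length s}"
    then have i: "i \<le> length s" by simp
    show "lookup (wd (u, p)) (u', take i s) * lookup (wd (v, q)) (awlast u' (take i s), drop i s) =
      (if i = length p then (if u' = u \<and> s = p @ q \<and> awlast u p = v then 1 else 0 :: 'k) else 0)"
    proof (cases "i = length p")
      case False
      then have "p \<noteq> take i s" using i by auto
      then show ?thesis using False by (simp add: lookup_wd)
    next
      case len: True
      show ?thesis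
      proof (cases "s = p @ q")
        case True
        then show ?thesis using len by (simp add: lookup_wd)
      next
        case False
        then have "p \<noteq> take i s \<or> q \<noteq> drop i s" using append_take_drop_id[of i s] by auto
        then show ?thesis using False by (auto simp: lookup_wd)
      qed
    qed
  qed
  also have "\<dots> = lookup (if awlast u p = v then wd (u, p @ q) else 0) x"
    unfolding x by (auto simp: lookup_wd)
  finally show "lookup (pmul (wd (u, p)) (wd (v, q) :: _ \<Rightarrow>\<^sub>0 'k)) x = lookup (if awlast u p = v then wd (u, p @ q) else 0) x" .
qed

text \<open>Both sides are trilinear, so the identity is reduced to words one argument at a
  time.\<close>

lemma pmul_assoc: "pmul (pmul f g) h = pmul f (pmul g h)"
proof -
  have 1: "pmul (pmul (wd x) (wd y)) (wd z) = pmul (wd x) (pmul (wd y) (wd z))" for x y z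
    by (cases x; cases y; cases z) (auto simp: pmul_wd awlast_append linear_opD[OF linear_op_pmul_left] linear_opD[OF linear_op_pmul_right])
  have 2: "pmul (pmul (wd x) (wd y)) h = pmul (wd x) (pmul (wd y) h)" for x y
    by (rule linear_op_eqI[of _ "\<lambda>h. pmul (wd x) (pmul (wd y) h)"]) (auto intro!: linear_intros 1)
  have 3: "pmul (pmul (wd x) g) h = pmul (wd x) (pmul g h)" for x
    by (rule linear_op_eqI[of "\<lambda>g. pmul (pmul (wd x) g) h" "\<lambda>g. pmul (wd x) (pmul g h)"]) (auto intro!: linear_intros 2)
  show ?thesis
    by (rule linear_op_eqI[of "\<lambda>f. pmul (pmul f g) h" "\<lambda>f. pmul f (pmul g h)"]) (auto intro!: linear_intros 3)
qed

lemma paths_iff: "(u, p) \<in> paths G \<longleftrightarrow> awalk u p (awlast u p)"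
  unfolding paths_def by auto

lemma paths_append: "(u, p @ q) \<in> paths G \<longleftrightarrow> (u, p) \<in> paths G \<and> (awlast u p, q) \<in> paths G"
  by (simp add: paths_iff awlast_append)

lemma paths_Nil: "(u, []) \<in> paths G \<longleftrightarrow> u \<in> verts G"
  by (simp add: paths_iff awalk_def)

lemma paths_Cons: "(u, b # p) \<in> paths G \<longleftrightarrow> b \<in> arcs G \<and> tail G b = u \<and> (head G b, p) \<in> paths G"
  by (auto simp: paths_iff awalk_def awalk_verts_conv)

definition arr :: "'b \<Rightarrow> ('a \<times> 'b list \<Rightarrow>\<^sub>0 'k::field)" where "arr b = wd (tail G b, [b])"
definition idem :: "'a \<Rightarrow> ('a \<times> 'b list \<Rightarrow>\<^sub>0 'k::field)" where "idem v = wd (v, [])"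

lemma pmul_idem_right: "pmul (wd (u, p)) (idem v) = (if awlast u p = v then wd (u, p) else 0)"
  by (simp add: idem_def pmul_wd)

lemma pmul_idem_left: "pmul (idem v) (wd (u, p)) = (if u = v then wd (u, p) else 0)"
  by (simp add: idem_def pmul_wd)

lemma pmul_arr_right: "pmul (wd (u, p)) (arr b) = (if awlast u p = tail G b then wd (u, p @ [b]) else 0)"
  by (simp add: arr_def pmul_wd)

lemma pmul_arr_left: "pmul (arr b) (wd (u, p)) = (if u = head G b then wd (tail G b, b # p) else 0)"
  by (simp add: arr_def pmul_wd)

text \<open>Right division by an arrow. The guard ensures that, for an arrow b of the quiver,
  stripping a word that is not a path gives 0 or again a word that is not a path.\<close>

definition strip :: "'b \<Rightarrow> ('a \<times> 'b list \<Rightarrow>\<^sub>0 'k::field) \<Rightarrow> ('a \<times> 'b list \<Rightarrow>\<^sub>0 'k)" where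
  "strip b f = Abs_poly_mapping (\<lambda>(u, p). if awlast u p = tail G b then lookup f (u, p @ [b]) else 0)"

lemma lookup_strip: "lookup (strip b f) = (\<lambda>(u, p). if awlast u p = tail G b then lookup f (u, p @ [b]) else 0)"
  unfolding strip_def
proof (rule lookup_Abs_poly_mapping, rule finite_subset)
  show "{x. (case x of (u, p) \<Rightarrow> if awlast u p = tail G b then lookup f (u, p @ [b]) else 0) \<noteq> 0}
    \<subseteq> (\<lambda>(u, p). (u, butlast p)) ` keys f"
    by (force simp: in_keys_iff split: if_splits)
qed simp

lemma linear_op_strip: "linear_op (strip b)"
  by (auto simp: linear_op_def lookup_strip lookup_add intro!: poly_mapping_eqI)

lemma strip_wd_Nil: "strip b (wd (u, [])) = 0"
  by (auto simp: lookup_strip lookup_wd intro!: poly_mapping_eqI)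

lemma strip_wd_snoc: "strip b (wd (u, p @ [c])) = (if b = c \<and> awlast u p = tail G b then wd (u, p) else 0)"
  by (auto simp: lookup_strip lookup_wd intro!: poly_mapping_eqI)

text \<open>Left multiplication only lengthens words at the front, so the last letter of a nonempty
  right factor can be stripped first.\<close>

lemma strip_mul_word:
  "strip b (pmul f (wd (v, q @ [c]))) = (if b = c \<and> awlast v q = tail G b then pmul f (wd (v, q)) else 0)"
proof (rule linear_op_eqI[of "\<lambda>f. strip b (pmul f (wd (v, q @ [c])))"])
  show "linear_op (\<lambda>f. if b = c \<and> awlast v q = tail G b then pmul f (wd (v, q)) else 0)"
    using linear_op_pmul_left by (auto simp: linear_op_def)
  fix x :: "'a \<times> 'b list"
  obtain u p where x: "x = (u, p)" by (cases x)
  show "strip b (pmul (wd x) (wd (v, q @ [c]))) = (if b = c \<and> awlast v q = tail G b then pmul (wd x) (wd (v, q)) else 0)"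
    unfolding x pmul_wd using strip_wd_snoc[of b u "p @ q" c]
    by (auto simp: linear_opD[OF linear_op_strip] awlast_append)
qed (intro linear_op_comp[OF linear_op_strip] linear_intros)

lemma strip_mul_arr: "strip b (pmul f (arr c)) = (if b = c then pmul f (idem (tail G b)) else 0)"
  using strip_mul_word[of b f "tail G c" "[]" c] by (auto simp: arr_def idem_def)

section \<open>Grading by path length\<close>

definition trunc :: "nat \<Rightarrow> ('a \<times> 'b list \<Rightarrow>\<^sub>0 'k::field) \<Rightarrow> ('a \<times> 'b list \<Rightarrow>\<^sub>0 'k)" where
  "trunc n f = Abs_poly_mapping (\<lambda>x. if length (snd x) < n then lookup f x else 0)"

lemma lookup_trunc: "lookup (trunc n f) = (\<lambda>x. if length (snd x) < n then lookup f x else 0)"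
  unfolding trunc_def by (rule lookup_Abs_poly_mapping, rule finite_subset[of _ "keys f"]) (auto simp: in_keys_iff)

lemma linear_op_trunc: "linear_op (trunc n)"
  by (auto simp: linear_op_def lookup_trunc lookup_add intro!: poly_mapping_eqI)

definition homogeneous :: "nat \<Rightarrow> ('a \<times> 'b list \<Rightarrow>\<^sub>0 'k::field) \<Rightarrow> bool" where
  "homogeneous n f \<longleftrightarrow> (\<forall>x\<in>keys f. length (snd x) = n)"

lemma trunc_homogeneous: "homogeneous m f \<Longrightarrow> trunc n f = (if m < n then f else 0)"
proof (rule poly_mapping_eqI)
  fix x assume f: "homogeneous m f"
  have "lookup f x = 0" if "length (snd x) \<noteq> m"
    using f that unfolding homogeneous_def by (meson in_keys_iff)
  then show "lookup (trunc n f) x = lookup (if m < n then f else 0) x" by (auto simp: lookup_trunc)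
qed

lemma homogeneous_wd: "homogeneous (length (snd x)) (wd x)"
  by (simp add: homogeneous_def)

lemma homogeneous_pmul: "homogeneous m f \<Longrightarrow> homogeneous n g \<Longrightarrow> homogeneous (m + n) (pmul f g)"
  unfolding homogeneous_def
proof
  fix x assume f: "\<forall>x\<in>keys f. length (snd x) = m" and g: "\<forall>x\<in>keys g. length (snd x) = n"
    and x: "x \<in> keys (pmul f g)"
  obtain u p where x': "x = (u, p)" by (cases x)
  with x have "(\<Sum>i\<le>length p. lookup f (u, take i p) * lookup g (awlast u (take i p), drop i p)) \<noteq> 0"
    by (simp add: in_keys_iff lookup_pmul fmul_def)
  then obtain i where "lookup f (u, take i p) * lookup g (awlast u (take i p), drop i p) \<noteq> 0"
    by (rule sum.not_neutral_contains_not_neutral)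
  then have "(u, take i p) \<in> keys f" "(awlast u (take i p), drop i p) \<in> keys g" by (auto simp: in_keys_iff)
  then have "length (take i p) = m" "length (drop i p) = n" using f g by force+
  then show "length (snd x) = m + n" using x' by (metis append_take_drop_id length_append snd_conv)
qed

lemma homogeneous_smul: "homogeneous n f \<Longrightarrow> homogeneous n (smul c f)"
  by (auto simp: homogeneous_def in_keys_iff)

lemma homogeneous_sum: "(\<And>a. a \<in> A \<Longrightarrow> homogeneous n (f a)) \<Longrightarrow> homogeneous n (sum f A)"
  unfolding homogeneous_def
proof
  fix x assume f: "\<And>a. a \<in> A \<Longrightarrow> \<forall>x\<in>keys (f a). length (snd x) = n" and x: "x \<in> keys (sum f A)"
  then have "(\<Sum>a\<in>A. lookup (f a) x) \<noteq> 0" by (simp add: in_keys_iff lookup_sum)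
  then obtain a where "a \<in> A" "lookup (f a) x \<noteq> 0" by (rule sum.not_neutral_contains_not_neutral)
  then show "length (snd x) = n" using f[of a] by (simp add: in_keys_iff)
qed

end


section \<open>Preprojective relations\<close>

locale reversible_quiver = wf_digraph G for G :: "('v, 'b) pre_digraph" +
  fixes rv :: "'b \<Rightarrow> 'b" and \<tau> :: "'b \<Rightarrow> 'k::field"
  assumes finite_verts: "finite (verts G)" and finite_arcs: "finite (arcs G)"
    and rv_in_arcs: "b \<in> arcs G \<Longrightarrow> rv b \<in> arcs G"
    and tail_rv: "b \<in> arcs G \<Longrightarrow> tail G (rv b) = head G b"
    and head_rv: "b \<in> arcs G \<Longrightarrow> head G (rv b) = tail G b"
    and rv_rv: "b \<in> arcs G \<Longrightarrow> rv (rv b) = b"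
    and no_loop: "b \<in> arcs G \<Longrightarrow> tail G b \<noteq> head G b"
    and no_multiple: "b \<in> arcs G \<Longrightarrow> c \<in> arcs G \<Longrightarrow> tail G b = tail G c \<Longrightarrow> head G b = head G c \<Longrightarrow> b = c"
    and tau_nz: "b \<in> arcs G \<Longrightarrow> \<tau> b \<noteq> 0"
begin

definition rel :: "'v \<Rightarrow> ('v \<times> 'b list \<Rightarrow>\<^sub>0 'k)" where
  "rel i = (\<Sum>b | b \<in> arcs G \<and> head G b = i. smul (\<tau> b) (pmul (arr (rv b)) (arr b)))"

text \<open>Word factors on both sides of the relations make the span an ideal. Non-paths are
  included because the ambient type allows all words.\<close>

definition gens :: "('v \<times> 'b list \<Rightarrow>\<^sub>0 'k) set" where
  "gens = {pmul (pmul (wd x) (rel i)) (wd y) | x i y. i \<in> verts G} \<union> {wd x | x. x \<notin> paths G}"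

definition Jp :: "('v \<times> 'b list \<Rightarrow>\<^sub>0 'k) set" where "Jp = pm.span gens"

definition Dp :: "nat \<Rightarrow> ('v \<times> 'b list \<Rightarrow>\<^sub>0 'k) set" where
  "Dp n = pm.span (Jp \<union> {wd x | x. n \<le> length (snd x)})"

lemma subspace_Jp: "pm.subspace Jp" unfolding Jp_def by (rule pm.subspace_span)

lemma subspace_Dp: "pm.subspace (Dp n)" unfolding Dp_def by (rule pm.subspace_span)

lemma nonpath_in_Jp: "x \<notin> paths G \<Longrightarrow> wd x \<in> Jp"
  unfolding Jp_def gens_def by (rule pm.span_base) blast

lemma rel_in_Jp: "i \<in> verts G \<Longrightarrow> pmul (pmul (wd x) (rel i)) (wd y) \<in> Jp"
  unfolding Jp_def gens_def by (rule pm.span_base) blast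

lemma zero_in_Jp: "0 \<in> Jp" by (rule pm.subspace_0[OF subspace_Jp])

lemma gens_cases:
  assumes "g \<in> gens"
  obtains (rel) x i y where "i \<in> verts G" "g = pmul (pmul (wd x) (rel i)) (wd y)"
    | (nonpath) x where "x \<notin> paths G" "g = wd x"
  using assms unfolding gens_def by blast

lemma pmul_zero: "pmul 0 f = 0" "pmul f 0 = 0"
  by (rule linear_opD(3)[OF linear_op_pmul_left], rule linear_opD(3)[OF linear_op_pmul_right])

lemma Jp_wd_left: "f \<in> Jp \<Longrightarrow> pmul (wd z) f \<in> Jp"
  unfolding Jp_def
proof (rule linear_op_span[OF linear_op_pmul_right subspace_Jp[unfolded Jp_def]])
  fix g assume "g \<in> gens"
  then show "pmul (wd z) g \<in> pm.span gens"
  proof (cases rule: gens_cases)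
    case (rel x i y)
    have "pmul (pmul (pmul (wd z) (wd x)) (rel i)) (wd y) \<in> Jp"
      using rel_in_Jp[OF rel(1)] by (cases z; cases x) (auto simp: pmul_wd pmul_zero zero_in_Jp)
    then show ?thesis using rel by (simp add: pmul_assoc Jp_def)
  next
    case (nonpath x)
    have "pmul (wd z) (wd x) \<in> Jp"
    proof (cases z, cases x)
      fix u p v q assume zx: "z = (u, p)" "x = (v, q)"
      then show ?thesis using nonpath nonpath_in_Jp[of "(u, p @ q)"] by (auto simp: pmul_wd zero_in_Jp paths_append)
    qed
    then show ?thesis using nonpath by (simp add: Jp_def)
  qed
qed

lemma Jp_wd_right: "f \<in> Jp \<Longrightarrow> pmul f (wd z) \<in> Jp"
  unfolding Jp_def
proof (rule linear_op_span[OF linear_op_pmul_left subspace_Jp[unfolded Jp_def]])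
  fix g assume "g \<in> gens"
  then show "pmul g (wd z) \<in> pm.span gens"
  proof (cases rule: gens_cases)
    case (rel x i y)
    have "pmul (pmul (wd x) (rel i)) (pmul (wd y) (wd z)) \<in> Jp"
      using rel_in_Jp[OF rel(1)] by (cases y; cases z) (auto simp: pmul_wd pmul_zero zero_in_Jp)
    then show ?thesis using rel by (simp add: pmul_assoc Jp_def)
  next
    case (nonpath x)
    have "pmul (wd x) (wd z) \<in> Jp"
    proof (cases z, cases x)
      fix u p v q assume zx: "z = (u, p)" "x = (v, q)"
      then show ?thesis using nonpath nonpath_in_Jp[of "(v, q @ p)"] by (auto simp: pmul_wd zero_in_Jp paths_append)
    qed
    then show ?thesis using nonpath by (simp add: Jp_def)
  qed
qed

lemma Jp_left: "f \<in> Jp \<Longrightarrow> pmul g f \<in> Jp"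
  by (rule linear_op_memI[OF linear_op_pmul_left subspace_Jp Jp_wd_left])

lemma Jp_right: "f \<in> Jp \<Longrightarrow> pmul f g \<in> Jp"
  by (rule linear_op_memI[OF linear_op_pmul_right subspace_Jp Jp_wd_right])

sublocale A: algebra_mod smul pmul Jp
proof
  show "pmul (f + g) h = pmul f h + pmul g h" "pmul f (g + h) = pmul f g + pmul f h"
    "pmul (smul c f) g = smul c (pmul f g)" "pmul f (smul c g) = smul c (pmul f g)" for f g h c
    by (rule linear_opD[OF linear_op_pmul_left] linear_opD[OF linear_op_pmul_right])+
qed (fact pmul_assoc subspace_Jp Jp_left Jp_right)+

lemma Jp_subset_Dp: "Jp \<subseteq> Dp n" unfolding Dp_def using pm.span_superset by blast

lemma wd_in_Dp: "n \<le> length (snd x) \<Longrightarrow> wd x \<in> Dp n"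
  unfolding Dp_def by (rule pm.span_base) blast

lemma Dp_mult: "f \<in> Dp m \<Longrightarrow> g \<in> Dp n \<Longrightarrow> pmul f g \<in> Dp (m + n)"
proof -
  assume f: "f \<in> Dp m" and g: "g \<in> Dp n"
  have 1: "pmul (wd x) (wd y) \<in> Dp (m + n)" if "m \<le> length (snd x)" "n \<le> length (snd y)" for x y
    using that by (cases x; cases y) (auto simp: pmul_wd pm.subspace_0[OF subspace_Dp] intro!: wd_in_Dp)
  have 2: "pmul (wd x) g \<in> Dp (m + n)" if x: "m \<le> length (snd x)" for x
    by (rule linear_op_span[OF linear_op_pmul_right subspace_Dp _ g[unfolded Dp_def]])
       (use 1[OF x] Jp_left Jp_subset_Dp in blast)
  show "pmul f g \<in> Dp (m + n)"
    by (rule linear_op_span[OF linear_op_pmul_left subspace_Dp _ f[unfolded Dp_def]])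
       (use 2 Jp_right Jp_subset_Dp in blast)
qed

lemma path_snocD: "(u, p @ [b]) \<in> paths G \<Longrightarrow> b \<in> arcs G \<and> tail G b = awlast u p \<and> (u, p) \<in> paths G"
  by (auto simp: paths_append paths_Cons)

lemma last_vertex: "(u, p) \<in> paths G \<Longrightarrow> awlast u p \<in> verts G"
  using paths_append[of u p "[]"] by (simp add: paths_Nil)

lemma first_vertex: "(u, p) \<in> paths G \<Longrightarrow> u \<in> verts G"
  using paths_append[of u "[]" p] by (simp add: paths_Nil)

lemma Dp_0: "Dp 0 = UNIV"
proof -
  have "f \<in> Dp 0" for f
    by (rule linear_op_memI[OF linear_op_id subspace_Dp]) (simp add: wd_in_Dp)
  then show ?thesis by auto
qed

lemma wd_mult_unit: "pmul (wd (u, p)) (\<Sum>v\<in>verts G. idem v) = (if awlast u p \<in> verts G then wd (u, p) else 0 :: _ \<Rightarrow>\<^sub>0 'k)"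
  using finite_verts by (simp add: linear_opD(4)[OF linear_op_pmul_right] pmul_idem_right)

lemma unit_mult_wd: "pmul (\<Sum>v\<in>verts G. idem v) (wd (u, p)) = (if u \<in> verts G then wd (u, p) else 0 :: _ \<Rightarrow>\<^sub>0 'k)"
  using finite_verts by (simp add: linear_opD(4)[OF linear_op_pmul_left] pmul_idem_left)

text \<open>Stated for any subspace containing the non-paths, as it serves both the path algebra and
  the preprojective algebra.\<close>

lemma right_unit:
  assumes S: "pm.subspace S" "\<And>x. x \<notin> paths G \<Longrightarrow> wd x \<in> S"
  shows "pmul f (\<Sum>v\<in>verts G. idem v) - f \<in> (S :: ('v \<times> 'b list \<Rightarrow>\<^sub>0 'k) set)"
proof (rule linear_op_memI[of "\<lambda>f. pmul f (\<Sum>v\<in>verts G. idem v) - f", OF _ S(1)])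
  show "linear_op (\<lambda>f. pmul f (\<Sum>v\<in>verts G. idem v) - f)" by (intro linear_intros)
  fix x :: "'v \<times> 'b list"
  obtain u p where x: "x = (u, p)" by (cases x)
  show "pmul (wd x) (\<Sum>v\<in>verts G. idem v) - wd x \<in> S"
    using S(2)[of x] last_vertex[of u p] pm.subspace_neg[OF S(1)] pm.subspace_0[OF S(1)] x by (auto simp: wd_mult_unit)
qed

lemma left_unit:
  assumes S: "pm.subspace S" "\<And>x. x \<notin> paths G \<Longrightarrow> wd x \<in> S"
  shows "pmul (\<Sum>v\<in>verts G. idem v) f - f \<in> (S :: ('v \<times> 'b list \<Rightarrow>\<^sub>0 'k) set)"
proof (rule linear_op_memI[of "\<lambda>f. pmul (\<Sum>v\<in>verts G. idem v) f - f", OF _ S(1)])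
  show "linear_op (\<lambda>f. pmul (\<Sum>v\<in>verts G. idem v) f - f)" by (intro linear_intros)
  fix x :: "'v \<times> 'b list"
  obtain u p where x: "x = (u, p)" by (cases x)
  show "pmul (\<Sum>v\<in>verts G. idem v) (wd x) - wd x \<in> S"
    using S(2)[of x] first_vertex[of u p] pm.subspace_neg[OF S(1)] pm.subspace_0[OF S(1)] x by (auto simp: unit_mult_wd)
qed

lemma right_unit_Jp: "pmul f (\<Sum>v\<in>verts G. idem v) - f \<in> Jp"
  by (rule right_unit[OF subspace_Jp nonpath_in_Jp])

lemma left_unit_Jp: "pmul (\<Sum>v\<in>verts G. idem v) f - f \<in> Jp"
  by (rule left_unit[OF subspace_Jp nonpath_in_Jp])

lemma Dp_right: "f \<in> Dp (Suc n) \<Longrightarrow> \<exists>y. (\<forall>b. y b \<in> Dp n) \<and> f - (\<Sum>b\<in>arcs G. pmul (y b) (arr b)) \<in> Jp"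
proof -
  let ?S = "{f. \<exists>y. (\<forall>b. y b \<in> Dp n) \<and> f - (\<Sum>b\<in>arcs G. pmul (y b) (arr b)) \<in> Jp}"
  note lin = linear_opD[OF linear_op_pmul_left]
  assume f: "f \<in> Dp (Suc n)"
  have J: "g \<in> ?S" if "g \<in> Jp" for g
    using that by (auto intro!: exI[of _ "\<lambda>_. 0"] simp: pmul_zero pm.subspace_0[OF subspace_Dp])
  have sub: "pm.subspace ?S"
    by (rule A.subspace_combinations[OF subspace_Dp subspace_Jp, of "\<lambda>b y. pmul y (arr b)"]) (simp_all add: lin)
  have "wd x \<in> ?S" if x: "Suc n \<le> length (snd x)" for x
  proof (cases "x \<in> paths G")
    case False
    then show ?thesis using J nonpath_in_Jp by blast
  next
    case True
    obtain u q where "x = (u, q)" by (cases x)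
    moreover from this x obtain p b where "q = p @ [b]" by (cases q rule: rev_cases) auto
    ultimately have x': "x = (u, p @ [b])" by simp
    with True have b: "b \<in> arcs G" "tail G b = awlast u p" using path_snocD by auto
    have "(\<Sum>c\<in>arcs G. pmul (if c = b then wd (u, p) else 0) (arr c)) = (\<Sum>c\<in>arcs G. if c = b then wd x else 0 :: _ \<Rightarrow>\<^sub>0 'k)"
      using b x' by (intro sum.cong) (auto simp: pmul_arr_right pmul_zero)
    also have "\<dots> = wd x" using finite_arcs b(1) by simp
    finally have "wd x - (\<Sum>c\<in>arcs G. pmul (if c = b then wd (u, p) else 0) (arr c)) \<in> Jp" by (simp add: zero_in_Jp)
    moreover have "wd (u, p) \<in> Dp n" using x x' by (intro wd_in_Dp) auto
    ultimately show ?thesis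
      by (intro CollectI exI[of _ "\<lambda>c. if c = b then wd (u, p) else 0"]) (auto simp: pm.subspace_0[OF subspace_Dp])
  qed
  then have "g \<in> ?S" if "g \<in> Jp \<union> {wd x |x. Suc n \<le> length (snd x)}" for g
    using that J by blast
  then have "pm.span (Jp \<union> {wd x |x. Suc n \<le> length (snd x)}) \<subseteq> ?S"
    by (intro pm.span_minimal sub) blast
  then have "f \<in> ?S" using f unfolding Dp_def by blast
  then show ?thesis by simp
qed

lemma Dp_left: "f \<in> Dp 1 \<Longrightarrow> \<exists>y. f - (\<Sum>b\<in>arcs G. pmul (arr b) (y b)) \<in> Jp"
proof -
  let ?S = "{f. \<exists>y. f - (\<Sum>b\<in>arcs G. pmul (arr b) (y b)) \<in> Jp}"
  note lin = linear_opD[OF linear_op_pmul_right]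
  assume f: "f \<in> Dp 1"
  have J: "g \<in> ?S" if "g \<in> Jp" for g
    using that by (auto intro!: exI[of _ "\<lambda>_. 0"] simp: pmul_zero)
  have sub: "pm.subspace ?S"
    using A.subspace_combinations[OF pm.subspace_UNIV subspace_Jp, of "\<lambda>b. pmul (arr b)"] by (simp add: lin)
  have "wd x \<in> ?S" if x: "1 \<le> length (snd x)" for x
  proof (cases "x \<in> paths G")
    case False
    then show ?thesis using J nonpath_in_Jp by blast
  next
    case True
    obtain u q where "x = (u, q)" by (cases x)
    moreover from this x obtain p b where "q = b # p" by (cases q) auto
    ultimately have x': "x = (u, b # p)" by simp
    with True have b: "b \<in> arcs G" "tail G b = u" by (auto simp: paths_Cons)
    have "(\<Sum>c\<in>arcs G. pmul (arr c) (if c = b then wd (head G b, p) else 0)) = (\<Sum>c\<in>arcs G. if c = b then wd x else 0 :: _ \<Rightarrow>\<^sub>0 'k)"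
      using b x' by (intro sum.cong) (auto simp: pmul_arr_left pmul_zero)
    also have "\<dots> = wd x" using finite_arcs b(1) by simp
    finally have "wd x - (\<Sum>c\<in>arcs G. pmul (arr c) (if c = b then wd (head G b, p) else 0)) \<in> Jp" by (simp add: zero_in_Jp)
    then show ?thesis by (intro CollectI exI[of _ "\<lambda>c. if c = b then wd (head G b, p) else 0"])
  qed
  then have "g \<in> ?S" if "g \<in> Jp \<union> {wd x |x. 1 \<le> length (snd x)}" for g
    using that J by blast
  then have "pm.span (Jp \<union> {wd x |x. 1 \<le> length (snd x)}) \<subseteq> ?S"
    by (intro pm.span_minimal sub) blast
  then have "f \<in> ?S" using f unfolding Dp_def by blast
  then show ?thesis by simp
qed

lemma Dp_0_split: "\<exists>c. f - (\<Sum>v\<in>verts G. smul (c v) (idem v)) \<in> Dp 1"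
proof -
  let ?S = "{f. \<exists>c. f - (\<Sum>v\<in>verts G. smul (c v) (idem v)) \<in> Dp 1}"
  have D: "g \<in> ?S" if "g \<in> Dp 1" for g using that by (auto intro!: exI[of _ "\<lambda>_. 0"])
  have sub: "pm.subspace ?S"
  proof (rule pm.subspaceI)
    show "0 \<in> ?S" by (rule D[OF pm.subspace_0[OF subspace_Dp]])
  next
    fix g h assume "g \<in> ?S" "h \<in> ?S"
    then obtain c d where c: "g - (\<Sum>v\<in>verts G. smul (c v) (idem v)) \<in> Dp 1"
      and d: "h - (\<Sum>v\<in>verts G. smul (d v) (idem v)) \<in> Dp 1" by blast
    have "(g + h) - (\<Sum>v\<in>verts G. smul (c v + d v) (idem v)) \<in> Dp 1"
      using pm.subspace_add[OF subspace_Dp c d] by (simp add: pm.scale_left_distrib sum.distrib algebra_simps)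
    then show "g + h \<in> ?S" by (intro CollectI exI[of _ "\<lambda>v. c v + d v"])
  next
    fix a g assume "g \<in> ?S"
    then obtain c where c: "g - (\<Sum>v\<in>verts G. smul (c v) (idem v)) \<in> Dp 1" by blast
    have "smul a g - (\<Sum>v\<in>verts G. smul (a * c v) (idem v)) \<in> Dp 1"
      using pm.subspace_scale[OF subspace_Dp c, of a] by (simp add: pm.scale_right_diff_distrib pm.scale_sum_right)
    then show "smul a g \<in> ?S" by (intro CollectI exI[of _ "\<lambda>v. a * c v"])
  qed
  have "wd x \<in> ?S" for x
  proof (cases "x \<in> paths G \<and> snd x = []")
    case False
    then have "x \<notin> paths G \<or> 1 \<le> length (snd x)" by (cases "snd x") auto
    then have "wd x \<in> Dp 1" using nonpath_in_Jp Jp_subset_Dp wd_in_Dp by blast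
    then show ?thesis by (rule D)
  next
    case True
    then obtain u where x: "x = (u, [])" "u \<in> verts G" by (cases x) (auto simp: paths_Nil)
    have "(\<Sum>v\<in>verts G. smul (if v = u then 1 else 0) (idem v)) = (\<Sum>v\<in>verts G. if v = u then idem v else 0 :: _ \<Rightarrow>\<^sub>0 'k)"
      by (intro sum.cong) auto
    also have "\<dots> = wd x" using finite_verts x by (simp add: idem_def)
    finally show ?thesis by (intro CollectI exI[of _ "\<lambda>v. if v = u then 1 else 0"]) (simp add: pm.subspace_0[OF subspace_Dp])
  qed
  then have "(\<lambda>f. f) f \<in> ?S" using linear_op_memI[OF linear_op_id sub] by blast
  then show ?thesis by simp
qed

lemma homogeneous_rel: "homogeneous 2 (rel i)"
proof -
  have "homogeneous 1 (arr b)" for b using homogeneous_wd[of "(tail G b, [b])"] by (simp add: arr_def)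
  then have "homogeneous (1 + 1) (pmul (arr c) (arr b))" for b c by (intro homogeneous_pmul)
  then show ?thesis unfolding rel_def one_add_one by (intro homogeneous_sum homogeneous_smul)
qed

text \<open>The relations are homogeneous of degree 2, so each generator is homogeneous and
  truncation either fixes or kills it.\<close>

lemma trunc_Jp: "f \<in> Jp \<Longrightarrow> trunc n f \<in> Jp"
  unfolding Jp_def
proof (rule linear_op_span[OF linear_op_trunc pm.subspace_span])
  fix g assume g: "g \<in> gens"
  then obtain m where "homogeneous m g"
  proof (cases rule: gens_cases)
    case (rel x i y)
    then show ?thesis using that homogeneous_pmul[OF homogeneous_pmul[OF homogeneous_wd homogeneous_rel] homogeneous_wd] by blast
  next
    case (nonpath x)
    then show ?thesis using that homogeneous_wd by blast
  qed
  then show "trunc n g \<in> pm.span gens"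
    using g by (simp add: trunc_homogeneous pm.span_zero pm.span_base)
qed

lemma Dp_Inter: "(\<And>n. f \<in> Dp n) \<Longrightarrow> f \<in> Jp"
proof -
  assume f: "\<And>n. f \<in> Dp n"
  \<comment> \<open>Exceeds the length of every word in f, so truncation at n fixes f but maps
    \<open>Dp n\<close> into \<open>Jp\<close>.\<close>
  define n where "n = Suc (\<Sum>x\<in>keys f. length (snd x))"
  have "length (snd x) < n" if "x \<in> keys f" for x
    using member_le_sum[OF that, of "\<lambda>x. length (snd x)"] by (simp add: n_def)
  then have "trunc n f = f" by (intro poly_mapping_eqI) (auto simp: lookup_trunc in_keys_iff)
  moreover have "trunc n f \<in> Jp"
  proof (rule linear_op_span[OF linear_op_trunc subspace_Jp _ f[of n, unfolded Dp_def]])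
    fix g assume "g \<in> Jp \<union> {wd x |x. n \<le> length (snd x)}"
    then show "trunc n g \<in> Jp"
    proof
      assume "g \<in> {wd x |x. n \<le> length (snd x)}"
      then obtain x where x: "g = wd x" "n \<le> length (snd x)" by blast
      then have "homogeneous (length (snd x)) g" using homogeneous_wd by blast
      from trunc_homogeneous[OF this, of n] x(2) show ?thesis by (simp add: zero_in_Jp)
    qed (rule trunc_Jp)
  qed
  ultimately show "f \<in> Jp" by simp
qed

section \<open>Exactness of the mesh complex\<close>

lemma rel_idem: "pmul (rel i) (wd (v, [])) = (if v = i then rel i else 0)"
proof -
  have "pmul (smul c (pmul f (arr b))) (wd (v, [])) = (if head G b = v then smul c (pmul f (arr b)) else 0)" for c :: 'k and f b
  proof -
    have "pmul (arr b) (wd (v, [])) = (if head G b = v then arr b else 0 :: _ \<Rightarrow>\<^sub>0 'k)"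
      by (simp add: arr_def pmul_wd)
    then show ?thesis by (simp add: linear_opD[OF linear_op_pmul_left] pmul_assoc pmul_zero)
  qed
  then show ?thesis unfolding rel_def linear_opD(4)[OF linear_op_pmul_left] by (auto intro!: sum.neutral sum.cong)
qed

lemma idem_rel: "pmul (wd (v, [])) (rel i) = (if v = i then rel i else 0)"
proof -
  have "pmul (wd (v, [])) (smul c (pmul (arr (rv b)) f)) = (if head G b = v then smul c (pmul (arr (rv b)) f) else 0)"
    if "b \<in> arcs G" for c :: 'k and f b
  proof -
    have "pmul (wd (v, [])) (arr (rv b)) = (if head G b = v then arr (rv b) else 0 :: _ \<Rightarrow>\<^sub>0 'k)"
      using tail_rv[OF that] by (simp add: arr_def pmul_wd)
    then show ?thesis by (simp add: linear_opD[OF linear_op_pmul_right] pmul_assoc[symmetric] pmul_zero)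
  qed
  then show ?thesis unfolding rel_def linear_opD(4)[OF linear_op_pmul_right] by (auto intro!: sum.neutral sum.cong)
qed

lemma rel_mem: "i \<in> verts G \<Longrightarrow> rel i \<in> Jp"
  using rel_in_Jp[of i "(i, [])" "(i, [])"] by (simp add: idem_rel rel_idem)

lemma strip_rel:
  assumes "b \<in> arcs G"
  shows "strip b (pmul f (rel i)) = (if head G b = i then smul (\<tau> b) (pmul f (arr (rv b))) else 0)"
proof -
  have "pmul (arr (rv b)) (idem (tail G b)) = (arr (rv b) :: _ \<Rightarrow>\<^sub>0 'k)"
    using pmul_idem_right[of "tail G (rv b)" "[rv b]" "tail G b"] head_rv[OF assms] by (simp add: arr_def awalk_verts_conv)
  then have ri: "pmul (pmul f (arr (rv b))) (idem (tail G b)) = pmul f (arr (rv b))"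
    by (simp add: pmul_assoc)
  have "strip b (pmul f (rel i)) = (\<Sum>c | c \<in> arcs G \<and> head G c = i. smul (\<tau> c) (strip b (pmul (pmul f (arr (rv c))) (arr c))))"
    unfolding rel_def
    by (simp add: linear_opD[OF linear_op_pmul_right] linear_opD[OF linear_op_strip] pmul_assoc)
  also have "\<dots> = (\<Sum>c | c \<in> arcs G \<and> head G c = i. if c = b then smul (\<tau> b) (pmul f (arr (rv b))) else 0)"
    by (intro sum.cong) (auto simp: strip_mul_arr ri)
  also have "\<dots> = (if head G b = i then smul (\<tau> b) (pmul f (arr (rv b))) else 0)"
    using finite_arcs assms by (simp add: sum.delta)
  finally show ?thesis .
qed

text \<open>For g in \<open>Jp\<close>, stripping b gives \<open>\<tau> b\<close> times x followed
  by \<open>rv b\<close> modulo \<open>Jp\<close>, with one x for all b into i: this is linear in g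
  and checked on generators. Applied to the given sum it is the claim, since stripping b returns z b
  cut down to the tail of b.\<close>

lemma exact_Jp:
  assumes i: "i \<in> verts G" and z: "(\<Sum>b | b \<in> arcs G \<and> head G b = i. pmul (z b) (arr b)) \<in> Jp"
  shows "\<exists>x. \<forall>b. b \<in> arcs G \<and> head G b = i \<longrightarrow> pmul (z b) (idem (tail G b)) - smul (\<tau> b) (pmul x (arr (rv b))) \<in> Jp"
proof -
  let ?S = "{g. \<exists>x. \<forall>b. b \<in> arcs G \<and> head G b = i \<longrightarrow> strip b g - smul (\<tau> b) (pmul x (arr (rv b))) \<in> Jp}"
  note lin = linear_opD[OF linear_op_pmul_left] linear_opD[OF linear_op_strip]
  have J: "g \<in> ?S" if "\<And>b. b \<in> arcs G \<Longrightarrow> strip b g \<in> Jp" for g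
    using that by (auto intro!: exI[of _ 0] simp: pmul_zero)
  have sub: "pm.subspace ?S"
  proof (rule pm.subspaceI)
    show "0 \<in> ?S" by (rule J) (simp add: lin zero_in_Jp)
  next
    fix g h assume "g \<in> ?S" "h \<in> ?S"
    then obtain x y where x: "\<And>b. b \<in> arcs G \<Longrightarrow> head G b = i \<Longrightarrow> strip b g - smul (\<tau> b) (pmul x (arr (rv b))) \<in> Jp"
      and y: "\<And>b. b \<in> arcs G \<Longrightarrow> head G b = i \<Longrightarrow> strip b h - smul (\<tau> b) (pmul y (arr (rv b))) \<in> Jp" by blast
    have "strip b (g + h) - smul (\<tau> b) (pmul (x + y) (arr (rv b))) \<in> Jp" if b: "b \<in> arcs G" "head G b = i" for b
      using pm.subspace_add[OF subspace_Jp x[OF b] y[OF b]] by (simp add: lin pm.scale_right_distrib algebra_simps)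
    then show "g + h \<in> ?S" by blast
  next
    fix c g assume "g \<in> ?S"
    then obtain x where x: "\<And>b. b \<in> arcs G \<Longrightarrow> head G b = i \<Longrightarrow> strip b g - smul (\<tau> b) (pmul x (arr (rv b))) \<in> Jp" by blast
    have "strip b (smul c g) - smul (\<tau> b) (pmul (smul c x) (arr (rv b))) \<in> Jp" if b: "b \<in> arcs G" "head G b = i" for b
      using pm.subspace_scale[OF subspace_Jp x[OF b], of c] by (simp add: lin pm.scale_right_diff_distrib mult.commute)
    then show "smul c g \<in> ?S" by blast
  qed
  have "g \<in> ?S" if "g \<in> gens" for g
    using that
  proof (cases rule: gens_cases)
    case (nonpath x)
    show ?thesis
    proof (rule J)
      fix b assume b: "b \<in> arcs G"
      obtain u p where x: "x = (u, p)" by (cases x)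
      show "strip b g \<in> Jp"
      proof (cases p rule: rev_cases)
        case Nil
        then show ?thesis using nonpath x by (simp add: strip_wd_Nil zero_in_Jp)
      next
        case (snoc q c)
        \<comment> \<open>If q were a path ending at the tail of b, then q followed by b would be a
          path too.\<close>
        have "wd (u, q) \<in> Jp" if "b = c" "awlast u q = tail G b"
          using nonpath x snoc b that by (intro nonpath_in_Jp) (auto simp: paths_append paths_Cons paths_Nil)
        then show ?thesis using nonpath x snoc by (simp add: strip_wd_snoc zero_in_Jp)
      qed
    qed
  next
    case (rel x j y)
    obtain v q where y: "y = (v, q)" by (cases y)
    show ?thesis
    proof (cases q rule: rev_cases)
      case Nil
      then have g: "g = (if v = j then pmul (wd x) (rel j) else 0)"
        using rel y by (simp add: pmul_assoc rel_idem pmul_zero)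
      show ?thesis
      proof (cases "v = j \<and> j = i")
        case True
        \<comment> \<open>The only case with a nonzero witness: nothing follows the relation at i,
          so its own last arrows are stripped.\<close>
        then show ?thesis using g strip_rel by (intro CollectI exI[of _ "wd x"]) (auto simp: zero_in_Jp)
      next
        case False
        then have "strip b g = 0" if "b \<in> arcs G" "head G b = i" for b
          using g strip_rel[OF that(1), of "wd x" j] that(2) by (auto simp: lin)
        then show ?thesis by (intro CollectI exI[of _ 0]) (auto simp: pmul_zero zero_in_Jp)
      qed
    next
      case (snoc p c)
      show ?thesis
      proof (rule J)
        fix b assume "b \<in> arcs G"
        \<comment> \<open>Stripping shortens only the right factor, leaving 0 or another
          generator.\<close>
        show "strip b g \<in> Jp"
          using rel y snoc rel_in_Jp[OF rel(1)] by (simp add: strip_mul_word zero_in_Jp)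
      qed
    qed
  qed
  then have "pm.span gens \<subseteq> ?S" by (intro pm.span_minimal sub) blast
  then have "(\<Sum>b | b \<in> arcs G \<and> head G b = i. pmul (z b) (arr b)) \<in> ?S"
    using z unfolding Jp_def[symmetric] by blast
  then obtain x where x: "\<And>b. b \<in> arcs G \<Longrightarrow> head G b = i \<Longrightarrow>
      strip b (\<Sum>b | b \<in> arcs G \<and> head G b = i. pmul (z b) (arr b)) - smul (\<tau> b) (pmul x (arr (rv b))) \<in> Jp" by blast
  have "strip b (\<Sum>b | b \<in> arcs G \<and> head G b = i. pmul (z b) (arr b)) = pmul (z b) (idem (tail G b))"
    if b: "b \<in> arcs G" "head G b = i" for b
  proof -
    have "strip b (\<Sum>b | b \<in> arcs G \<and> head G b = i. pmul (z b) (arr b))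
        = (\<Sum>c | c \<in> arcs G \<and> head G c = i. if c = b then pmul (z b) (idem (tail G b)) else 0)"
      unfolding linear_opD(4)[OF linear_op_strip] by (intro sum.cong) (auto simp: strip_mul_arr)
    also have "\<dots> = pmul (z b) (idem (tail G b))" using finite_arcs b by (simp add: sum.delta)
    finally show ?thesis .
  qed
  with x show ?thesis by auto
qed

lemma idem_idem: "i \<in> verts G \<Longrightarrow> pmul (idem i) (idem i) = idem i"
  by (simp add: idem_def pmul_wd)

lemma idem_orth: "i \<in> verts G \<Longrightarrow> j \<in> verts G \<Longrightarrow> i \<noteq> j \<Longrightarrow> pmul (idem i) (idem j) = 0"
  by (simp add: idem_def pmul_wd)

lemma idem_tail: "b \<in> arcs G \<Longrightarrow> pmul (idem (tail G b)) (arr b) = arr b"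
  by (simp add: idem_def arr_def pmul_wd)

lemma idem_head: "b \<in> arcs G \<Longrightarrow> pmul (arr b) (idem (head G b)) = arr b"
  by (simp add: idem_def arr_def pmul_wd)

lemma Dp_antimono: "Dp (Suc n) \<subseteq> Dp n"
  unfolding Dp_def by (intro pm.span_mono Un_mono order_refl) (blast dest: Suc_leD)

lemma arr_in_Dp: "b \<in> arcs G \<Longrightarrow> arr b \<in> Dp 1"
  unfolding arr_def by (rule wd_in_Dp) simp

sublocale M: mesh_algebra smul pmul Jp "verts G" "arcs G" "tail G" "head G" rv \<tau> idem arr Dp
proof (unfold_locales, unfold A.eqv_def)
  show "(\<Sum>b | b \<in> arcs G \<and> head G b = i. smul (\<tau> b) (pmul (arr (rv b)) (arr b))) \<in> Jp" if "i \<in> verts G" for i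
    using rel_mem[OF that] by (simp add: rel_def)
qed (fact finite_verts finite_arcs tail_in_verts head_in_verts rv_in_arcs tail_rv head_rv rv_rv no_loop
    no_multiple tau_nz idem_idem idem_orth right_unit_Jp left_unit_Jp idem_tail idem_head Dp_0 subspace_Dp
    Jp_subset_Dp Dp_mult Dp_antimono arr_in_Dp Dp_right Dp_left Dp_0_split Dp_Inter exact_Jp)+

end


section \<open>Presentations of algebras\<close>

text \<open>\<open>\<rho>\<close> presents the algebra \<open>P\<close> as the quotient of \<open>'r\<close> by \<open>J\<close>.\<close>

locale algebra_rep = algebra_mod scale mult J
  for scale :: "'k::field \<Rightarrow> 'r::ab_group_add \<Rightarrow> 'r" (infixr "*s" 75)
    and mult :: "'r \<Rightarrow> 'r \<Rightarrow> 'r" (infixl "\<star>" 70) and J +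
  fixes unit :: 'r and P :: "('k, 'x) module" (structure) and \<rho> :: "'r \<Rightarrow> 'x"
  assumes mult_unit: "x \<star> unit \<approx> x" and unit_mult: "unit \<star> x \<approx> x"
    and carrier_P: "carrier P = range \<rho>"
    and rho_add: "\<rho> (x + y) = \<rho> x \<oplus> \<rho> y"
    and rho_mult: "\<rho> (x \<star> y) = \<rho> x \<otimes> \<rho> y"
    and rho_smult: "\<rho> (c *s x) = c \<odot> \<rho> x"
    and rho_one: "\<rho> unit = \<one>" and rho_zero: "\<rho> 0 = \<zero>"
    and rho_eq: "\<rho> x = \<rho> y \<longleftrightarrow> x \<approx> y"
begin

lemma rho_carrier [simp]: "\<rho> x \<in> carrier P"
  by (simp add: carrier_P)

lemma carrier_cases: "a \<in> carrier P \<Longrightarrow> (\<And>x. a = \<rho> x \<Longrightarrow> thesis) \<Longrightarrow> thesis"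
  by (auto simp: carrier_P)

lemma ring_P: "ring P"
proof (rule ringI)
  show "abelian_group P"
  proof (rule abelian_groupI)
    fix a b c assume abc: "a \<in> carrier P" "b \<in> carrier P" "c \<in> carrier P"
    obtain x where x: "a = \<rho> x" using abc(1) by (rule carrier_cases)
    obtain y where y: "b = \<rho> y" using abc(2) by (rule carrier_cases)
    obtain z where z: "c = \<rho> z" using abc(3) by (rule carrier_cases)
    show "a \<oplus> b \<in> carrier P" "a \<oplus> b = b \<oplus> a"
      "(a \<oplus> b) \<oplus> c = a \<oplus> (b \<oplus> c)"
      unfolding x y z rho_add[symmetric] by (simp_all add: algebra_simps)
  next
    fix a assume "a \<in> carrier P"
    then obtain x where x: "a = \<rho> x" by (rule carrier_cases)
    show "\<zero> \<oplus> a = a" unfolding x rho_zero[symmetric] rho_add[symmetric] by simp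
    show "\<exists>b\<in>carrier P. b \<oplus> a = \<zero>"
      unfolding x rho_zero[symmetric] by (rule bexI[of _ "\<rho> (- x)"]) (simp_all add: rho_add[symmetric])
  qed (simp add: rho_zero[symmetric])
  show "monoid P"
  proof (rule monoidI)
    fix a b c assume abc: "a \<in> carrier P" "b \<in> carrier P" "c \<in> carrier P"
    obtain x where x: "a = \<rho> x" using abc(1) by (rule carrier_cases)
    obtain y where y: "b = \<rho> y" using abc(2) by (rule carrier_cases)
    obtain z where z: "c = \<rho> z" using abc(3) by (rule carrier_cases)
    show "a \<otimes> b \<in> carrier P" "(a \<otimes> b) \<otimes> c = a \<otimes> (b \<otimes> c)"
      unfolding x y z rho_mult[symmetric] by (simp_all add: mult_assoc)
  next
    fix a assume "a \<in> carrier P"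
    then obtain x where x: "a = \<rho> x" by (rule carrier_cases)
    show "\<one> \<otimes> a = a" "a \<otimes> \<one> = a"
      unfolding x rho_one[symmetric] rho_mult[symmetric] rho_eq by (rule unit_mult, rule mult_unit)
  qed (simp add: rho_one[symmetric])
next
  fix a b c assume abc: "a \<in> carrier P" "b \<in> carrier P" "c \<in> carrier P"
  obtain x where x: "a = \<rho> x" using abc(1) by (rule carrier_cases)
  obtain y where y: "b = \<rho> y" using abc(2) by (rule carrier_cases)
  obtain z where z: "c = \<rho> z" using abc(3) by (rule carrier_cases)
  show "(a \<oplus> b) \<otimes> c = a \<otimes> c \<oplus> b \<otimes> c"
    "c \<otimes> (a \<oplus> b) = c \<otimes> a \<oplus> c \<otimes> b"
    unfolding x y z rho_mult[symmetric] rho_add[symmetric] by (simp_all add: mult_add_left mult_add_right)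
qed

sublocale P: ring P by (rule ring_P)

lemma rho_uminus: "\<rho> (- x) = \<ominus> \<rho> x"
  by (rule P.minus_equality[symmetric]) (simp_all add: rho_add[symmetric] rho_zero[symmetric])

lemma rho_diff: "\<rho> (x - y) = \<rho> x \<ominus> \<rho> y"
  using rho_add[of x "- y"] by (simp add: rho_uminus a_minus_def)

lemma rho_sum: "finite S \<Longrightarrow> \<rho> (sum f S) = (\<Oplus>a\<in>S. \<rho> (f a))"
  by (induction S rule: finite_induct) (simp_all add: rho_zero rho_add Pi_def)

lemma rho_mem_iff: "two_sided X \<Longrightarrow> \<rho> x \<in> \<rho> ` X \<longleftrightarrow> x \<in> X"
  using two_sided_eqv by (auto simp: rho_eq)

lemma ideal_image:
  assumes "two_sided X"
  shows "ideal (\<rho> ` X) P"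
proof (rule idealI[OF ring_P])
  note X = two_sidedD[OF assms]
  show "subgroup (\<rho> ` X) (add_monoid P)"
  proof (rule P.add.subgroupI)
    show "\<rho> ` X \<subseteq> carrier P" by auto
    show "\<rho> ` X \<noteq> {}" using subspace_0[OF X(1)] by auto
    show "\<ominus> a \<in> \<rho> ` X" if "a \<in> \<rho> ` X" for a
      using that subspace_neg[OF X(1)] by (auto simp: rho_uminus[symmetric])
    show "a \<oplus> b \<in> \<rho> ` X" if "a \<in> \<rho> ` X" "b \<in> \<rho> ` X" for a b
      using that subspace_add[OF X(1)] by (auto simp: rho_add[symmetric])
  qed
  fix a b assume a: "a \<in> \<rho> ` X" and "b \<in> carrier P"
  then obtain y where "b = \<rho> y" by (auto simp: carrier_P)
  with a X show "b \<otimes> a \<in> \<rho> ` X" "a \<otimes> b \<in> \<rho> ` X"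
    by (auto simp: rho_mult[symmetric])
qed

lemma two_sided_preimage:
  assumes "ideal I P"
  shows "two_sided {x. \<rho> x \<in> I}"
proof -
  interpret I: ideal I P by fact
  have "\<rho> (c *s x) \<in> I" if "\<rho> x \<in> I" for c x
  proof -
    \<comment> \<open>Closure under scalars is not part of being a ring ideal; c x is written as (c
      1) x, with the unit acting only modulo \<open>J\<close>.\<close>
    have "\<rho> (c *s x) = \<rho> (c *s (unit \<star> x))"
      unfolding rho_eq by (rule eqv_sym[OF eqv_scale[OF unit_mult]])
    also have "\<dots> = \<rho> (c *s unit) \<otimes> \<rho> x"
      by (simp add: rho_mult[symmetric] mult_scale_left)
    finally show ?thesis using that I.I_l_closed by simp
  qed
  moreover have "J \<subseteq> {x. \<rho> x \<in> I}"
  proof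
    fix x assume "x \<in> J"
    then have "\<rho> x = \<zero>" unfolding rho_zero[symmetric] rho_eq by (simp add: eqv_zero)
    then show "x \<in> {x. \<rho> x \<in> I}" by simp
  qed
  ultimately show ?thesis
    unfolding two_sided_def subspace_def
    by (auto simp: rho_add rho_mult rho_zero intro: I.I_l_closed I.I_r_closed)
qed

lemma ideal_prod_image:
  assumes "two_sided X" "two_sided Y"
  shows "ideal_prod P (\<rho> ` X) (\<rho> ` Y) = \<rho> ` iprod X Y"
proof
  show "ideal_prod P (\<rho> ` X) (\<rho> ` Y) \<subseteq> \<rho> ` iprod X Y"
  proof
    fix a assume "a \<in> ideal_prod P (\<rho> ` X) (\<rho> ` Y)"
    then show "a \<in> \<rho> ` iprod X Y"
    proof (induction rule: ideal_prod.induct)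
      case (prod a b)
      then show ?case using mult_in_iprod by (auto simp: rho_mult[symmetric])
    next
      case (sum a b)
      then show ?case using subspace_add[OF subspace_iprod] by (auto simp: rho_add[symmetric])
    qed
  qed
  have id: "ideal (ideal_prod P (\<rho> ` X) (\<rho> ` Y)) P"
    by (intro P.ideal_prod_is_ideal ideal_image assms)
  have "iprod X Y \<subseteq> {z. \<rho> z \<in> ideal_prod P (\<rho> ` X) (\<rho> ` Y)}"
    by (intro iprod_least two_sidedD(1,2)[OF two_sided_preimage[OF id]])
       (auto simp: rho_mult intro: ideal_prod.prod)
  then show "\<rho> ` iprod X Y \<subseteq> ideal_prod P (\<rho> ` X) (\<rho> ` Y)" by auto
qed

lemma genideal_image:
  assumes X: "two_sided X" "a \<in> X" and least: "\<And>Y. two_sided Y \<Longrightarrow> a \<in> Y \<Longrightarrow> X \<subseteq> Y"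
  shows "Idl {\<rho> a} = \<rho> ` X"
proof
  show "Idl {\<rho> a} \<subseteq> \<rho> ` X"
    using X by (intro P.genideal_minimal ideal_image) auto
  have id: "ideal (Idl {\<rho> a}) P" by (intro P.genideal_ideal) simp
  have "\<rho> a \<in> Idl {\<rho> a}" by (intro P.genideal_self') simp
  then have "X \<subseteq> {x. \<rho> x \<in> Idl {\<rho> a}}" by (intro least two_sided_preimage[OF id]) simp
  then show "\<rho> ` X \<subseteq> Idl {\<rho> a}" by auto
qed

text \<open>Elements of the dual are linear on the ideal only, whereas a Frobenius form represents
  forms on the whole algebra.\<close>

lemma form_extend:
  assumes X: "subspace X" and add: "\<And>x y. x \<in> X \<Longrightarrow> y \<in> X \<Longrightarrow> f (x + y) = f x + f y"
    and scale: "\<And>c x. x \<in> X \<Longrightarrow> f (c *s x) = c * (f x :: 'k)"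
  shows "\<exists>g. linear_form g \<and> (\<forall>x\<in>X. g x = f x)"
proof -
  interpret K: vector_space "(*) :: 'k \<Rightarrow> 'k \<Rightarrow> 'k" by unfold_locales (auto simp: algebra_simps)
  interpret VP: vector_space_pair scale "(*) :: 'k \<Rightarrow> 'k \<Rightarrow> 'k" ..
  obtain C where C: "C \<subseteq> X" "independent C" "X \<subseteq> span C"
    using maximal_independent_subset by blast
  obtain g where g: "Vector_Spaces.linear scale (*) g" "\<forall>x\<in>C. g x = f x"
    using VP.linear_independent_extend[OF C(2), of f] by blast
  have lin: "linear_form g" using g linear_form_iff by simp
  have "x \<in> X \<and> g x = f x" if "x \<in> span C" for x
    using that
  proof (induction rule: span_induct_alt)
    case base
    have "f 0 = 0" using scale[of 0 0] subspace_0[OF X] by simp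
    then show ?case using subspace_0[OF X] by (simp add: linear_formD[OF lin])
  next
    case (step c x y)
    then show ?case
      using C(1) g(2) add[of "c *s x" y] scale[of x c] subspace_add[OF X] subspace_scale[OF X]
      by (auto simp: linear_formD(1,2)[OF lin])
  qed
  then show ?thesis using lin C(3) by blast
qed

section \<open>Duals of ideals as quotients\<close>

lemma coset_eq_iff:
  assumes "two_sided X"
  shows "\<rho> ` X +> \<rho> a = \<rho> ` X +> \<rho> b \<longleftrightarrow> a - b \<in> X"
  using P.quotient_eq_iff_same_a_r_cos[OF ideal_image[OF assms], of "\<rho> a" "\<rho> b"]
  by (simp add: rho_diff[symmetric] rho_mem_iff[OF assms])

text \<open>The isomorphism sends the form \<open>x \<mapsto> \<beta> x a\<close> to the residue class of \<open>a\<close>.\<close>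

lemma dual_isomorphic_quotient:
  fixes M :: "('x, 'x \<Rightarrow> 'k) module" and N :: "('x, 'y) module"
  assumes X: "two_sided X" and Y: "subspace Y"
    and lin: "\<And>a. linear_form (\<lambda>x. \<beta> x a)" "\<And>x. linear_form (\<beta> x)"
    and J0: "\<And>x a. x \<in> J \<Longrightarrow> \<beta> x a = 0"
    and rep: "\<And>f. linear_form f \<Longrightarrow> (\<And>x. x \<in> J \<Longrightarrow> f x = 0) \<Longrightarrow> \<exists>a. \<forall>x. f x = \<beta> x a"
    and ann: "\<And>a. (\<forall>x\<in>X. \<beta> x a = 0) \<longleftrightarrow> a \<in> Y"
    and N: "carrier N = range q" "\<And>a b. q a = q b \<longleftrightarrow> a - b \<in> Y" "\<And>a b. q a \<oplus>\<^bsub>N\<^esub> q b = q (a + b)"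
      "\<And>t a. \<rho> t \<odot>\<^bsub>N\<^esub> q a = q (l t a)"
    and M: "carrier M = linear_forms P (\<rho> ` X)" "\<And>f g. f \<oplus>\<^bsub>M\<^esub> g = (\<lambda>x\<in>\<rho> ` X. f x + g x)"
      "\<And>t f. \<rho> t \<odot>\<^bsub>M\<^esub> f = (\<lambda>x\<in>\<rho> ` X. f (m t x))"
    and act: "\<And>t x. x \<in> X \<Longrightarrow> r t x \<in> X" "\<And>t x. m t (\<rho> x) = \<rho> (r t x)"
      "\<And>t x a. \<beta> (r t x) a = \<beta> x (l t a)"
  shows "module_isomorphic P M N"
proof -
  note X' = two_sidedD[OF X]
  \<comment> \<open>A representing element, unique modulo Y by \<open>ann\<close>; the class
    \<open>q (rp f)\<close> is therefore independent of the choice.\<close>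
  define rp where "rp f = (SOME a. \<forall>x\<in>X. f (\<rho> x) = \<beta> x a)" for f
  have rp: "f (\<rho> x) = \<beta> x (rp f)" if f: "f \<in> carrier M" and x: "x \<in> X" for f x
  proof -
    have add: "f (\<rho> (x + y)) = f (\<rho> x) + f (\<rho> y)" if "x \<in> X" "y \<in> X" for x y
      using f that unfolding M(1) linear_forms_def by (simp add: rho_add)
    have scale: "f (\<rho> (c *s x)) = c * f (\<rho> x)" if "x \<in> X" for c x
      using f that unfolding M(1) linear_forms_def by (simp add: rho_smult)
    obtain g where g: "linear_form g" "\<And>x. x \<in> X \<Longrightarrow> g x = f (\<rho> x)"
      using form_extend[OF X'(1), of "\<lambda>x. f (\<rho> x)"] add scale by blast
    have "g x = 0" if "x \<in> J" for x
    proof -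
      have "\<rho> x = \<rho> 0" using that by (simp add: rho_eq eqv_zero)
      then have "g x = g 0" using g(2)[of x] g(2)[of 0] X'(2) that subspace_0[OF X'(1)] by auto
      then show ?thesis by (simp add: linear_formD[OF g(1)])
    qed
    then obtain a where "\<And>x. g x = \<beta> x a" using rep[OF g(1)] by blast
    then have "\<forall>x\<in>X. f (\<rho> x) = \<beta> x a" using g(2) by metis
    then have "\<forall>x\<in>X. f (\<rho> x) = \<beta> x (rp f)" unfolding rp_def by (rule someI)
    with x show ?thesis by blast
  qed
  have rpI: "q (rp f) = q a" if f: "f \<in> carrier M" "\<And>x. x \<in> X \<Longrightarrow> f (\<rho> x) = \<beta> x a" for f a
  proof -
    have "\<beta> x (rp f - a) = 0" if "x \<in> X" for x
      using rp[OF f(1) that] f(2)[OF that] by (simp add: linear_formD[OF lin(2)])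
    then show ?thesis using ann N(2) by blast
  qed
  have beta_eqv: "\<beta> x a = \<beta> y a" if "x \<approx> y" for x y a
    using J0[of "x - y" a] that by (simp add: eqv_def linear_formD(5)[OF lin(1)])
  \<comment> \<open>The inverse map. The preimage of y is chosen arbitrarily, which is harmless by
    \<open>beta_eqv\<close>.\<close>
  define fm where "fm a = (\<lambda>y\<in>\<rho> ` X. \<beta> (SOME x. \<rho> x = y) a)" for a
  have fm: "fm a (\<rho> x) = \<beta> x a" if "x \<in> X" for a x
  proof -
    have "\<rho> (SOME z. \<rho> z = \<rho> x) = \<rho> x" by (rule someI) simp
    then show ?thesis using that beta_eqv by (auto simp: fm_def rho_eq)
  qed
  have fm_M: "fm a \<in> carrier M" for a
    unfolding M(1) linear_forms_def
    by (auto simp: rho_add[symmetric] rho_smult[symmetric] fm subspace_add[OF X'(1)] subspace_scale[OF X'(1)]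
        linear_formD(1,2)[OF lin(1)]) (simp add: fm_def)
  have ext: "f = g" if "f \<in> carrier M" "g \<in> carrier M" "\<And>x. x \<in> X \<Longrightarrow> f (\<rho> x) = g (\<rho> x)" for f g
    using that unfolding M(1) linear_forms_def by (auto intro!: extensionalityI[of _ "\<rho> ` X"])
  define h where "h f = q (rp f)" for f
  have "bij_betw h (carrier M) (carrier N)"
    unfolding bij_betw_def
  proof
    show "inj_on h (carrier M)"
    proof (rule inj_onI)
      fix f g assume f: "f \<in> carrier M" and g: "g \<in> carrier M" and "h f = h g"
      then have "rp f - rp g \<in> Y" using N(2) by (simp add: h_def)
      then have "\<beta> x (rp f - rp g) = 0" if "x \<in> X" for x using ann that by blast
      then show "f = g" using rp[OF f] rp[OF g] by (intro ext[OF f g]) (simp add: linear_formD[OF lin(2)])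
    qed
    show "h ` carrier M = carrier N"
    proof
      show "carrier N \<subseteq> h ` carrier M"
      proof
        fix y assume "y \<in> carrier N"
        then obtain a where "y = q a" using N(1) by auto
        then have "y = h (fm a)" using rpI[OF fm_M fm] by (simp add: h_def)
        then show "y \<in> h ` carrier M" using fm_M by blast
      qed
    qed (auto simp: h_def N(1))
  qed
  moreover have "h (f \<oplus>\<^bsub>M\<^esub> g) = h f \<oplus>\<^bsub>N\<^esub> h g" if f: "f \<in> carrier M" and g: "g \<in> carrier M" for f g
  proof -
    have "f \<oplus>\<^bsub>M\<^esub> g = fm (rp f + rp g)"
      unfolding M(2) using rp[OF f] rp[OF g] fm fm_M[of "rp f + rp g"]
      by (intro extensionalityI[of _ "\<rho> ` X"]) (auto simp: M(1) linear_forms_def linear_formD[OF lin(2)])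
    then have "h (f \<oplus>\<^bsub>M\<^esub> g) = q (rp f + rp g)" using rpI[OF fm_M fm] by (simp add: h_def)
    then show ?thesis by (simp add: h_def N(3))
  qed
  moreover have "h (a \<odot>\<^bsub>M\<^esub> f) = a \<odot>\<^bsub>N\<^esub> h f" if a: "a \<in> carrier P" and f: "f \<in> carrier M" for a f
  proof -
    obtain t where t: "a = \<rho> t" using a by (rule carrier_cases)
    have "a \<odot>\<^bsub>M\<^esub> f = fm (l t (rp f))"
      unfolding M(3) t using rp[OF f act(1)] fm fm_M[of "l t (rp f)"]
      by (intro extensionalityI[of _ "\<rho> ` X"]) (auto simp: M(1) linear_forms_def act)
    then have "h (a \<odot>\<^bsub>M\<^esub> f) = q (l t (rp f))" using rpI[OF fm_M fm] by (simp add: h_def)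
    then show ?thesis by (simp add: h_def N(4) t)
  qed
  ultimately show ?thesis unfolding module_isomorphic_def by blast
qed

lemma cosets: "two_sided Y \<Longrightarrow> carrier (P Quot (\<rho> ` Y)) = range (\<lambda>a. \<rho> ` Y +> \<rho> a)"
  unfolding FactRing_def A_RCOSETS_def' by (auto simp: carrier_P)

text \<open>The left action on the dual comes from right multiplication on X, and lam ((x t) a) =
  lam (x (t a)); so if f corresponds to a, then t f corresponds to t a.\<close>

lemma dual_left_isomorphic_quotient:
  assumes lam: "frobenius_form lam" and X: "two_sided X" and Y: "two_sided Y" "rann X = Y"
  shows "module_isomorphic P (dual_left_module P (\<rho> ` X)) (quotient_left_module P (\<rho> ` Y))"
proof (rule dual_isomorphic_quotient[where \<beta> = "\<lambda>x a. lam (x \<star> a)" and q = "\<lambda>a. \<rho> ` Y +> \<rho> a"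
      and l = "\<lambda>t a. t \<star> a" and m = "\<lambda>t x. x \<otimes> \<rho> t" and r = "\<lambda>t x. x \<star> t", OF X two_sidedD(1)[OF Y(1)]])
  interpret Y: ideal "\<rho> ` Y" P by (rule ideal_image[OF Y(1)])
  note lamD = frobenius_formD[OF lam]
  show "linear_form (\<lambda>x. lam (x \<star> a))" "linear_form (\<lambda>a. lam (x \<star> a))" for a x
    using lamD(1) by (auto simp: linear_form_def mult_add_left mult_add_right mult_scale_left mult_scale_right)
  show "lam (x \<star> a) = 0" if "x \<in> J" for x a using lamD(2) J_mult_right[OF that] by blast
  show "\<exists>a. \<forall>x. f x = lam (x \<star> a)" if "linear_form f" "\<And>x. x \<in> J \<Longrightarrow> f x = 0" for f
    using lamD(5) that by blast
  show "(\<forall>x\<in>X. lam (x \<star> a) = 0) \<longleftrightarrow> a \<in> Y" for a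
  proof
    assume a: "\<forall>x\<in>X. lam (x \<star> a) = 0"
    \<comment> \<open>X absorbs left factors, so nondegeneracy upgrades the vanishing of
      \<open>lam\<close> to membership in \<open>J\<close>.\<close>
    have "x \<star> a \<in> J" if "x \<in> X" for x
      by (rule lamD(4)) (use a two_sidedD(4)[OF X that] in \<open>simp add: mult_assoc[symmetric]\<close>)
    then show "a \<in> Y" unfolding Y(2)[symmetric] rann_def by blast
  next
    assume "a \<in> Y"
    then show "\<forall>x\<in>X. lam (x \<star> a) = 0" unfolding Y(2)[symmetric] rann_def using lamD(2) by blast
  qed
  show "carrier (quotient_left_module P (\<rho> ` Y)) = range (\<lambda>a. \<rho> ` Y +> \<rho> a)"
    using cosets[OF Y(1)] by (simp add: quotient_left_module_def)
  show "(\<rho> ` Y +> \<rho> a = \<rho> ` Y +> \<rho> b) = (a - b \<in> Y)" for a b by (rule coset_eq_iff[OF Y(1)])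
  show "(\<rho> ` Y +> \<rho> a) \<oplus>\<^bsub>quotient_left_module P (\<rho> ` Y)\<^esub> (\<rho> ` Y +> \<rho> b) = \<rho> ` Y +> \<rho> (a + b)" for a b
    by (simp add: quotient_left_module_def FactRing_def Y.a_rcos_sum rho_add)
  show "\<rho> t \<odot>\<^bsub>quotient_left_module P (\<rho> ` Y)\<^esub> (\<rho> ` Y +> \<rho> a) = \<rho> ` Y +> \<rho> (t \<star> a)" for t a
    by (simp add: quotient_left_module_def FactRing_def Y.rcoset_mult_add rho_mult)
  show "x \<star> t \<in> X" if "x \<in> X" for t x using two_sidedD(3)[OF X that] .
qed (simp_all add: dual_left_module_def rho_mult mult_assoc)

lemma dual_right_isomorphic_quotient:
  assumes lam: "frobenius_form lam" and X: "two_sided X" and Y: "two_sided Y" "lann X = Y"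
  shows "module_isomorphic P (dual_right_module P (\<rho> ` X)) (quotient_right_module P (\<rho> ` Y))"
proof (rule dual_isomorphic_quotient[where \<beta> = "\<lambda>x a. lam (a \<star> x)" and q = "\<lambda>a. \<rho> ` Y +> \<rho> a"
      and l = "\<lambda>t a. a \<star> t" and m = "\<lambda>t x. \<rho> t \<otimes> x" and r = "\<lambda>t x. t \<star> x", OF X two_sidedD(1)[OF Y(1)]])
  interpret Y: ideal "\<rho> ` Y" P by (rule ideal_image[OF Y(1)])
  note lamD = frobenius_formD[OF lam]
  show "linear_form (\<lambda>x. lam (a \<star> x))" "linear_form (\<lambda>a. lam (a \<star> x))" for a x
    using lamD(1) by (auto simp: linear_form_def mult_add_left mult_add_right mult_scale_left mult_scale_right)
  show "lam (a \<star> x) = 0" if "x \<in> J" for x a using lamD(2) J_mult_left[OF that] by blast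
  show "\<exists>a. \<forall>x. f x = lam (a \<star> x)" if "linear_form f" "\<And>x. x \<in> J \<Longrightarrow> f x = 0" for f
    using lamD(6) that by blast
  show "(\<forall>x\<in>X. lam (a \<star> x) = 0) \<longleftrightarrow> a \<in> Y" for a
  proof
    assume a: "\<forall>x\<in>X. lam (a \<star> x) = 0"
    have "a \<star> x \<in> J" if "x \<in> X" for x
      by (rule lamD(3)) (use a two_sidedD(3)[OF X that] in \<open>simp add: mult_assoc\<close>)
    then show "a \<in> Y" unfolding Y(2)[symmetric] lann_def by blast
  next
    assume "a \<in> Y"
    then show "\<forall>x\<in>X. lam (a \<star> x) = 0" unfolding Y(2)[symmetric] lann_def using lamD(2) by blast
  qed
  show "carrier (quotient_right_module P (\<rho> ` Y)) = range (\<lambda>a. \<rho> ` Y +> \<rho> a)"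
    using cosets[OF Y(1)] by (simp add: quotient_right_module_def)
  show "(\<rho> ` Y +> \<rho> a = \<rho> ` Y +> \<rho> b) = (a - b \<in> Y)" for a b by (rule coset_eq_iff[OF Y(1)])
  show "(\<rho> ` Y +> \<rho> a) \<oplus>\<^bsub>quotient_right_module P (\<rho> ` Y)\<^esub> (\<rho> ` Y +> \<rho> b) = \<rho> ` Y +> \<rho> (a + b)" for a b
    by (simp add: quotient_right_module_def FactRing_def Y.a_rcos_sum rho_add)
  show "\<rho> t \<odot>\<^bsub>quotient_right_module P (\<rho> ` Y)\<^esub> (\<rho> ` Y +> \<rho> a) = \<rho> ` Y +> \<rho> (a \<star> t)" for t a
    by (simp add: quotient_right_module_def FactRing_def Y.rcoset_mult_add rho_mult)
  show "t \<star> x \<in> X" if "x \<in> X" for t x using two_sidedD(4)[OF X that] .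
qed (simp_all add: dual_right_module_def rho_mult mult_assoc)

end


section \<open>Weyl groups of quivers\<close>

locale weyl_realization = weyl_words V adj
  for V :: "'v set" and adj :: "'v \<Rightarrow> 'v \<Rightarrow> bool" +
  fixes Q :: "('v, 'a) pre_digraph"
  assumes verts_Q: "verts Q = V"
    and cartan: "i \<in> V \<Longrightarrow> j \<in> V \<Longrightarrow> cartan_matrix Q i j = (if i = j then 2 else if adj i j then - 1 else 0)"
begin

definition el :: "'v list \<Rightarrow> ('v \<Rightarrow> int) \<Rightarrow> ('v \<Rightarrow> int)" where "el u = restrict (act u) L"

lemma root_lattice_eq: "root_lattice Q = L"
  by (auto simp: root_lattice_def L_def verts_Q)

lemma simple_reflection_eq:
  assumes i: "i \<in> V"
  shows "simple_reflection Q i = el [i]"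
proof -
  have "(\<Sum>j\<in>V. cartan_matrix Q i j * x j) = 2 * x i - nsum i x" for x
  proof -
    have "(\<Sum>j\<in>V. cartan_matrix Q i j * x j) = (\<Sum>j\<in>V. (if j = i then 2 * x i else 0) - (if adj i j then x j else 0))"
      using i adj_irrefl[OF i] by (intro sum.cong) (auto simp: cartan)
    also have "\<dots> = 2 * x i - (\<Sum>j\<in>V. if adj i j then x j else 0)"
      using i finite_vertices by (simp add: sum_subtractf)
    also have "(\<Sum>j\<in>V. if adj i j then x j else 0) = nsum i x"
      unfolding nsum_def using finite_vertices by (simp add: sum.inter_filter)
    finally show ?thesis .
  qed
  then show ?thesis
    by (auto simp: simple_reflection_def el_def root_lattice_eq verts_Q refl_def restrict_def fun_eq_iff)
qed

lemma el_eq_iff: "el u = el v \<longleftrightarrow> eqw u v"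
  by (auto simp: el_def eqw_def restrict_def fun_eq_iff)

lemma el_Bij:
  assumes "set u \<subseteq> V"
  shows "el u \<in> Bij L"
proof -
  have "bij_betw (act u) L L"
    by (rule bij_betw_byWitness[of _ "act (rev u)"]) (use assms act_in_L[of u] act_in_L[of "rev u"] in \<open>auto simp: act_rev act_rev'\<close>)
  then have "bij_betw (el u) L L" by (subst bij_betw_cong[of L "el u" "act u"]) (auto simp: el_def)
  then show ?thesis by (auto simp: Bij_def el_def)
qed

lemma mult_el:
  assumes "set u \<subseteq> V" "set v \<subseteq> V"
  shows "el u \<otimes>\<^bsub>weyl_group Q\<^esub> el v = el (u @ v)"
proof -
  have "el u \<otimes>\<^bsub>weyl_group Q\<^esub> el v = compose L (el u) (el v)"
    using assms by (simp add: weyl_group_def subgroup_generated_def BijGroup_def root_lattice_eq el_Bij)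
  also have "\<dots> = el (u @ v)"
    using act_in_L[OF assms(2)] by (auto simp: compose_def el_def restrict_def fun_eq_iff)
  finally show ?thesis .
qed

lemma one_el: "\<one>\<^bsub>weyl_group Q\<^esub> = el []"
  by (auto simp: weyl_group_def subgroup_generated_def BijGroup_def root_lattice_eq el_def restrict_def fun_eq_iff)

lemma word_element_eq: "set u \<subseteq> V \<Longrightarrow> word_element Q u = el u"
proof (induction u)
  case Nil
  show ?case by (simp add: word_element_def one_el)
next
  case (Cons i u)
  then have "word_element Q (i # u) = el [i] \<otimes>\<^bsub>weyl_group Q\<^esub> el u"
    by (simp add: word_element_def simple_reflection_eq)
  then show ?case using Cons mult_el[of "[i]" u] by simp
qed

lemma group_weyl: "group (weyl_group Q)"
  unfolding weyl_group_def using group.group_subgroup_generated[OF group_BijGroup] .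

lemma carrier_weyl_eq: "carrier (weyl_group Q) = generate (BijGroup L) (simple_reflection Q ` V)"
proof -
  have "carrier (BijGroup L) \<inter> simple_reflection Q ` V = simple_reflection Q ` V"
    using el_Bij by (auto simp: BijGroup_def simple_reflection_eq)
  then show ?thesis by (simp add: weyl_group_def carrier_subgroup_generated root_lattice_eq verts_Q)
qed

lemma mult_weyl: "x \<otimes>\<^bsub>BijGroup L\<^esub> y = x \<otimes>\<^bsub>weyl_group Q\<^esub> y"
  by (simp add: weyl_group_def subgroup_generated_def root_lattice_eq)

lemma one_weyl: "\<one>\<^bsub>BijGroup L\<^esub> = \<one>\<^bsub>weyl_group Q\<^esub>"
  by (simp add: weyl_group_def subgroup_generated_def root_lattice_eq)

lemma inv_simple:
  assumes "i \<in> V"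
  shows "inv\<^bsub>BijGroup L\<^esub> (el [i]) = el [i]"
proof (rule group.inv_equality[OF group_BijGroup])
  show "el [i] \<otimes>\<^bsub>BijGroup L\<^esub> el [i] = \<one>\<^bsub>BijGroup L\<^esub>"
    using assms mult_el[of "[i]" "[i]"] eqw_cons_cons[of i "[]"] by (simp add: mult_weyl one_weyl one_el el_eq_iff)
qed (use assms el_Bij[of "[i]"] in \<open>auto simp: BijGroup_def\<close>)

lemma carrier_weyl: "carrier (weyl_group Q) = el ` {u. set u \<subseteq> V}"
proof
  show "carrier (weyl_group Q) \<subseteq> el ` {u. set u \<subseteq> V}"
  proof
    fix g assume "g \<in> carrier (weyl_group Q)"
    then have "g \<in> generate (BijGroup L) (simple_reflection Q ` V)" by (simp add: carrier_weyl_eq)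
    then show "g \<in> el ` {u. set u \<subseteq> V}"
    proof (induction rule: generate.induct)
      case one
      show ?case unfolding one_weyl one_el by (rule imageI) simp
    next
      case (incl h)
      then obtain i where "i \<in> V" "h = el [i]" by (auto simp: simple_reflection_eq)
      then show ?case by (intro image_eqI[of _ _ "[i]"]) auto
    next
      case (inv h)
      then obtain i where i: "i \<in> V" "h = el [i]" by (auto simp: simple_reflection_eq)
      \<comment> \<open>Simple reflections are involutions, so their inverses are again one-letter
        words.\<close>
      then show ?case unfolding i(2) inv_simple[OF i(1)] by (intro image_eqI[of _ _ "[i]"]) auto
    next
      case (eng g h)
      then obtain u v where "set u \<subseteq> V" "g = el u" "set v \<subseteq> V" "h = el v" by blast
      then show ?case using mult_el by (intro image_eqI[of _ _ "u @ v"]) (auto simp: mult_weyl)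
    qed
  qed
  have "el u \<in> carrier (weyl_group Q)" if "set u \<subseteq> V" for u
    using that
  proof (induction u)
    case Nil
    show ?case unfolding one_el[symmetric] by (rule monoid.one_closed[OF group.is_monoid[OF group_weyl]])
  next
    case (Cons i u)
    have "el [i] \<in> carrier (weyl_group Q)"
      unfolding carrier_weyl_eq using Cons by (intro generate.incl) (auto simp: simple_reflection_eq)
    then have "el [i] \<otimes>\<^bsub>weyl_group Q\<^esub> el u \<in> carrier (weyl_group Q)"
      using Cons by (intro monoid.m_closed[OF group.is_monoid[OF group_weyl]]) auto
    then show ?case using Cons mult_el[of "[i]" u] by simp
  qed
  then show "el ` {u. set u \<subseteq> V} \<subseteq> carrier (weyl_group Q)" by blast
qed

lemma inv_el:
  assumes "set u \<subseteq> V"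
  shows "inv\<^bsub>weyl_group Q\<^esub> (el u) = el (rev u)"
proof (rule group.inv_equality[OF group_weyl])
  show "el (rev u) \<otimes>\<^bsub>weyl_group Q\<^esub> el u = \<one>\<^bsub>weyl_group Q\<^esub>"
    using assms by (simp add: mult_el one_el el_eq_iff eqw_def act_rev')
qed (use assms in \<open>auto simp: carrier_weyl\<close>)

lemma weyl_length_el: "set u \<subseteq> V \<Longrightarrow> weyl_length Q (el u) = len u"
proof -
  have "(set v \<subseteq> verts Q \<and> word_element Q v = el u \<and> length v = n) = (set v \<subseteq> V \<and> eqw v u \<and> length v = n)" for v n
    using word_element_eq[of v] by (auto simp: verts_Q el_eq_iff[symmetric])
  then show ?thesis unfolding weyl_length_def len_def by simp
qed

lemma reduced_expression_el:
  assumes "set u \<subseteq> V"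
  shows "reduced_expression Q (el u) v \<longleftrightarrow> reduced v \<and> eqw v u"
proof
  assume "reduced_expression Q (el u) v"
  then have v: "set v \<subseteq> V" "eqw v u" "length v = len u"
    using word_element_eq[of v] weyl_length_el[OF assms]
    by (auto simp: reduced_expression_def verts_Q el_eq_iff[symmetric])
  then show "reduced v \<and> eqw v u" using len_eqw by (simp add: reduced_def)
next
  assume v: "reduced v \<and> eqw v u"
  then have "length v = len u" "set v \<subseteq> V" using len_eqw by (auto simp: reduced_def)
  then show "reduced_expression Q (el u) v"
    using v word_element_eq[of v] weyl_length_el[OF assms] by (simp add: reduced_expression_def verts_Q el_eq_iff)
qed

lemma some_reduced_expression:
  assumes "set u \<subseteq> V"
  shows "reduced (SOME v. reduced_expression Q (el u) v)" "eqw (SOME v. reduced_expression Q (el u) v) u"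
proof -
  obtain v where "reduced v" "eqw v u" using exists_reduced[OF assms] by blast
  then have "reduced_expression Q (el u) v" using reduced_expression_el[OF assms] by blast
  then have "reduced_expression Q (el u) (SOME v. reduced_expression Q (el u) v)" by (rule someI)
  then show "reduced (SOME v. reduced_expression Q (el u) v)" "eqw (SOME v. reduced_expression Q (el u) v) u"
    using reduced_expression_el[OF assms] by blast+
qed

lemma longest_el:
  assumes "longest_element Q w"
  shows "\<exists>z. longest z \<and> w = el z"
proof -
  obtain z where z: "set z \<subseteq> V" "w = el z" using assms by (auto simp: longest_element_def carrier_weyl)
  have "len v \<le> len z" if "set v \<subseteq> V" for v
    using assms that z weyl_length_el by (auto simp: longest_element_def carrier_weyl)
  then show ?thesis using z by (auto simp: longest_def)
qed

end


section \<open>The preprojective algebra of a simply laced quiver\<close>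

locale simply_laced_quiver = wf_digraph Q for Q :: "('v, 'a) pre_digraph" +
  assumes finite_verts_Q: "finite (verts Q)" and finite_arcs_Q: "finite (arcs Q)"
    and no_loop_Q: "a \<in> arcs Q \<Longrightarrow> tail Q a \<noteq> head Q a"
    and inj_edge: "inj_on (\<lambda>a. {tail Q a, head Q a}) (arcs Q)"

lemma dynkin_diagram_edges:
  assumes "(n, E) \<in> dynkin_diagrams"
  shows "finite E" "s \<in> E \<Longrightarrow> card s = 2"
proof -
  have chain: "finite {{i, i + 1} | i. P i \<and> i < m}" for P and m :: nat
    by (rule finite_subset[of _ "(\<lambda>i. {i, i + 1}) ` {..<m}"]) auto
  \<comment> \<open>The bound on n is kept in type D to separate the vertices n - 2 and n of the
    extra edge.\<close>
  have "E = dynkin_A_edges n \<or> E = dynkin_D_edges n \<and> n \<ge> 4 \<or> E = dynkin_E_edges n"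
    using assms by (auto simp: dynkin_diagrams_def)
  then show "finite E" "s \<in> E \<Longrightarrow> card s = 2"
    using chain[of "\<lambda>i. 1 \<le> i" n] chain[of "\<lambda>i. 1 \<le> i" "n - 1"] chain[of "\<lambda>i. 4 \<le> i" n]
    by (auto simp: dynkin_A_edges_def dynkin_D_edges_def dynkin_E_edges_def)
qed

text \<open>Arrows biject with edges, so distinct arrows have distinct unordered pairs of ends, and
  edges of size two exclude loops.\<close>

lemma simply_laced_if_dynkin:
  assumes "dynkin_quiver Q"
  shows "simply_laced_quiver Q"
proof -
  obtain n E f where Q: "wf_digraph Q" "(n, E) \<in> dynkin_diagrams" "bij_betw f (verts Q) {1..n}"
      "bij_betw (\<lambda>a. {f (tail Q a), f (head Q a)}) (arcs Q) E"
    using assms unfolding dynkin_quiver_def by blast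
  interpret wf_digraph Q by (rule Q(1))
  show ?thesis
  proof
    show "finite (verts Q)" using bij_betw_finite[OF Q(3)] by simp
    show "finite (arcs Q)" using bij_betw_finite[OF Q(4)] dynkin_diagram_edges(1)[OF Q(2)] by simp
    show "tail Q a \<noteq> head Q a" if "a \<in> arcs Q" for a
    proof
      assume "tail Q a = head Q a"
      moreover have "{f (tail Q a), f (head Q a)} \<in> E" using Q(4) that by (auto simp: bij_betw_def)
      ultimately show False using dynkin_diagram_edges(2)[OF Q(2)] by fastforce
    qed
    show "inj_on (\<lambda>a. {tail Q a, head Q a}) (arcs Q)"
    proof (rule inj_onI)
      fix a b assume ab: "a \<in> arcs Q" "b \<in> arcs Q" "{tail Q a, head Q a} = {tail Q b, head Q b}"
      from arg_cong[OF ab(3), of "image f"]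
      have "{f (tail Q a), f (head Q a)} = {f (tail Q b), f (head Q b)}" by simp
      with ab Q(4) show "a = b" by (auto simp: bij_betw_def dest: inj_onD)
    qed
  qed
qed

locale preprojective = simply_laced_quiver Q for Q :: "('v, 'a) pre_digraph" +
  fixes k :: "'k::field itself"
begin

abbreviation G :: "('v, 'a \<times> bool) pre_digraph" where "G \<equiv> double_quiver Q"

definition rv :: "'a \<times> bool \<Rightarrow> 'a \<times> bool" where "rv = (\<lambda>(a, s). (a, \<not> s))"
text \<open>The summand of b in a mesh relation is \<open>rv b\<close> followed by b. The sign is +1
  on opposite arrows, giving an arrow followed by its opposite, and -1 on original ones, giving the
  product in the other order, as in the preprojective relation.\<close>

definition sg :: "'a \<times> bool \<Rightarrow> 'k" where "sg = (\<lambda>(a, s). if s then 1 else - 1)"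

lemma verts_G: "verts G = verts Q" and arcs_G: "arcs G = arcs Q \<times> UNIV"
  by (auto simp: double_quiver_def)

lemma tail_head_G [simp]:
  "tail G (a, s) = (if s then head Q a else tail Q a)" "head G (a, s) = (if s then tail Q a else head Q a)"
  by (auto simp: double_quiver_def)

lemma arc_eqI: "a \<in> arcs Q \<Longrightarrow> b \<in> arcs Q \<Longrightarrow> {tail Q a, head Q a} = {tail Q b, head Q b} \<Longrightarrow> a = b"
  using inj_edge by (auto dest: inj_onD)

sublocale R: reversible_quiver G rv sg
proof
  show "tail G b \<in> verts G" "head G b \<in> verts G" if "b \<in> arcs G" for b
    using that by (cases b; auto simp: verts_G arcs_G)+
  show "finite (verts G)" "finite (arcs G)" using finite_verts_Q finite_arcs_Q by (auto simp: verts_G arcs_G)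
  show "rv b \<in> arcs G" "tail G (rv b) = head G b" "head G (rv b) = tail G b" "rv (rv b) = b" "tail G b \<noteq> head G b" "sg b \<noteq> 0"
    if "b \<in> arcs G" for b
    using that no_loop_Q by (cases b; auto simp: rv_def sg_def arcs_G dest: sym)+
  show "b = c" if "b \<in> arcs G" "c \<in> arcs G" "tail G b = tail G c" "head G b = head G c" for b c
  proof -
    obtain a s where b: "b = (a, s)" by (cases b)
    obtain d t where c: "c = (d, t)" by (cases c)
    \<comment> \<open>The unoriented edge determines the arrow of Q; the direction then follows from
      the tail, as there are no loops.\<close>
    have "a = d" using that arc_eqI[of a d] unfolding b c by (auto simp: arcs_G split: if_splits)
    then show ?thesis using that no_loop_Q[of a] unfolding b c by (auto simp: arcs_G split: if_splits)
  qed
qed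

section \<open>The path algebra as a quotient by the non-paths\<close>

abbreviation A where "A \<equiv> path_algebra k G"
abbreviation u0 :: "'v \<times> ('a \<times> bool) list \<Rightarrow>\<^sub>0 'k" where "u0 \<equiv> \<Sum>v\<in>verts G. R.idem v"

text \<open>The carrier of \<open>path_algebra\<close> has only functions supported on paths, while
  the ambient type allows all words; \<open>res\<close> is the surjection and \<open>Np\<close> its
  kernel.\<close>

definition res :: "('v \<times> ('a \<times> bool) list \<Rightarrow>\<^sub>0 'k) \<Rightarrow> ('v \<times> ('a \<times> bool) list \<Rightarrow> 'k)" where
  "res f = (\<lambda>x. if x \<in> paths G then lookup f x else 0)"

definition Np :: "('v \<times> ('a \<times> bool) list \<Rightarrow>\<^sub>0 'k) set" where
  "Np = {f. \<forall>x\<in>paths G. lookup f x = 0}"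

lemma subspace_Np: "pm.subspace Np"
  by (auto simp: Np_def pm.subspace_def lookup_add)

lemma paths_split: "(u, p) \<in> paths G \<longleftrightarrow>
    (u, take i p) \<in> paths G \<and> (last (pre_digraph.awalk_verts G u (take i p)), drop i p) \<in> paths G"
  using R.paths_append[of u "take i p" "drop i p"] by simp

lemma Np_ideal:
  assumes "f \<in> Np"
  shows "R.pmul g f \<in> Np" "R.pmul f g \<in> Np"
  using assms paths_split
  by (fastforce simp: Np_def R.lookup_pmul R.fmul_def intro!: sum.neutral)+

sublocale N: algebra_mod smul R.pmul Np
proof
  show "f \<in> Np \<Longrightarrow> R.pmul g f \<in> Np" "f \<in> Np \<Longrightarrow> R.pmul f g \<in> Np" for f g by (rule Np_ideal, assumption)+
qed (fact R.A.mult_add_left R.A.mult_add_right R.A.mult_scale_left R.A.mult_scale_right R.A.mult_assoc subspace_Np)+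

lemma nonpath_in_Np: "x \<notin> paths G \<Longrightarrow> wd x \<in> Np"
  by (auto simp: Np_def lookup_wd)

lemma res_eq_iff: "res f = res g \<longleftrightarrow> f - g \<in> Np"
  by (auto simp: res_def Np_def lookup_minus fun_eq_iff)

lemma res_mult: "res (R.pmul f g) = R.fmul (res f) (res g)"
proof
  fix x :: "'v \<times> ('a \<times> bool) list"
  obtain u p where x: "x = (u, p)" by (cases x)
  show "res (R.pmul f g) x = R.fmul (res f) (res g) x"
  proof (cases "x \<in> paths G")
    case True
    then show ?thesis
      using paths_split[of u p] unfolding x by (auto simp: res_def R.lookup_pmul R.fmul_def intro!: sum.cong)
  next
    case False
    then have "R.fmul (res f) (res g) x = 0"
      using paths_split[of u p] unfolding x R.fmul_def prod.case by (intro sum.neutral) (auto simp: res_def)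
    then show ?thesis using False by (simp add: res_def)
  qed
qed

lemma carrier_A: "carrier A = range res"
proof
  show "carrier A \<subseteq> range res"
  proof
    fix f assume "f \<in> carrier A"
    then have f: "finite {x. f x \<noteq> 0}" "{x. f x \<noteq> 0} \<subseteq> paths G" by (auto simp: path_algebra_def)
    then have "f = res (Abs_poly_mapping f)" by (auto simp: res_def fun_eq_iff)
    then show "f \<in> range res" by blast
  qed
  have "finite {x. res f x \<noteq> 0}" for f
    by (rule finite_subset[of _ "keys f"]) (auto simp: res_def in_keys_iff)
  then show "range res \<subseteq> carrier A" by (auto simp: path_algebra_def res_def split: if_splits)
qed

lemma fmul_eq: "f \<otimes>\<^bsub>A\<^esub> g = R.fmul f g"
  by (simp add: path_algebra_def R.fmul_def)

lemma res_unit: "res u0 = \<one>\<^bsub>A\<^esub>"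
proof
  fix x :: "'v \<times> ('a \<times> bool) list"
  obtain u p where x: "x = (u, p)" by (cases x)
  have "lookup u0 x = (\<Sum>v\<in>verts Q. if v = u then (if p = [] then 1 else 0) else 0)"
    unfolding lookup_sum verts_G by (intro sum.cong) (auto simp: R.idem_def lookup_wd x)
  then have "lookup u0 x = (if u \<in> verts Q \<and> p = [] then 1 else 0)" using finite_verts_Q by simp
  then show "res u0 x = \<one>\<^bsub>A\<^esub> x"
    using R.paths_Nil[of u] by (auto simp: res_def path_algebra_def x verts_G)
qed

text \<open>Presenting the path algebra itself as a quotient supplies its ring laws and the
  translation between its ideals and those of the ambient type.\<close>

sublocale AR: algebra_rep smul R.pmul Np u0 A res
proof (unfold_locales, unfold N.eqv_def)
  show "R.pmul x u0 - x \<in> Np" "R.pmul u0 x - x \<in> Np" for x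
    by (rule R.right_unit[OF subspace_Np nonpath_in_Np], assumption)
       (rule R.left_unit[OF subspace_Np nonpath_in_Np], assumption)
  show "carrier A = range res" by (rule carrier_A)
  show "res (f + g) = res f \<oplus>\<^bsub>A\<^esub> res g" "res (smul c f) = c \<odot>\<^bsub>A\<^esub> res f" "res 0 = \<zero>\<^bsub>A\<^esub>" for f g c
    by (auto simp: path_algebra_def res_def lookup_add)
  show "res (R.pmul f g) = res f \<otimes>\<^bsub>A\<^esub> res g" for f g by (simp add: fmul_eq res_mult)
qed (fact res_unit res_eq_iff)+

lemma res_path_elem: "x \<in> paths G \<Longrightarrow> res (wd x) = path_elem k x"
  by (auto simp: res_def path_elem_def lookup_wd fun_eq_iff)

definition relation :: "'v \<times> ('a \<times> bool) list \<Rightarrow>\<^sub>0 'k" where "relation = (\<Sum>i\<in>verts G. R.rel i)"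

text \<open>The arrows of the double quiver are grouped once by their heads and once by the
  underlying arrow of Q.\<close>

lemma relation_eq: "relation = (\<Sum>a\<in>arcs Q. R.pmul (R.arr (a, False)) (R.arr (a, True)) - R.pmul (R.arr (a, True)) (R.arr (a, False)))"
proof -
  let ?h = "\<lambda>b. smul (sg b) (R.pmul (R.arr (rv b)) (R.arr b))"
  have "relation = (\<Sum>b\<in>arcs G. ?h b)"
    unfolding relation_def R.rel_def
    by (rule sum.group[OF R.finite_arcs R.finite_verts]) (use R.head_in_verts in blast)
  also have "\<dots> = (\<Sum>a\<in>arcs Q. \<Sum>s\<in>UNIV. ?h (a, s))"
    unfolding arcs_G by (simp add: sum.cartesian_product)
  also have "\<dots> = (\<Sum>a\<in>arcs Q. R.pmul (R.arr (a, False)) (R.arr (a, True)) - R.pmul (R.arr (a, True)) (R.arr (a, False)))"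
    by (intro sum.cong) (auto simp: UNIV_bool sg_def rv_def)
  finally show ?thesis .
qed

lemma res_relation: "res relation = preprojective_relation k Q"
proof -
  have arr: "res (R.arr (a, False)) = path_elem k (tail Q a, [(a, False)])"
    "res (R.arr (a, True)) = path_elem k (head Q a, [(a, True)])" if "a \<in> arcs Q" for a
    unfolding R.arr_def using that by (simp_all add: res_path_elem R.paths_Cons R.paths_Nil arcs_G verts_G)
  show ?thesis
    unfolding relation_eq AR.rho_sum[OF finite_arcs_Q] preprojective_relation_def Let_def
    by (intro AR.P.add.finprod_cong') (auto simp: AR.rho_diff AR.rho_mult arr[symmetric])
qed

lemma two_sided_Jp_N: "N.two_sided R.Jp"
proof -
  have "Np \<subseteq> R.Jp"
  proof
    fix f assume f: "f \<in> Np"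
    have "(\<lambda>f. f) f \<in> R.Jp"
      by (rule linear_op_memI[OF linear_op_id R.subspace_Jp], rule R.nonpath_in_Jp)
         (use f in \<open>auto simp: Np_def in_keys_iff\<close>)
    then show "f \<in> R.Jp" .
  qed
  then show ?thesis
    unfolding N.two_sided_def using R.subspace_Jp R.Jp_left R.Jp_right by blast
qed

lemma preprojective_ideal_eq: "preprojective_ideal k Q = res ` R.Jp"
  unfolding preprojective_ideal_def res_relation[symmetric]
proof (rule AR.genideal_image[OF two_sided_Jp_N])
  show "relation \<in> R.Jp"
    unfolding relation_def by (intro pm.subspace_sum[OF R.subspace_Jp] R.rel_mem)
  fix Y assume Y: "N.two_sided Y" "relation \<in> Y"
  note Y' = N.two_sidedD[OF Y(1)]
  show "R.Jp \<subseteq> Y"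
    unfolding R.Jp_def
  proof (rule pm.span_minimal[OF _ Y'(1)], rule subsetI)
    fix g assume "g \<in> R.gens"
    then show "g \<in> Y"
    proof (cases rule: R.gens_cases)
      case (rel x i y)
      \<comment> \<open>The idempotent at i recovers the local relation from the global one, so the
        single generator suffices.\<close>
      have "R.pmul (wd (i, [])) relation = (\<Sum>j\<in>verts G. if i = j then R.rel j else 0)"
        unfolding relation_def by (simp add: linear_opD(4)[OF R.linear_op_pmul_right] R.idem_rel)
      also have "\<dots> = R.rel i" using rel(1) R.finite_verts by simp
      finally have "R.rel i \<in> Y" using Y'(4)[OF Y(2)] by metis
      then show ?thesis unfolding rel(2) by (intro Y'(3) Y'(4))
    next
      case (nonpath x)
      then show ?thesis using nonpath_in_Np Y'(2) by blast
    qed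
  qed
qed

section \<open>The preprojective algebra as a quotient\<close>

abbreviation P where "P \<equiv> preprojective_algebra k Q"

definition \<pi> :: "('v \<times> ('a \<times> bool) list \<Rightarrow>\<^sub>0 'k) \<Rightarrow> ('v \<times> ('a \<times> bool) list \<Rightarrow> 'k) set" where
  "\<pi> f = preprojective_ideal k Q +>\<^bsub>A\<^esub> res f"

sublocale J: ideal "preprojective_ideal k Q" A
  unfolding preprojective_ideal_eq by (rule AR.ideal_image[OF two_sided_Jp_N])

lemma \<pi>_eq_iff: "\<pi> f = \<pi> g \<longleftrightarrow> f - g \<in> R.Jp"
  unfolding \<pi>_def preprojective_ideal_eq by (rule AR.coset_eq_iff[OF two_sided_Jp_N])

lemma P_simps:
  "carrier P = carrier (A Quot preprojective_ideal k Q)" "monoid.mult P = monoid.mult (A Quot preprojective_ideal k Q)"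
  "\<one>\<^bsub>P\<^esub> = \<one>\<^bsub>A Quot preprojective_ideal k Q\<^esub>" "\<zero>\<^bsub>P\<^esub> = \<zero>\<^bsub>A Quot preprojective_ideal k Q\<^esub>"
  "add P = add (A Quot preprojective_ideal k Q)"
  "module.smult P = (\<lambda>c X. \<Union>x\<in>X. preprojective_ideal k Q +>\<^bsub>A\<^esub> (c \<odot>\<^bsub>A\<^esub> x))"
  by (simp_all add: preprojective_algebra_def Let_def)

text \<open>Scalar multiplication is defined by a union over representatives; all cosets in the
  union agree because \<open>Jp\<close> is closed under scalars.\<close>

lemma \<pi>_smult: "\<pi> (smul c f) = c \<odot>\<^bsub>P\<^esub> \<pi> f"
proof -
  have mem: "\<exists>h. x = res h \<and> h - f \<in> R.Jp" if x: "x \<in> \<pi> f" for x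
  proof -
    obtain j where j: "j \<in> R.Jp" "x = res j \<oplus>\<^bsub>A\<^esub> res f"
      using x by (auto simp: \<pi>_def a_r_coset_def' preprojective_ideal_eq)
    then show ?thesis by (intro exI[of _ "j + f"]) (simp add: AR.rho_add)
  qed
  have self: "res f \<in> \<pi> f"
    unfolding \<pi>_def by (rule J.a_rcos_self) simp
  have "preprojective_ideal k Q +>\<^bsub>A\<^esub> (c \<odot>\<^bsub>A\<^esub> x) = \<pi> (smul c f)" if x: "x \<in> \<pi> f" for x
  proof -
    obtain h where h: "x = res h" "h - f \<in> R.Jp" using mem[OF x] by blast
    have "preprojective_ideal k Q +>\<^bsub>A\<^esub> (c \<odot>\<^bsub>A\<^esub> x) = \<pi> (smul c h)" by (simp add: h(1) \<pi>_def AR.rho_smult)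
    also have "\<dots> = \<pi> (smul c f)"
      unfolding \<pi>_eq_iff using pm.subspace_scale[OF R.subspace_Jp h(2), of c] by (simp add: pm.scale_right_diff_distrib)
    finally show ?thesis .
  qed
  with self show ?thesis unfolding P_simps by auto
qed

sublocale PR: algebra_rep smul R.pmul R.Jp u0 P \<pi>
proof (unfold_locales, unfold R.A.eqv_def)
  show "R.pmul x u0 - x \<in> R.Jp" "R.pmul u0 x - x \<in> R.Jp" for x
    by (rule R.right_unit_Jp, rule R.left_unit_Jp)
  show "carrier P = range \<pi>"
    using AR.cosets[OF two_sided_Jp_N] by (simp add: P_simps \<pi>_def[abs_def] preprojective_ideal_eq)
  show "\<pi> (f + g) = \<pi> f \<oplus>\<^bsub>P\<^esub> \<pi> g" for f g
    unfolding P_simps FactRing_def by (simp add: \<pi>_def AR.rho_add J.a_rcos_sum)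
  show "\<pi> (R.pmul f g) = \<pi> f \<otimes>\<^bsub>P\<^esub> \<pi> g" for f g
    unfolding P_simps FactRing_def by (simp add: \<pi>_def AR.rho_mult J.rcoset_mult_add)
  show "\<pi> u0 = \<one>\<^bsub>P\<^esub>"
    unfolding P_simps FactRing_def by (simp add: \<pi>_def res_unit)
  show "\<pi> 0 = \<zero>\<^bsub>P\<^esub>"
    unfolding P_simps FactRing_def \<pi>_def AR.rho_zero
    using AR.P.a_rcos_zero[OF J.ideal_axioms] by simp
qed (fact \<pi>_smult \<pi>_eq_iff)+

text \<open>The element 1 - e i is the sum of the other idempotents, and multiplying it by any of
  these recovers that idempotent.\<close>

lemma vertex_ideal_eq:
  assumes i: "i \<in> verts G"
  shows "vertex_ideal k Q i = \<pi> ` R.M.K {i}"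
proof -
  have "vertex_idempotent k Q i = \<pi> (R.idem i)"
    using i by (simp add: vertex_idempotent_def \<pi>_def R.idem_def res_path_elem R.paths_Nil)
  then have "vertex_ideal k Q i = Idl\<^bsub>P\<^esub> {\<pi> (u0 - R.idem i)}"
    by (simp add: vertex_ideal_def Let_def PR.rho_diff PR.rho_one)
  also have "\<dots> = \<pi> ` R.M.K {i}"
  proof (rule PR.genideal_image[OF R.M.two_sided_K])
    have u0: "u0 - R.idem i = (\<Sum>v\<in>verts G - {i}. R.idem v)"
      using i R.finite_verts by (simp add: sum.remove)
    show "u0 - R.idem i \<in> R.M.K {i}"
      unfolding u0 by (intro pm.subspace_sum[OF R.A.two_sidedD(1)[OF R.M.two_sided_K]] R.M.e_in_K) simp
    fix Y assume Y: "R.A.two_sided Y" "u0 - R.idem i \<in> Y"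
    show "R.M.K {i} \<subseteq> Y"
    proof (rule R.M.K_subset[OF Y(1)])
      fix v assume v: "v \<in> verts G - {i}"
      have "R.pmul (R.idem v) (u0 - R.idem i) = (\<Sum>w\<in>verts G - {i}. if w = v then R.idem v else 0)"
        unfolding u0 linear_opD(4)[OF R.linear_op_pmul_right]
        using v by (intro sum.cong) (auto simp: R.idem_idem R.idem_orth)
      also have "\<dots> = R.idem v" using v R.finite_verts by simp
      finally show "R.idem v \<in> Y" using R.A.two_sidedD(4)[OF Y] by metis
    qed
  qed
  finally show ?thesis .
qed

lemma word_ideal_eq: "set u \<subseteq> verts G \<Longrightarrow> word_ideal k Q u = \<pi> ` R.M.idl u"
proof (induction u)
  case Nil
  show ?case by (simp add: PR.carrier_P)
next
  case (Cons i u)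
  then show ?case
    by (simp add: vertex_ideal_eq PR.ideal_prod_image[OF R.M.two_sided_idl R.M.two_sided_K])
qed

lemma adj_iff: "R.M.adj i j \<longleftrightarrow> (\<exists>a\<in>arcs Q. {tail Q a, head Q a} = {i, j})"
proof
  assume "R.M.adj i j"
  then obtain c where c: "c \<in> arcs G" "tail G c = i" "head G c = j" unfolding R.M.adj_def by blast
  moreover obtain a s where "c = (a, s)" by (cases c)
  ultimately have "a \<in> arcs Q" "tail G (a, s) = i" "head G (a, s) = j" by (auto simp: arcs_G)
  then show "\<exists>a\<in>arcs Q. {tail Q a, head Q a} = {i, j}" by (intro bexI[of _ a]) (auto split: if_splits)
next
  assume "\<exists>a\<in>arcs Q. {tail Q a, head Q a} = {i, j}"
  then obtain a where a: "a \<in> arcs Q" "{tail Q a, head Q a} = {i, j}" by blast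
  then have "tail Q a = i \<and> head Q a = j \<or> tail Q a = j \<and> head Q a = i" by (auto simp: doubleton_eq_iff)
  then show "R.M.adj i j"
    unfolding R.M.adj_def using a(1) by (auto simp: arcs_G intro: bexI[of _ "(a, False)"] bexI[of _ "(a, True)"])
qed

sublocale WR: weyl_realization "verts G" R.M.adj Q
proof
  fix i j assume "i \<in> verts G" "j \<in> verts G"
  show "cartan_matrix Q i j = (if i = j then 2 else if R.M.adj i j then - 1 else 0)"
  proof (cases "R.M.adj i j")
    case True
    then obtain a where a: "a \<in> arcs Q" "{tail Q a, head Q a} = {i, j}" by (auto simp: adj_iff)
    then have "{a \<in> arcs Q. {tail Q a, head Q a} = {i, j}} = {a}" using arc_eqI by auto
    then show ?thesis using True by (simp add: cartan_matrix_def)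
  next
    case False
    then have e: "{a \<in> arcs Q. {tail Q a, head Q a} = {i, j}} = {}" by (auto simp: adj_iff)
    show ?thesis using False unfolding cartan_matrix_def e by simp
  qed
qed (rule verts_G[symmetric])

text \<open>The right annihilator of I_w is found from (w_0 w^-1) w = w_0. For the left one, w (w^-1
  w_0) = w_0 exhibits I_w as the right annihilator of the ideal of w^-1 w_0.\<close>

lemma dual_weyl_ideal:
  assumes w0: "longest_element Q w0" and w: "w \<in> carrier (weyl_group Q)"
  shows "module_isomorphic P (dual_left_module P (weyl_ideal k Q w))
      (quotient_left_module P (weyl_ideal k Q (w0 \<otimes>\<^bsub>weyl_group Q\<^esub> inv\<^bsub>weyl_group Q\<^esub> w)))"
    and "module_isomorphic P (dual_right_module P (weyl_ideal k Q w))
      (quotient_right_module P (weyl_ideal k Q (inv\<^bsub>weyl_group Q\<^esub> w \<otimes>\<^bsub>weyl_group Q\<^esub> w0)))"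
proof -
  obtain z where z: "R.M.longest z" "w0 = WR.el z" using WR.longest_el[OF w0] by blast
  obtain u where u: "set u \<subseteq> verts G" "w = WR.el u" using w by (auto simp: WR.carrier_weyl)
  have zV: "set z \<subseteq> verts G" by (rule R.M.longestD(1)[OF z(1)])
  obtain lam where lam: "R.A.frobenius_form lam" using R.M.exists_frobenius_form_longest[OF z(1)] by blast
  \<comment> \<open>The word chosen in \<open>weyl_ideal\<close> is arbitrary among the reduced
    ones; only its value in the group is known.\<close>
  define sr where "sr v = (SOME v'. reduced_expression Q (WR.el v) v')" for v
  have sr: "R.M.reduced (sr v)" "R.M.eqw (sr v) v" "set (sr v) \<subseteq> verts G" if "set v \<subseteq> verts G" for v
    using WR.some_reduced_expression[OF that] by (auto simp: sr_def R.M.reduced_def)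
  have ideal: "weyl_ideal k Q (WR.el v) = \<pi> ` R.M.idl (sr v)" if "set v \<subseteq> verts G" for v
    using word_ideal_eq[of "sr v"] sr(3)[OF that] by (simp add: weyl_ideal_def sr_def)
  define v1 v2 where "v1 = z @ rev u" and "v2 = rev u @ z"
  have v12: "set v1 \<subseteq> verts G" "set v2 \<subseteq> verts G" using u zV by (auto simp: v1_def v2_def)
  have el1: "w0 \<otimes>\<^bsub>weyl_group Q\<^esub> inv\<^bsub>weyl_group Q\<^esub> w = WR.el v1"
    using u z(2) zV by (simp add: WR.inv_el WR.mult_el v1_def)
  have el2: "inv\<^bsub>weyl_group Q\<^esub> w \<otimes>\<^bsub>weyl_group Q\<^esub> w0 = WR.el v2"
    using u z(2) zV by (simp add: WR.inv_el WR.mult_el v2_def)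
  have "R.M.eqw (sr v1 @ sr u) (v1 @ u)"
    by (intro R.M.eqw_append sr v12 u)
  also have "R.M.eqw (v1 @ u) z" using u(1) by (simp add: v1_def R.M.eqw_def R.M.act_rev')
  finally have "R.A.rann (R.M.idl (sr u)) = R.M.idl (sr v1)"
    by (intro R.M.rann_idl[OF lam z(1)] sr v12 u)
  then show "module_isomorphic P (dual_left_module P (weyl_ideal k Q w))
      (quotient_left_module P (weyl_ideal k Q (w0 \<otimes>\<^bsub>weyl_group Q\<^esub> inv\<^bsub>weyl_group Q\<^esub> w)))"
    unfolding el1 ideal[OF v12(1)] unfolding u(2) ideal[OF u(1)]
    by (rule PR.dual_left_isomorphic_quotient[OF lam R.M.two_sided_idl R.M.two_sided_idl])
  have "R.M.eqw (sr u @ sr v2) (u @ v2)"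
    by (intro R.M.eqw_append sr v12 u)
  also have "R.M.eqw (u @ v2) z" using u(1) by (simp add: v2_def R.M.eqw_def R.M.act_rev)
  finally have "R.A.lann (R.M.idl (sr u)) = R.M.idl (sr v2)"
    by (intro R.M.lann_idl[OF lam z(1)] sr v12 u)
  then show "module_isomorphic P (dual_right_module P (weyl_ideal k Q w))
      (quotient_right_module P (weyl_ideal k Q (inv\<^bsub>weyl_group Q\<^esub> w \<otimes>\<^bsub>weyl_group Q\<^esub> w0)))"
    unfolding el2 ideal[OF v12(2)] unfolding u(2) ideal[OF u(1)]
    by (rule PR.dual_right_isomorphic_quotient[OF lam R.M.two_sided_idl R.M.two_sided_idl])
qed

end

theorem proposition6p4:
  fixes Q :: "('v, 'a) pre_digraph"
    and k :: "'k::alg_closed_field itself"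
    and w w\<^sub>0 :: "('v \<Rightarrow> int) \<Rightarrow> ('v \<Rightarrow> int)"
  assumes "dynkin_quiver Q"
    and "longest_element Q w\<^sub>0"
    and "w \<in> carrier (weyl_group Q)"
  shows "module_isomorphic (preprojective_algebra k Q)
           (dual_left_module (preprojective_algebra k Q) (weyl_ideal k Q w))
           (quotient_left_module (preprojective_algebra k Q)
              (weyl_ideal k Q (w\<^sub>0 \<otimes>\<^bsub>weyl_group Q\<^esub> inv\<^bsub>weyl_group Q\<^esub> w)))
       \<and>
         module_isomorphic (preprojective_algebra k Q)
           (dual_right_module (preprojective_algebra k Q) (weyl_ideal k Q w))
           (quotient_right_module (preprojective_algebra k Q)
              (weyl_ideal k Q (inv\<^bsub>weyl_group Q\<^esub> w \<otimes>\<^bsub>weyl_group Q\<^esub> w\<^sub>0)))"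
proof -
  interpret simply_laced_quiver Q by (rule simply_laced_if_dynkin[OF assms(1)])
  interpret preprojective Q k ..
  show ?thesis by (intro conjI dual_weyl_ideal assms)
qed

end
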